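(* There exist absolute constants $K,K'>0$ such that the following holds. Let $n\ge1$, $\epsilon\ge0$, $\delta>0$ with $\delta\ge K\sqrt{\epsilon}$, and let $f\colon S_n\to\{0,1\}$ satisfy $\mathbb{E}[(f-\ell)^2]\le\epsilon$ for some linear $\ell\colon S_n\to\mathbb{R}$ and $\delta\le\mathbb{E}[f]\le1-\delta$. Then there is a dictator $g$ with $\Pr[f\neq g]\le K'\epsilon/\delta$.
   Context: $S_n$ is the symmetric group on $[n]$; expectations and probabilities are over uniformly random $\pi\in S_n$. $x_{i,j}(\pi)=1$ if $\pi(i)=j$ and $0$ otherwise; a function is linear if it equals $\sum_{i,j}c_{i,j}x_{i,j}$ for reals $c_{i,j}$. A dictator is a function of the form $\sum_{(i,j)\in\mathcal{C}}x_{i,j}$ where all elements of $\mathcal{C}\subseteq[n]^2$ share the same first coordinate or all share the same second coordinate. *)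

theory Defs
  imports "HOL-Probability.Probability" "HOL-Combinatorics.Permutations"
begin

text \<open>
  A function on $S_n$ is modelled by a function on all of \<open>nat \<Rightarrow> nat\<close> whose values outside
  \<open>sym_grp n\<close> are irrelevant: every condition below is restricted to \<open>sym_grp n\<close>.
\<close>

definition sym_grp :: "nat \<Rightarrow> (nat \<Rightarrow> nat) set" where
  "sym_grp n = {\<pi>. \<pi> permutes {1..n}}"

definition unif_perm :: "nat \<Rightarrow> (nat \<Rightarrow> nat) pmf" where
  "unif_perm n = pmf_of_set (sym_grp n)"

definition perm_entry :: "nat \<Rightarrow> nat \<Rightarrow> (nat \<Rightarrow> nat) \<Rightarrow> real" where
  "perm_entry i j \<pi> = (if \<pi> i = j then 1 else 0)"

definition linear_on_perms :: "nat \<Rightarrow> ((nat \<Rightarrow> nat) \<Rightarrow> real) \<Rightarrow> bool" where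
  "linear_on_perms n l \<longleftrightarrow>
     (\<exists>c :: nat \<Rightarrow> nat \<Rightarrow> real. \<forall>\<pi>\<in>sym_grp n.
        l \<pi> = (\<Sum>i=1..n. \<Sum>j=1..n. c i j * perm_entry i j \<pi>))"

text \<open>The set \<open>C\<close> may be empty, so the zero function counts as a dictator.\<close>

definition dictator :: "nat \<Rightarrow> ((nat \<Rightarrow> nat) \<Rightarrow> real) \<Rightarrow> bool" where
  "dictator n g \<longleftrightarrow>
     (\<exists>C \<subseteq> {1..n} \<times> {1..n}.
        ((\<exists>a. \<forall>(i, j)\<in>C. i = a) \<or> (\<exists>b. \<forall>(i, j)\<in>C. j = b)) \<and>
        (\<forall>\<pi>\<in>sym_grp n. g \<pi> = (\<Sum>(i, j)\<in>C. perm_entry i j \<pi>)))"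

end

theory Submission
  imports Defs
begin

text \<open>
  A random subcube of \<open>S\<^sub>n\<close> is obtained by pairing up the rows and swapping the values within an
  arbitrary set of pairs; on it a linear function is affine, and its slopes are the quantities
  \<open>c i v + c u j - c i j - c u v\<close>. An affine function that is close to Boolean on the cube has at
  most one slope that is not small, and that slope is close to \<open>\<plusminus>1\<close>, up to a total squared error
  \<open>O(\<epsilon>)\<close>. Averaging over all subcubes, the coefficients of \<open>l\<close> can be rounded to integers while
  keeping an error \<open>O(\<epsilon>)\<close>.

  Once the coefficients are integers and mostly zero in every line, two nonzero entries in different
  rows and columns yield many subcubes with two large slopes, so there are only \<open>O(\<epsilon> n\<^sup>2)\<close> such
  pairs. As there are at least \<open>\<delta> n / 2\<close> nonzero entries, all but \<open>O(\<epsilon> n / \<delta>)\<close> of them lie in one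
  line. For bounded \<open>n\<close> the rounded function equals \<open>f\<close>, and an exact argument applies.
\<close>

section \<open>Nearly Boolean affine functions on the cube\<close>

text \<open>The coefficients of a linear function on \<open>sym_grp n\<close> are not unique: adding
  a constant to a row or a column of \<open>c\<close> changes the function by a constant only. The
  slopes \<open>quad\<close> do not see this freedom, so they are what can be shown to be close to
  integers; coefficients can be rounded only after a base entry \<open>(i0, v0)\<close>, found by
  averaging, has been used to normalise its row and column to 0. The same freedom is used again on
  the integer matrix, whose lines may be filled with a common nonzero value. The size of
  \<open>K\<close> answers two demands. For large \<open>n\<close> there are
  \<open>O(\<epsilon> * n\<^sup>2)\<close> conflicting pairs among at least
  \<open>(\<delta> * n / 2)\<^sup>2\<close> pairs of nonzero entries, and a dominating line exists
  only if the former are a small fraction, that is, if \<open>\<epsilon>\<close> is small against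
  \<open>\<delta>\<^sup>2\<close>. For bounded \<open>n\<close> the error has to fall below
  \<open>1 / n!\<close>. The loss \<open>1 / \<delta>\<close> arises when the number of conflicts is
  divided by the number of nonzero entries, which bounds the entries off the line; each of them is
  met with probability \<open>1 / n\<close>.\<close>

definition cavg :: "'a set \<Rightarrow> ('a set \<Rightarrow> real) \<Rightarrow> real" where
  "cavg I \<phi> = (\<Sum>Y\<in>Pow I. \<phi> Y) / 2 ^ card I"

text \<open>A Rademacher sum: the subset \<open>Y\<close> encodes the sign vector that is +1 on
  \<open>Y\<close> and -1 on the rest of \<open>I\<close>, and \<open>cavg\<close> averages over all
  sign vectors.\<close>

definition rsum :: "'a set \<Rightarrow> ('a \<Rightarrow> real) \<Rightarrow> 'a set \<Rightarrow> real" where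
  "rsum I a Y = (\<Sum>k\<in>I. if k \<in> Y then a k else - a k)"

lemma cavg_add: "cavg I (\<lambda>Y. f Y + g Y) = cavg I f + cavg I g"
  by (simp add: cavg_def sum.distrib add_divide_distrib)

lemma cavg_diff: "cavg I (\<lambda>Y. f Y - g Y) = cavg I f - cavg I g"
  by (simp add: cavg_def sum_subtractf diff_divide_distrib)

lemma cavg_cmult: "cavg I (\<lambda>Y. r * f Y) = r * cavg I f"
  by (simp add: cavg_def sum_distrib_left)

lemma cavg_divide: "cavg I (\<lambda>Y. f Y / r) = cavg I f / r"
  by (simp add: cavg_def sum_divide_distrib[symmetric])

lemma cavg_const: "finite I \<Longrightarrow> cavg I (\<lambda>Y. r) = r"
  by (simp add: cavg_def card_Pow)

lemma cavg_mono: "(\<And>Y. Y \<subseteq> I \<Longrightarrow> f Y \<le> g Y) \<Longrightarrow> cavg I f \<le> cavg I g"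
  by (auto simp: cavg_def intro!: divide_right_mono sum_mono)

lemma cavg_cong: "(\<And>Y. Y \<subseteq> I \<Longrightarrow> f Y = g Y) \<Longrightarrow> cavg I f = cavg I g"
  by (auto simp: cavg_def intro!: sum.cong)

lemma cavg_nonneg: "(\<And>Y. Y \<subseteq> I \<Longrightarrow> 0 \<le> f Y) \<Longrightarrow> 0 \<le> cavg I f"
  by (auto simp: cavg_def intro!: divide_nonneg_pos sum_nonneg)

lemma cavg_insert:
  assumes "finite I" "k \<notin> I"
  shows "cavg (insert k I) \<phi> = cavg I (\<lambda>Y. (\<phi> Y + \<phi> (insert k Y)) / 2)"
proof -
  have disj: "Pow I \<inter> insert k ` Pow I = {}" using assms by auto
  have inj: "inj_on (insert k) (Pow I)" using assms by (intro inj_onI) (metis PowD insert_ident subsetD)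
  have "(\<Sum>Y\<in>Pow (insert k I). \<phi> Y) = (\<Sum>Y\<in>Pow I. \<phi> Y) + (\<Sum>Y\<in>insert k ` Pow I. \<phi> Y)"
    unfolding Pow_insert by (rule sum.union_disjoint) (use assms disj in auto)
  also have "(\<Sum>Y\<in>insert k ` Pow I. \<phi> Y) = (\<Sum>Y\<in>Pow I. \<phi> (insert k Y))"
    using inj by (simp add: sum.reindex)
  finally show ?thesis using assms
    by (simp add: cavg_def sum.distrib sum_divide_distrib[symmetric])
qed

lemma rsum_insert:
  assumes "finite I" "k \<notin> I" "Y \<subseteq> I"
  shows "rsum (insert k I) a Y = rsum I a Y - a k"
    and "rsum (insert k I) a (insert k Y) = rsum I a Y + a k"
proof -
  show "rsum (insert k I) a Y = rsum I a Y - a k"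
    using assms by (auto simp: rsum_def)
  have "(\<Sum>i\<in>I. if i \<in> insert k Y then a i else - a i) = (\<Sum>i\<in>I. if i \<in> Y then a i else - a i)"
    by (rule sum.cong) (use assms in auto)
  then show "rsum (insert k I) a (insert k Y) = rsum I a Y + a k"
    using assms by (simp add: rsum_def)
qed

text \<open>Conditioning on the sign of \<open>k\<close>, the induction step of the moment
  computations. Two sums driven by the same signs are carried along so that mixed moments are
  covered.\<close>

lemma cavg_insert_rsum:
  assumes "finite I" "k \<notin> I"
  shows "cavg (insert k I) (\<lambda>Y. \<phi> (rsum (insert k I) a Y) (rsum (insert k I) b Y))
    = cavg I (\<lambda>Y. (\<phi> (rsum I a Y - a k) (rsum I b Y - b k) + \<phi> (rsum I a Y + a k) (rsum I b Y + b k)) / 2)"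
  using assms by (simp add: cavg_insert rsum_insert cong: cavg_cong)

section \<open>Moments of Rademacher sums\<close>

lemma cavg_rsum_sq:
  assumes "finite I"
  shows "cavg I (\<lambda>Y. (rsum I a Y)\<^sup>2) = (\<Sum>k\<in>I. (a k)\<^sup>2)"
  using assms
proof (induction I)
  case empty
  then show ?case by (simp add: cavg_def rsum_def)
next
  case (insert k I)
  have eq: "((s - a k)\<^sup>2 + (s + a k)\<^sup>2) / 2 = s\<^sup>2 + (a k)\<^sup>2" for s
    by (simp add: power2_eq_square algebra_simps)
  then show ?case
    using insert cavg_insert_rsum[of I k "\<lambda>s t. s\<^sup>2" a a] unfolding eq by (simp add: cavg_add cavg_const)
qed

text \<open>Khinchine's inequality for the fourth moment. In the expansion the odd powers cancel,
  and raising \<open>(a k)^4\<close> to \<open>3 * (a k)^4\<close> completes the square of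
  \<open>(a k)\<^sup>2 + V\<close>.\<close>

lemma cavg_rsum_pow4:
  assumes "finite I"
  shows "cavg I (\<lambda>Y. (rsum I a Y)^4) \<le> 3 * (\<Sum>k\<in>I. (a k)\<^sup>2)\<^sup>2"
  using assms
proof (induction I)
  case empty
  then show ?case by (simp add: cavg_def rsum_def)
next
  case (insert k I)
  define V where "V = (\<Sum>k\<in>I. (a k)\<^sup>2)"
  have eq: "((s - a k)^4 + (s + a k)^4) / 2 = s^4 + (6 * (a k)\<^sup>2 * s\<^sup>2 + (a k)^4)" for s
    by (simp add: power4_eq_xxxx power2_eq_square algebra_simps)
  have "cavg (insert k I) (\<lambda>Y. (rsum (insert k I) a Y)^4)
     = cavg I (\<lambda>Y. (rsum I a Y)^4) + (6 * (a k)\<^sup>2 * V + (a k)^4)"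
    using insert cavg_insert_rsum[of I k "\<lambda>s t. s^4" a a] unfolding eq
    by (simp add: cavg_add cavg_const cavg_cmult cavg_rsum_sq V_def)
  also have "\<dots> \<le> 3 * V\<^sup>2 + (6 * (a k)\<^sup>2 * V + 3 * (a k)^4)"
  proof -
    have "0 \<le> (a k)^4" by simp
    with insert.IH show ?thesis unfolding V_def by linarith
  qed
  also have "\<dots> = 3 * ((a k)\<^sup>2 + V)\<^sup>2" by (simp add: power4_eq_xxxx power2_eq_square algebra_simps)
  finally show ?case using insert by (simp add: V_def)
qed

text \<open>As \<open>a\<close> and \<open>b\<close> have disjoint supports, the two sums depend on
  disjoint sets of signs and are independent, so the expectation factors.\<close>

lemma cavg_rsum_22:
  assumes "finite I" "\<And>k. k \<in> I \<Longrightarrow> a k * b k = 0"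
  shows "cavg I (\<lambda>Y. (rsum I a Y)\<^sup>2 * (rsum I b Y)\<^sup>2) = (\<Sum>k\<in>I. (a k)\<^sup>2) * (\<Sum>k\<in>I. (b k)\<^sup>2)"
  using assms
proof (induction I)
  case empty
  then show ?case by (simp add: cavg_def rsum_def)
next
  case (insert k I)
  have ab: "a k = 0 \<or> b k = 0" using insert.prems by auto
  have eq: "((s - a k)\<^sup>2 * (t - b k)\<^sup>2 + (s + a k)\<^sup>2 * (t + b k)\<^sup>2) / 2
     = s\<^sup>2 * t\<^sup>2 + ((a k)\<^sup>2 * t\<^sup>2 + (b k)\<^sup>2 * s\<^sup>2)" for s t
    using ab by (auto simp: power2_eq_square field_simps)
  have "(a k)\<^sup>2 * (b k)\<^sup>2 = 0" using ab by auto
  then show ?case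
    using insert cavg_insert_rsum[of I k "\<lambda>s t. s\<^sup>2 * t\<^sup>2" a b] unfolding eq
    by (simp add: cavg_add cavg_cmult cavg_rsum_sq algebra_simps)
qed

text \<open>The same independence combined with the fourth moment bound. The induction runs on the
  product itself, so independence never has to be stated.\<close>

lemma cavg_rsum_42:
  assumes "finite I" "\<And>k. k \<in> I \<Longrightarrow> a k * b k = 0"
  shows "cavg I (\<lambda>Y. (rsum I a Y)^4 * (rsum I b Y)\<^sup>2) \<le> 3 * (\<Sum>k\<in>I. (a k)\<^sup>2)\<^sup>2 * (\<Sum>k\<in>I. (b k)\<^sup>2)"
  using assms
proof (induction I)
  case empty
  then show ?case by (simp add: cavg_def rsum_def)
next
  case (insert k I)
  define V W where "V = (\<Sum>k\<in>I. (a k)\<^sup>2)" and "W = (\<Sum>k\<in>I. (b k)\<^sup>2)"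
  have ab: "a k = 0 \<or> b k = 0" and ab': "a k * b k = 0" using insert.prems by auto
  have W0: "0 \<le> W" by (simp add: W_def sum_nonneg)
  have eq: "((s - a k)^4 * (t - b k)\<^sup>2 + (s + a k)^4 * (t + b k)\<^sup>2) / 2
     = s^4 * t\<^sup>2 + (6 * (a k)\<^sup>2 * (s\<^sup>2 * t\<^sup>2) + (a k)^4 * t\<^sup>2 + (b k)\<^sup>2 * s^4)" for s t
    using ab by (auto simp: power4_eq_xxxx power2_eq_square field_simps)
  have "cavg (insert k I) (\<lambda>Y. (rsum (insert k I) a Y)^4 * (rsum (insert k I) b Y)\<^sup>2)
     = cavg I (\<lambda>Y. (rsum I a Y)^4 * (rsum I b Y)\<^sup>2) + (6 * (a k)\<^sup>2 * (V * W) + (a k)^4 * W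
       + (b k)\<^sup>2 * cavg I (\<lambda>Y. (rsum I a Y)^4))"
    using insert cavg_insert_rsum[of I k "\<lambda>s t. s^4 * t\<^sup>2" a b] unfolding eq
    by (simp add: cavg_add cavg_cmult cavg_rsum_sq cavg_rsum_22 V_def W_def)
  also have "\<dots> \<le> 3 * V\<^sup>2 * W + (6 * (a k)\<^sup>2 * (V * W) + 3 * ((a k)^4 * W) + (b k)\<^sup>2 * (3 * V\<^sup>2))"
  proof -
    have "cavg I (\<lambda>Y. (rsum I a Y)^4 * (rsum I b Y)\<^sup>2) \<le> 3 * V\<^sup>2 * W"
      using insert by (simp add: V_def W_def)
    moreover have "(b k)\<^sup>2 * cavg I (\<lambda>Y. (rsum I a Y)^4) \<le> (b k)\<^sup>2 * (3 * V\<^sup>2)"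
      using cavg_rsum_pow4[OF insert.hyps(1), of a] by (intro mult_left_mono) (auto simp: V_def)
    moreover have "0 \<le> (a k)^4 * W" using W0 by simp
    ultimately show ?thesis by linarith
  qed
  also have "\<dots> = 3 * ((a k)\<^sup>2 + V)\<^sup>2 * ((b k)\<^sup>2 + W)"
    using ab by (auto simp: power4_eq_xxxx power2_eq_square algebra_simps)
  finally show ?case using insert by (simp add: V_def W_def)
qed

section \<open>The minimum of two independent squares\<close>

text \<open>Only polynomial moments are available, so \<open>min\<close> is replaced by a polynomial
  minorant. The bound by \<open>x\<close> is \<open>x * (1 - y / (2 * t))\<^sup>2 + x\<^sup>2 * y /
  (4 * t\<^sup>2) \<ge> 0\<close>, and the left side is symmetric in \<open>x\<close> and
  \<open>y\<close>.\<close>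

lemma min_ge_quartic:
  fixes x y t :: real
  assumes "0 \<le> x" "0 \<le> y" "0 < t"
  shows "x * y / t - (x\<^sup>2 * y + x * y\<^sup>2) / (4 * t\<^sup>2) \<le> min x y"
proof -
  have *: "x * y / t - (x\<^sup>2 * y + x * y\<^sup>2) / (4 * t\<^sup>2) \<le> x" if "0 \<le> x" "0 \<le> y" for x y :: real
  proof -
    have "0 \<le> x * (y - 2 * t)\<^sup>2 + x\<^sup>2 * y" using that by simp
    then show ?thesis using \<open>0 < t\<close>
      by (simp add: field_simps power2_eq_square)
  qed
  have "x * y / t - (x\<^sup>2 * y + x * y\<^sup>2) / (4 * t\<^sup>2) = y * x / t - (y\<^sup>2 * x + y * x\<^sup>2) / (4 * t\<^sup>2)"
    by (simp add: algebra_simps)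
  then show ?thesis using *[of x y] *[of y x] assms by (simp add: min_def)
qed

lemma cavg_min_ge_aux:
  assumes fin: "finite I" and ab: "\<And>k. k \<in> I \<Longrightarrow> a k * b k = 0"
    and "V = (\<Sum>k\<in>I. (a k)\<^sup>2)" "W = (\<Sum>k\<in>I. (b k)\<^sup>2)" "0 < V" "V \<le> W"
  shows "V / 6 \<le> cavg I (\<lambda>Y. min ((rsum I a Y)\<^sup>2) ((rsum I b Y)\<^sup>2))"
proof -
  \<comment> \<open>Scaling the square of the sum of \<open>b\<close> by \<open>r \<le> 1\<close>
    gives both squares the mean \<open>V\<close> and can only lower the minimum.\<close>
  define r where "r = V / W"
  have r: "0 < r" "r \<le> 1" "r * W = V" using assms by (auto simp: r_def)
  define x y where "x = (\<lambda>Y. (rsum I a Y)\<^sup>2)" and "y = (\<lambda>Y. (rsum I b Y)\<^sup>2)"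
  have xy: "cavg I (\<lambda>Y. x Y * (r * y Y)) = V * V"
    using cavg_rsum_22[OF fin ab] assms(3,4) r(3)
    by (simp add: x_def y_def mult.left_commute cavg_cmult)
  have xxy: "cavg I (\<lambda>Y. (x Y)\<^sup>2 * (r * y Y)) \<le> 3 * V^3"
  proof -
    have "cavg I (\<lambda>Y. (x Y)\<^sup>2 * (r * y Y)) = r * cavg I (\<lambda>Y. (rsum I a Y)^4 * (rsum I b Y)\<^sup>2)"
      by (simp add: x_def y_def mult.left_commute cavg_cmult flip: power_mult)
    also have "\<dots> \<le> r * (3 * V\<^sup>2 * W)"
      using cavg_rsum_42[OF fin ab] assms(3,4) r(1) by (intro mult_left_mono) auto
    also have "\<dots> = 3 * V\<^sup>2 * (r * W)" by simp
    also have "\<dots> = 3 * V^3" unfolding r(3) by (simp add: power2_eq_square power3_eq_cube)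
    finally show ?thesis .
  qed
  have xyy: "cavg I (\<lambda>Y. x Y * (r * y Y)\<^sup>2) \<le> 3 * V^3"
  proof -
    have "cavg I (\<lambda>Y. x Y * (r * y Y)\<^sup>2) = r\<^sup>2 * cavg I (\<lambda>Y. (rsum I b Y)^4 * (rsum I a Y)\<^sup>2)"
      by (simp add: x_def y_def power_mult_distrib mult.left_commute mult.commute cavg_cmult flip: power_mult)
    also have "\<dots> \<le> r\<^sup>2 * (3 * W\<^sup>2 * V)"
      using cavg_rsum_42[OF fin, of b a] ab assms(3,4) by (intro mult_left_mono) (auto simp: mult.commute)
    also have "\<dots> = 3 * (r * W)\<^sup>2 * V" by (simp add: power_mult_distrib)
    finally show ?thesis using r(3) by (simp add: power2_eq_square power3_eq_cube)
  qed
  \<comment> \<open>The minorant is used with \<open>t = 3 * V\<close>, which maximises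
    \<open>V\<^sup>2 / t - 6 * V^3 / (4 * t\<^sup>2)\<close>.\<close>
  have "V / 6 \<le> V * V / (3 * V) - (3 * V^3 + 3 * V^3) / (4 * (3 * V)\<^sup>2)"
    using \<open>0 < V\<close> by (simp add: power2_eq_square power3_eq_cube field_simps)
  also have "\<dots> \<le> cavg I (\<lambda>Y. x Y * (r * y Y)) / (3 * V)
      - (cavg I (\<lambda>Y. (x Y)\<^sup>2 * (r * y Y)) + cavg I (\<lambda>Y. x Y * (r * y Y)\<^sup>2)) / (4 * (3 * V)\<^sup>2)"
    unfolding xy using xxy xyy by (intro diff_left_mono divide_right_mono add_mono) auto
  also have "\<dots> = cavg I (\<lambda>Y. x Y * (r * y Y) / (3 * V)
      - ((x Y)\<^sup>2 * (r * y Y) + x Y * (r * y Y)\<^sup>2) / (4 * (3 * V)\<^sup>2))"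
    by (simp only: cavg_diff cavg_divide cavg_add)
  also have "\<dots> \<le> cavg I (\<lambda>Y. min (x Y) (y Y))"
  proof (rule cavg_mono)
    fix Y
    have "0 \<le> x Y" "0 \<le> y Y" by (auto simp: x_def y_def)
    then have "x Y * (r * y Y) / (3 * V) - ((x Y)\<^sup>2 * (r * y Y) + x Y * (r * y Y)\<^sup>2) / (4 * (3 * V)\<^sup>2)
        \<le> min (x Y) (r * y Y)"
      using r \<open>0 < V\<close> by (intro min_ge_quartic) auto
    also have "\<dots> \<le> min (x Y) (y Y)"
      using r \<open>0 \<le> y Y\<close> by (intro min.mono) (auto simp: mult_left_le_one_le)
    finally show "x Y * (r * y Y) / (3 * V) - ((x Y)\<^sup>2 * (r * y Y) + x Y * (r * y Y)\<^sup>2) / (4 * (3 * V)\<^sup>2)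
        \<le> min (x Y) (y Y)" .
  qed
  finally show ?thesis by (simp add: x_def y_def)
qed

lemma cavg_min_ge:
  assumes fin: "finite I" and ab: "\<And>k. k \<in> I \<Longrightarrow> a k * b k = 0"
  shows "min (\<Sum>k\<in>I. (a k)\<^sup>2) (\<Sum>k\<in>I. (b k)\<^sup>2) \<le> 6 * cavg I (\<lambda>Y. min ((rsum I a Y)\<^sup>2) ((rsum I b Y)\<^sup>2))"
proof -
  define V W where "V = (\<Sum>k\<in>I. (a k)\<^sup>2)" and "W = (\<Sum>k\<in>I. (b k)\<^sup>2)"
  have nn: "0 \<le> V" "0 \<le> W" by (auto simp: V_def W_def sum_nonneg)
  have nn': "0 \<le> cavg I (\<lambda>Y. min ((rsum I a Y)\<^sup>2) ((rsum I b Y)\<^sup>2))"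
    by (rule cavg_nonneg) auto
  consider "V = 0 \<or> W = 0" | "0 < V" "V \<le> W" | "0 < W" "W \<le> V" using nn by linarith
  then show ?thesis
  proof cases
    case 1
    then show ?thesis using nn nn' unfolding V_def[symmetric] W_def[symmetric] by auto
  next
    case 2
    then show ?thesis using cavg_min_ge_aux[OF fin ab V_def W_def 2] unfolding V_def[symmetric] W_def[symmetric] by simp
  next
    case 3
    have ba: "b k * a k = 0" if "k \<in> I" for k using ab[OF that] by (simp add: mult.commute)
    show ?thesis using cavg_min_ge_aux[OF fin ba W_def V_def 3] 3
      unfolding V_def[symmetric] W_def[symmetric] by (simp add: min.commute)
  qed
qed

text \<open>Each sign is symmetric, so negating some of the coefficients leaves the law of the sum
  unchanged. The test function \<open>\<phi>\<close> is generalised because the induction shifts its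
  argument.\<close>

lemma cavg_rsum_signs:
  assumes "finite I" "\<And>k. k \<in> I \<Longrightarrow> b k = a k \<or> b k = - a k"
  shows "cavg I (\<lambda>Y. \<phi> (rsum I b Y)) = cavg I (\<lambda>Y. \<phi> (rsum I a Y))"
  using assms
proof (induction I arbitrary: \<phi>)
  case empty
  then show ?case by (simp add: cavg_def rsum_def)
next
  case (insert k I)
  have IH: "cavg I (\<lambda>Y. \<psi> (rsum I b Y)) = cavg I (\<lambda>Y. \<psi> (rsum I a Y))" for \<psi>
    using insert by blast
  have split: "cavg (insert k I) (\<lambda>Y. \<phi> (rsum (insert k I) c Y))
     = (cavg I (\<lambda>Y. \<phi> (rsum I c Y - c k)) + cavg I (\<lambda>Y. \<phi> (rsum I c Y + c k))) / 2" for c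
    using cavg_insert_rsum[of I k "\<lambda>s t. \<phi> s" c c] insert.hyps
    by (simp add: add_divide_distrib cavg_add cavg_divide)
  have "b k = a k \<or> b k = - a k" using insert.prems by auto
  then show ?case
    unfolding split using IH[of "\<lambda>s. \<phi> (s - b k)"] IH[of "\<lambda>s. \<phi> (s + b k)"] by auto
qed

text \<open>If \<open>p + q\<close> and \<open>p - q\<close> have nearly equal absolute values, then
  \<open>p\<close> or \<open>q\<close> is small; this identity makes it quantitative.\<close>

lemma abs_sum_diff_sq: "(\<bar>p + q\<bar> - \<bar>p - q\<bar>)\<^sup>2 = 4 * min (p\<^sup>2) (q\<^sup>2)" for p q :: real
proof -
  have "\<bar>\<bar>p + q\<bar> - \<bar>p - q\<bar>\<bar> = 2 * min \<bar>p\<bar> \<bar>q\<bar>" by (auto simp: abs_if min_def)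
  then have "(\<bar>p + q\<bar> - \<bar>p - q\<bar>)\<^sup>2 = (2 * min \<bar>p\<bar> \<bar>q\<bar>)\<^sup>2" by (metis power2_abs)
  also have "\<dots> = 4 * min (p\<^sup>2) (q\<^sup>2)"
    by (auto simp: min_def power2_eq_square abs_le_square_iff[unfolded power2_eq_square])
  finally show ?thesis .
qed

text \<open>Flipping the signs outside \<open>J\<close> replaces \<open>p + q\<close> by \<open>p - q\<close> without changing the law.\<close>

lemma rsum_split_small:
  assumes fin: "finite I" and J: "J \<subseteq> I"
  shows "min (\<Sum>k\<in>J. (v k)\<^sup>2) (\<Sum>k\<in>I - J. (v k)\<^sup>2) \<le> 6 * cavg I (\<lambda>Y. (\<bar>rsum I v Y\<bar> - 1/2)\<^sup>2)"
proof -
  define a b where "a = (\<lambda>k. if k \<in> J then v k else 0)" and "b = (\<lambda>k. if k \<in> J then 0 else v k)"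
  have sa: "(\<Sum>k\<in>I. (a k)\<^sup>2) = (\<Sum>k\<in>J. (v k)\<^sup>2)"
    by (rule sum.mono_neutral_cong_right[OF fin J]) (auto simp: a_def)
  have sb: "(\<Sum>k\<in>I. (b k)\<^sup>2) = (\<Sum>k\<in>I - J. (v k)\<^sup>2)"
    by (rule sum.mono_neutral_cong_right[OF fin]) (auto simp: b_def)
  define w where "w = (\<lambda>k. a k - b k)"
  have pq: "rsum I v Y = rsum I a Y + rsum I b Y" "rsum I w Y = rsum I a Y - rsum I b Y" for Y
    by (auto simp: rsum_def w_def a_def b_def sum.distrib[symmetric] sum_subtractf[symmetric] intro!: sum.cong)
  have law: "cavg I (\<lambda>Y. (\<bar>rsum I w Y\<bar> - 1/2)\<^sup>2) = cavg I (\<lambda>Y. (\<bar>rsum I v Y\<bar> - 1/2)\<^sup>2)"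
    by (rule cavg_rsum_signs[OF fin, where \<phi>="\<lambda>s. (\<bar>s\<bar> - 1/2)\<^sup>2"]) (auto simp: w_def a_def b_def)
  have "4 * cavg I (\<lambda>Y. min ((rsum I a Y)\<^sup>2) ((rsum I b Y)\<^sup>2))
     = cavg I (\<lambda>Y. (\<bar>rsum I v Y\<bar> - \<bar>rsum I w Y\<bar>)\<^sup>2)"
    unfolding pq abs_sum_diff_sq by (simp add: cavg_cmult)
  also have "\<dots> \<le> cavg I (\<lambda>Y. 2 * (\<bar>rsum I v Y\<bar> - 1/2)\<^sup>2 + 2 * (\<bar>rsum I w Y\<bar> - 1/2)\<^sup>2)"
  proof (rule cavg_mono)
    fix Y
    have "(s - t)\<^sup>2 \<le> 2 * (s - 1/2)\<^sup>2 + 2 * (t - 1/2)\<^sup>2" for s t :: real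
    proof -
      have "2 * (s - 1/2)\<^sup>2 + 2 * (t - 1/2)\<^sup>2 - (s - t)\<^sup>2 = (s + t - 1)\<^sup>2"
        by (simp add: power2_eq_square algebra_simps)
      then show ?thesis by (smt (verit) zero_le_power2)
    qed
    then show "(\<bar>rsum I v Y\<bar> - \<bar>rsum I w Y\<bar>)\<^sup>2 \<le> 2 * (\<bar>rsum I v Y\<bar> - 1/2)\<^sup>2 + 2 * (\<bar>rsum I w Y\<bar> - 1/2)\<^sup>2" .
  qed
  also have "\<dots> = 4 * cavg I (\<lambda>Y. (\<bar>rsum I v Y\<bar> - 1/2)\<^sup>2)"
    by (simp add: cavg_add cavg_cmult law)
  finally have "cavg I (\<lambda>Y. min ((rsum I a Y)\<^sup>2) ((rsum I b Y)\<^sup>2)) \<le> cavg I (\<lambda>Y. (\<bar>rsum I v Y\<bar> - 1/2)\<^sup>2)"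
    by simp
  moreover have "a k * b k = 0" for k by (simp add: a_def b_def)
  ultimately show ?thesis using cavg_min_ge[OF fin, of a b] by (simp add: sa sb)
qed

text \<open>If one point weighs more than \<open>t\<close>, its complement weighs at most
  \<open>t\<close>. Otherwise take a largest set \<open>J\<close> of weight at most
  \<open>t\<close>: one more point takes it above \<open>t\<close>, so what then remains is light
  again, and the total is at most \<open>t + t + t\<close>.\<close>

lemma concentrated_weight:
  fixes w :: "'a \<Rightarrow> real"
  assumes fin: "finite X" and ne: "X \<noteq> {}" and nn: "\<And>x. x \<in> X \<Longrightarrow> 0 \<le> w x" and t: "0 \<le> t"
    and split: "\<And>J. J \<subseteq> X \<Longrightarrow> min (sum w J) (sum w (X - J)) \<le> t"
  shows "\<exists>x\<in>X. sum w (X - {x}) \<le> 3 * t"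
proof (cases "\<exists>x\<in>X. t < w x")
  case True
  then obtain x where x: "x \<in> X" "t < w x" by auto
  then have "sum w (X - {x}) \<le> t" using split[of "{x}"] by auto
  moreover have "t \<le> 3 * t" using t by simp
  ultimately show ?thesis using x(1) by (meson order_trans)
next
  case False
  then have small: "w x \<le> t" if "x \<in> X" for x using that by force
  define \<J> where "\<J> = {J. J \<subseteq> X \<and> sum w J \<le> t}"
  have "finite \<J>" "{} \<in> \<J>" using fin t by (auto simp: \<J>_def)
  then obtain J where J: "J \<in> \<J>" and max: "\<And>J'. J' \<in> \<J> \<Longrightarrow> card J' \<le> card J"
    using finite_has_maximal[of "card ` \<J>"]
    by (metis (no_types, lifting) Max_ge Max_in empty_iff finite_imageI image_iff image_is_empty imageI)
  have tot: "sum w X \<le> 3 * t"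
  proof (cases "J = X")
    case True
    then show ?thesis using J t by (auto simp: \<J>_def)
  next
    case False
    then obtain x where x: "x \<in> X" "x \<notin> J" using J by (auto simp: \<J>_def)
    have fJ: "finite J" using J fin by (auto simp: \<J>_def intro: finite_subset)
    have "insert x J \<notin> \<J>" using max[of "insert x J"] x fJ by auto
    then have "t < sum w (insert x J)" using x J by (auto simp: \<J>_def)
    moreover have "insert x J \<subseteq> X" using x J by (auto simp: \<J>_def)
    ultimately have "sum w (X - insert x J) \<le> t" using split[of "insert x J"] by linarith
    moreover have "sum w X = sum w (X - insert x J) + sum w (insert x J)"
      by (rule sum.subset_diff) (use \<open>insert x J \<subseteq> X\<close> fin in auto)
    moreover have "sum w (insert x J) = w x + sum w J" using x fJ by simp
    ultimately show ?thesis using small[OF x(1)] J by (auto simp: \<J>_def)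
  qed
  obtain x where x: "x \<in> X" using ne by auto
  have "sum w (X - {x}) \<le> sum w X" using fin nn by (intro sum_mono2) auto
  then show ?thesis using x tot by force
qed

text \<open>By \<open>rsum_split_small\<close> every split of \<open>I\<close> has a light side, so
  \<open>concentrated_weight\<close> applies to the squares of the coefficients; 18 is 3 times
  6.\<close>

lemma rsum_concentrated:
  fixes v :: "'a \<Rightarrow> real"
  assumes fin: "finite I" and ne: "I \<noteq> {}"
  shows "\<exists>k\<in>I. (\<Sum>i\<in>I - {k}. (v i)\<^sup>2) \<le> 18 * cavg I (\<lambda>Y. (\<bar>rsum I v Y\<bar> - 1/2)\<^sup>2)"
  using concentrated_weight[OF fin ne, of "\<lambda>k. (v k)\<^sup>2" "6 * cavg I (\<lambda>Y. (\<bar>rsum I v Y\<bar> - 1/2)\<^sup>2)"]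
    rsum_split_small[OF fin] cavg_nonneg[of I "\<lambda>Y. (\<bar>rsum I v Y\<bar> - 1/2)\<^sup>2"]
  by (auto simp: mult.assoc)

text \<open>The nearest point of -1, 0, 1, the only slopes that a Boolean function affine on the
  cube can have. Ties go to 0.\<close>

definition rd :: "real \<Rightarrow> int" where
  "rd d = (if d > 1/2 then 1 else if d < -1/2 then -1 else 0)"

lemma rd_sq_le:
  "(d - of_int (rd d))\<^sup>2 \<le> d\<^sup>2" "(d - of_int (rd d))\<^sup>2 \<le> (\<bar>d\<bar> - 1)\<^sup>2"
  unfolding abs_le_square_iff[symmetric] by (auto simp: rd_def)

text \<open>Passing from 0/1 indicators to signs halves the slopes and moves half of their sum into
  the constant term.\<close>

lemma rsum_eq_subset_sum:
  assumes "finite I" "Y \<subseteq> I"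
  shows "A + (\<Sum>k\<in>Y. d k) = A + (\<Sum>k\<in>I. d k) / 2 + rsum I (\<lambda>k. d k / 2) Y"
proof -
  have "rsum I (\<lambda>k. d k / 2) Y = (\<Sum>k\<in>I. (if k \<in> Y then d k else 0) - d k / 2)"
    unfolding rsum_def by (rule sum.cong) auto
  also have "\<dots> = (\<Sum>k\<in>Y. d k) - (\<Sum>k\<in>I. d k) / 2"
    using assms by (simp add: sum_subtractf sum_divide_distrib sum.inter_restrict[symmetric] Int_absorb1)
  finally show ?thesis by simp
qed

text \<open>A Friedgut-Kalai-Naor theorem. Centred at 1/2, a Boolean function has modulus 1/2, so
  the affine function becomes a Rademacher sum of modulus close to 1/2, and by
  \<open>rsum_concentrated\<close> one coefficient carries nearly all the weight. For the second
  claim, every other slope of modulus at least 1/2 contributes 1/4 or more to a sum of squares that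
  is at most \<open>72 * \<theta>\<close>.\<close>

lemma cube_fkn:
  fixes A :: real and d :: "nat \<Rightarrow> real" and g :: "nat set \<Rightarrow> real"
  assumes fin: "finite I" and k0: "k0 \<notin> I" and g: "\<And>Y. Y \<subseteq> I \<Longrightarrow> g Y \<in> {0, 1}"
  defines "\<eta> \<equiv> cavg I (\<lambda>Y. (g Y - (A + (\<Sum>k\<in>Y. d k)))\<^sup>2)"
  shows "(\<Sum>k\<in>I. (d k - of_int (rd (d k)))\<^sup>2) \<le> 224 * \<eta>"
    and "real (card {k\<in>I. 1/2 \<le> \<bar>d k\<bar>}) \<le> 1 + 288 * \<eta>"
proof -
  \<comment> \<open>The auxiliary coordinate \<open>k0\<close> carries the constant term, centred by
    1/2, so that the affine function becomes a homogeneous sum.\<close>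
  define v where "v = (\<lambda>k. if k = k0 then A + (\<Sum>k\<in>I. d k) / 2 - 1/2 else d k / 2)"
  define X where "X = insert k0 I"
  define \<theta> where "\<theta> = cavg X (\<lambda>Y. (\<bar>rsum X v Y\<bar> - 1/2)\<^sup>2)"
  have rv: "rsum I v Y = rsum I (\<lambda>k. d k / 2) Y" for Y
    unfolding rsum_def by (rule sum.cong) (use k0 in \<open>auto simp: v_def\<close>)
  \<comment> \<open>Negating all other signs shows that the sign of \<open>k0\<close> does not
    affect the average, so \<open>\<theta>\<close> equals the average with that sign fixed to
    +1.\<close>
  have flip: "cavg I (\<lambda>Y. (\<bar>rsum I v Y - v k0\<bar> - 1/2)\<^sup>2) = cavg I (\<lambda>Y. (\<bar>rsum I v Y + v k0\<bar> - 1/2)\<^sup>2)"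
  proof -
    have "rsum I (\<lambda>k. - v k) Y = - rsum I v Y" for Y
      unfolding rsum_def sum_negf[symmetric] by (rule sum.cong) auto
    then have "\<bar>rsum I (\<lambda>k. - v k) Y - v k0\<bar> = \<bar>rsum I v Y + v k0\<bar>" for Y by simp
    then show ?thesis
      using cavg_rsum_signs[OF fin, of "\<lambda>k. - v k" v "\<lambda>s. (\<bar>s - v k0\<bar> - 1/2)\<^sup>2"] by simp
  qed
  have "\<theta> = cavg I (\<lambda>Y. (\<bar>rsum I v Y + v k0\<bar> - 1/2)\<^sup>2)"
    unfolding \<theta>_def X_def
    using cavg_insert_rsum[OF fin k0, of "\<lambda>s t. (\<bar>s\<bar> - 1/2)\<^sup>2" v v] flip
    by (simp add: add_divide_distrib cavg_add cavg_divide)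
  also have "\<dots> \<le> \<eta>"
    unfolding \<eta>_def
  proof (rule cavg_mono)
    fix Y assume Y: "Y \<subseteq> I"
    have L: "A + (\<Sum>k\<in>Y. d k) = rsum I v Y + v k0 + 1/2"
      using rsum_eq_subset_sum[OF fin Y, of A d] unfolding rv by (simp add: v_def)
    show "(\<bar>rsum I v Y + v k0\<bar> - 1/2)\<^sup>2 \<le> (g Y - (A + (\<Sum>k\<in>Y. d k)))\<^sup>2"
      unfolding L using g[OF Y] by (auto simp: abs_le_square_iff[symmetric] abs_if)
  qed
  finally have \<theta>\<eta>: "\<theta> \<le> \<eta>" .
  have finX: "finite X" "X \<noteq> {}" using fin by (auto simp: X_def)
  obtain k where k: "k \<in> X" and conc: "(\<Sum>i\<in>X - {k}. (v i)\<^sup>2) \<le> 18 * \<theta>"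
    using rsum_concentrated[OF finX, of v] unfolding \<theta>_def by blast
  have I_minus: "(\<Sum>i\<in>I - {k}. (d i)\<^sup>2) \<le> 72 * \<theta>"
  proof -
    have "(\<Sum>i\<in>I - {k}. (d i)\<^sup>2) = 4 * (\<Sum>i\<in>I - {k}. (v i)\<^sup>2)"
      unfolding sum_distrib_left by (rule sum.cong) (use k0 in \<open>auto simp: v_def power_divide\<close>)
    also have "\<dots> \<le> 4 * (\<Sum>i\<in>X - {k}. (v i)\<^sup>2)"
      using fin by (intro mult_left_mono sum_mono2) (auto simp: X_def)
    finally show ?thesis using conc by simp
  qed
  \<comment> \<open>The dominant coefficient has modulus near 1/2: the whole sum has mean squared
    error \<open>\<theta>\<close> and the rest has second moment at most
    \<open>18 * \<theta>\<close>. This gives \<open>2 + 2 * 18 = 38\<close> for \<open>v k\<close>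
    and \<open>4 * 38 = 152\<close> after doubling.\<close>
  have main: "(2 * \<bar>v k\<bar> - 1)\<^sup>2 \<le> 152 * \<theta>"
  proof -
    define v' where "v' = v(k := 0)"
    have dec: "rsum X v Y = (if k \<in> Y then v k else - v k) + rsum X v' Y" for Y
    proof -
      have "rsum X v' Y = rsum (X - {k}) v Y"
        unfolding rsum_def by (rule sum.mono_neutral_cong_right) (use finX in \<open>auto simp: v'_def\<close>)
      then show ?thesis using sum.remove[OF finX(1) k, of "\<lambda>i. if i \<in> Y then v i else - v i"] by (simp add: rsum_def)
    qed
    have sq: "cavg X (\<lambda>Y. (rsum X v' Y)\<^sup>2) \<le> 18 * \<theta>"
    proof -
      have "(\<Sum>i\<in>X. (v' i)\<^sup>2) = (\<Sum>i\<in>X - {k}. (v i)\<^sup>2)"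
        by (rule sum.mono_neutral_cong_right) (use finX in \<open>auto simp: v'_def\<close>)
      then show ?thesis using conc by (simp add: cavg_rsum_sq finX)
    qed
    have "(\<bar>v k\<bar> - 1/2)\<^sup>2 = cavg X (\<lambda>Y. (\<bar>v k\<bar> - 1/2)\<^sup>2)" by (simp add: cavg_const finX)
    also have "\<dots> \<le> cavg X (\<lambda>Y. 2 * (\<bar>rsum X v Y\<bar> - 1/2)\<^sup>2 + 2 * (rsum X v' Y)\<^sup>2)"
    proof (rule cavg_mono)
      fix Y
      define s r where "s = \<bar>rsum X v Y\<bar> - 1/2" and "r = rsum X v' Y"
      have "\<bar>\<bar>v k\<bar> - 1/2\<bar> \<le> \<bar>s\<bar> + \<bar>r\<bar>"
        unfolding s_def r_def dec by (auto simp: abs_if)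
      then have "(\<bar>v k\<bar> - 1/2)\<^sup>2 \<le> (\<bar>s\<bar> + \<bar>r\<bar>)\<^sup>2" by (metis abs_ge_zero abs_le_square_iff abs_of_nonneg add_nonneg_nonneg)
      also have "\<dots> \<le> 2 * s\<^sup>2 + 2 * r\<^sup>2"
        using sum_squares_bound[of "\<bar>s\<bar>" "\<bar>r\<bar>"] by (simp add: power2_sum)
      finally show "(\<bar>v k\<bar> - 1/2)\<^sup>2 \<le> 2 * (\<bar>rsum X v Y\<bar> - 1/2)\<^sup>2 + 2 * (rsum X v' Y)\<^sup>2"
        by (simp add: s_def r_def)
    qed
    also have "\<dots> \<le> 38 * \<theta>" using sq by (simp add: cavg_add cavg_cmult \<theta>_def)
    finally have "4 * (\<bar>v k\<bar> - 1/2)\<^sup>2 \<le> 152 * \<theta>" by simp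
    moreover have "(2 * \<bar>v k\<bar> - 1)\<^sup>2 = 4 * (\<bar>v k\<bar> - 1/2)\<^sup>2" by (simp add: power2_eq_square algebra_simps)
    ultimately show ?thesis by simp
  qed
  have rest: "(\<Sum>i\<in>I - {k}. (d i - of_int (rd (d i)))\<^sup>2) \<le> 72 * \<theta>"
    by (rule order_trans[OF sum_mono I_minus]) (rule rd_sq_le)
  have \<theta>0: "0 \<le> \<theta>" unfolding \<theta>_def by (rule cavg_nonneg) auto
  \<comment> \<open>If the dominant coefficient belongs to the constant term, the bound for the
    other slopes covers all of \<open>I\<close>. Otherwise \<open>d k\<close> is close to 1 or -1
    and its rounding error is added: 224 = 72 + 152.\<close>
  have "(\<Sum>k\<in>I. (d k - of_int (rd (d k)))\<^sup>2) \<le> 224 * \<theta>"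
  proof (cases "k \<in> I")
    case True
    then have "v k = d k / 2" using k0 by (auto simp: v_def)
    then have "\<bar>d k\<bar> = 2 * \<bar>v k\<bar>" by simp
    then have "(\<bar>d k\<bar> - 1)\<^sup>2 \<le> 152 * \<theta>" using main by simp
    then have "(d k - of_int (rd (d k)))\<^sup>2 \<le> 152 * \<theta>" using rd_sq_le(2)[of "d k"] by linarith
    then show ?thesis using rest sum.remove[OF fin True, of "\<lambda>k. (d k - of_int (rd (d k)))\<^sup>2"] by simp
  next
    case False
    then show ?thesis using rest \<theta>0 by simp
  qed
  then show "(\<Sum>k\<in>I. (d k - of_int (rd (d k)))\<^sup>2) \<le> 224 * \<eta>" using \<theta>\<eta> by simp
  have "real (card {i\<in>I - {k}. 1/2 \<le> \<bar>d i\<bar>}) \<le> 288 * \<theta>"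
  proof -
    have "real (card {i\<in>I - {k}. 1/2 \<le> \<bar>d i\<bar>}) = (\<Sum>i\<in>{i\<in>I - {k}. 1/2 \<le> \<bar>d i\<bar>}. 1)" by simp
    also have "\<dots> \<le> (\<Sum>i\<in>{i\<in>I - {k}. 1/2 \<le> \<bar>d i\<bar>}. 4 * (d i)\<^sup>2)"
    proof (rule sum_mono)
      fix i assume "i \<in> {i\<in>I - {k}. 1/2 \<le> \<bar>d i\<bar>}"
      then have "(1/2)\<^sup>2 \<le> (d i)\<^sup>2" by (simp add: abs_le_square_iff[symmetric])
      then show "1 \<le> 4 * (d i)\<^sup>2" by (simp add: power2_eq_square)
    qed
    also have "\<dots> \<le> (\<Sum>i\<in>I - {k}. 4 * (d i)\<^sup>2)" using fin by (intro sum_mono2) auto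
    also have "\<dots> \<le> 288 * \<theta>" using I_minus by (simp flip: sum_distrib_left)
    finally show ?thesis .
  qed
  moreover have "card {i\<in>I. 1/2 \<le> \<bar>d i\<bar>} \<le> 1 + card {i\<in>I - {k}. 1/2 \<le> \<bar>d i\<bar>}"
  proof -
    have "card {i\<in>I. 1/2 \<le> \<bar>d i\<bar>} \<le> card (insert k {i\<in>I - {k}. 1/2 \<le> \<bar>d i\<bar>})"
      using fin by (intro card_mono) auto
    then show ?thesis using fin by (simp add: card_insert_if)
  qed
  ultimately show "real (card {k\<in>I. 1/2 \<le> \<bar>d k\<bar>}) \<le> 1 + 288 * \<eta>" using \<theta>\<eta> by linarith
qed

section \<open>Random subcubes of the symmetric group\<close>

text \<open>Composing with the transposition of \<open>x\<close> and its prescribed image makes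
  \<open>x\<close> a fixed point and leaves a permutation of \<open>X - {x}\<close> with one
  constraint fewer; the remaining targets are moved by the same transposition.\<close>

lemma card_permutes_prescribed:
  assumes "finite X" "distinct xs" "distinct ys" "set xs \<subseteq> X" "set ys \<subseteq> X" "length xs = length ys"
  shows "card {p. p permutes X \<and> map p xs = ys} = fact (card X - length xs)"
  using assms
proof (induction xs arbitrary: X ys)
  case Nil
  then show ?case using card_permutations[of X "card X"] by simp
next
  case (Cons x xs)
  then obtain y zs where ys: "ys = y # zs" by (metis length_Suc_conv)
  let ?t = "Transposition.transpose x y"
  have xy: "x \<in> X" "y \<in> X" "x \<notin> set xs" "y \<notin> set zs" using Cons.prems ys by auto
  have tp: "?t permutes X" using xy by (simp add: permutes_swap_id)
  define B where "B = {q. q permutes (X - {x}) \<and> map q xs = map ?t zs}"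
  have bij: "bij_betw (\<lambda>p. ?t \<circ> p) {p. p permutes X \<and> map p (x # xs) = ys} B"
  proof (rule bij_betwI[where g="\<lambda>q. ?t \<circ> q"])
    show "(\<lambda>p. ?t \<circ> p) \<in> {p. p permutes X \<and> map p (x # xs) = ys} \<rightarrow> B"
    proof
      fix p assume p: "p \<in> {p. p permutes X \<and> map p (x # xs) = ys}"
      then have "?t \<circ> p permutes X" using tp by (simp add: permutes_compose)
      moreover have "(?t \<circ> p) x = x" using p ys by simp
      ultimately have "?t \<circ> p permutes (X - {x})"
        by (intro permutes_superset[of _ X "X - {x}"]) auto
      moreover have "map (?t \<circ> p) xs = map ?t zs" using p ys by auto
      ultimately show "?t \<circ> p \<in> B" by (simp add: B_def)
    qed
    show "(\<lambda>q. ?t \<circ> q) \<in> B \<rightarrow> {p. p permutes X \<and> map p (x # xs) = ys}"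
    proof
      fix q assume q: "q \<in> B"
      then have qX: "q permutes X" by (auto simp: B_def intro: permutes_subset)
      have qx: "q x = x" using q by (auto simp: B_def permutes_def)
      have "map (?t \<circ> q) xs = map ?t (map ?t zs)" using q by (simp add: B_def flip: map_map)
      then have "map (?t \<circ> q) xs = zs" by (simp add: comp_def)
      then show "?t \<circ> q \<in> {p. p permutes X \<and> map p (x # xs) = ys}"
        using qX tp qx ys by (simp add: permutes_compose)
    qed
  qed (auto simp: fun_eq_iff)
  have "card B = fact (card (X - {x}) - length xs)"
    unfolding B_def
  proof (rule Cons.IH)
    show "set (map ?t zs) \<subseteq> X - {x}"
      using Cons.prems ys xy by (auto simp: Transposition.transpose_def)
    show "distinct (map ?t zs)" using Cons.prems ys by (simp add: distinct_map)
  qed (use Cons.prems ys in auto)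
  then show ?case using bij_betw_same_card[OF bij] Cons.prems by simp
qed

lemma exists_permutes_prescribed:
  assumes "finite X" "distinct xs" "distinct ys" "set xs \<subseteq> X" "set ys \<subseteq> X" "length xs = length ys"
  shows "\<exists>p. p permutes X \<and> map p xs = ys"
proof -
  have "card {p. p permutes X \<and> map p xs = ys} \<noteq> 0"
    unfolding card_permutes_prescribed[OF assms] by simp
  then show ?thesis by (metis (mono_tags, lifting) card.empty empty_Collect_eq)
qed

section \<open>Averages over the symmetric group\<close>

lemma finite_sym_grp [simp]: "finite (sym_grp n)"
  by (simp add: sym_grp_def finite_permutations)

lemma card_sym_grp: "card (sym_grp n) = fact n"
  using card_permutations[of "{1..n}" n] by (simp add: sym_grp_def)

lemma sym_grp_in: "\<pi> \<in> sym_grp n \<Longrightarrow> i \<in> {1..n} \<Longrightarrow> \<pi> i \<in> {1..n}"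
  unfolding sym_grp_def using permutes_in_image[of \<pi> "{1..n}" i] by blast

lemma sym_grp_inj: "\<pi> \<in> sym_grp n \<Longrightarrow> \<pi> i = \<pi> j \<longleftrightarrow> i = j"
  unfolding sym_grp_def by (meson injD mem_Collect_eq permutes_inj)

lemma sym_grp_comp: "\<pi> \<in> sym_grp n \<Longrightarrow> \<sigma> \<in> sym_grp n \<Longrightarrow> \<pi> \<circ> \<sigma> \<in> sym_grp n"
  by (simp add: sym_grp_def permutes_compose)

lemma sym_grp_inv: "\<pi> \<in> sym_grp n \<Longrightarrow> inv \<pi> \<in> sym_grp n"
  by (simp add: sym_grp_def permutes_inv)

lemma sym_grp_transpose: "i \<in> {1..n} \<Longrightarrow> j \<in> {1..n} \<Longrightarrow> Transposition.transpose i j \<in> sym_grp n"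
  by (simp add: sym_grp_def permutes_swap_id)

definition pavg :: "nat \<Rightarrow> ((nat \<Rightarrow> nat) \<Rightarrow> real) \<Rightarrow> real" where
  "pavg n G = (\<Sum>\<pi>\<in>sym_grp n. G \<pi>) / fact n"

lemma id_sym_grp: "id \<in> sym_grp n"
  unfolding sym_grp_def using permutes_id by blast

lemma sym_grp_nonempty [simp]: "sym_grp n \<noteq> {}"
  using id_sym_grp by blast

lemma expectation_unif_perm: "measure_pmf.expectation (unif_perm n) G = pavg n G"
  by (simp add: unif_perm_def integral_pmf_of_set card_sym_grp pavg_def)

lemma prob_unif_perm:
  "measure_pmf.prob (unif_perm n) {\<pi>. P \<pi>} = real (card {\<pi>\<in>sym_grp n. P \<pi>}) / fact n"
  by (simp add: unif_perm_def measure_pmf_of_set card_sym_grp Int_def)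

lemma pavg_add: "pavg n (\<lambda>\<pi>. f \<pi> + g \<pi>) = pavg n f + pavg n g"
  by (simp add: pavg_def sum.distrib add_divide_distrib)

lemma pavg_cmult: "pavg n (\<lambda>\<pi>. r * f \<pi>) = r * pavg n f"
  by (simp add: pavg_def sum_distrib_left)

lemma pavg_multc: "pavg n (\<lambda>\<pi>. f \<pi> * r) = pavg n f * r"
  by (simp add: pavg_def sum_distrib_right)

lemma pavg_diff: "pavg n (\<lambda>\<pi>. f \<pi> - g \<pi>) = pavg n f - pavg n g"
  by (simp add: pavg_def sum_subtractf diff_divide_distrib)

lemma pavg_divide: "pavg n (\<lambda>\<pi>. f \<pi> / r) = pavg n f / r"
  by (simp add: pavg_def sum_divide_distrib[symmetric])

lemma pavg_const [simp]: "pavg n (\<lambda>\<pi>. r) = r"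
  by (simp add: pavg_def card_sym_grp)

lemma pavg_mono: "(\<And>\<pi>. \<pi> \<in> sym_grp n \<Longrightarrow> f \<pi> \<le> g \<pi>) \<Longrightarrow> pavg n f \<le> pavg n g"
  by (auto simp: pavg_def intro!: divide_right_mono sum_mono)

lemma pavg_nonneg: "(\<And>\<pi>. \<pi> \<in> sym_grp n \<Longrightarrow> 0 \<le> f \<pi>) \<Longrightarrow> 0 \<le> pavg n f"
  using pavg_mono[of n "\<lambda>\<pi>. 0" f] by simp

lemma pavg_cong: "(\<And>\<pi>. \<pi> \<in> sym_grp n \<Longrightarrow> f \<pi> = g \<pi>) \<Longrightarrow> pavg n f = pavg n g"
  by (auto simp: pavg_def intro!: sum.cong)

lemma pavg_sum: "pavg n (\<lambda>\<pi>. \<Sum>a\<in>A. f a \<pi>) = (\<Sum>a\<in>A. pavg n (f a))"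
  unfolding pavg_def by (subst sum.swap) (simp add: sum_divide_distrib)

lemma pavg_compose_right:
  assumes "q \<in> sym_grp n"
  shows "pavg n (\<lambda>\<pi>. G (\<pi> \<circ> q)) = pavg n G"
proof -
  have "q permutes {1..n}" using assms by (simp add: sym_grp_def)
  from sum_permutations_compose_right[OF this, of G] show ?thesis
    by (simp add: pavg_def sym_grp_def)
qed

text \<open>Each ordered pair of distinct values is attained by \<open>(n - 2)!\<close>
  permutations.\<close>

lemma pavg_two_points:
  assumes "a \<in> {1..n}" "b \<in> {1..n}" "a \<noteq> b"
  shows "pavg n (\<lambda>\<pi>. \<psi> (\<pi> a) (\<pi> b)) = (\<Sum>i\<in>{1..n}. \<Sum>j\<in>{1..n} - {i}. \<psi> i j) / (real n * real (n - 1))"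
proof -
  define T where "T = Sigma {1..n} (\<lambda>i. {1..n} - {i})"
  have img: "(\<lambda>\<pi>. (\<pi> a, \<pi> b)) ` sym_grp n \<subseteq> T"
  proof
    fix t assume "t \<in> (\<lambda>\<pi>. (\<pi> a, \<pi> b)) ` sym_grp n"
    then obtain \<pi> where \<pi>: "\<pi> \<in> sym_grp n" "t = (\<pi> a, \<pi> b)" by auto
    then show "t \<in> T"
      using sym_grp_in[OF \<pi>(1) assms(1)] sym_grp_in[OF \<pi>(1) assms(2)] sym_grp_inj[OF \<pi>(1), of a b] assms(3)
      unfolding T_def by auto
  qed
  have "(\<Sum>\<pi>\<in>sym_grp n. \<psi> (\<pi> a) (\<pi> b))
      = (\<Sum>t\<in>T. \<Sum>\<pi> | \<pi> \<in> sym_grp n \<and> (\<pi> a, \<pi> b) = t. \<psi> (\<pi> a) (\<pi> b))"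
    by (rule sum.group[symmetric, OF _ _ img]) (auto simp: T_def)
  also have "\<dots> = (\<Sum>t\<in>T. fact (n - 2) * \<psi> (fst t) (snd t))"
  proof (rule sum.cong[OF refl])
    fix t assume t: "t \<in> T"
    have "card {p. p permutes {1..n} \<and> map p [a, b] = [fst t, snd t]} = fact (card {1..n} - length [a, b])"
      by (rule card_permutes_prescribed) (use assms t in \<open>auto simp: T_def\<close>)
    moreover have "{p. p permutes {1..n} \<and> map p [a, b] = [fst t, snd t]} = {\<pi>. \<pi> \<in> sym_grp n \<and> (\<pi> a, \<pi> b) = t}"
      by (auto simp: sym_grp_def)
    ultimately have "card {\<pi>. \<pi> \<in> sym_grp n \<and> (\<pi> a, \<pi> b) = t} = fact (n - 2)" by (simp add: numeral_2_eq_2)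
    moreover have "(\<Sum>\<pi> | \<pi> \<in> sym_grp n \<and> (\<pi> a, \<pi> b) = t. \<psi> (\<pi> a) (\<pi> b))
       = (\<Sum>\<pi> | \<pi> \<in> sym_grp n \<and> (\<pi> a, \<pi> b) = t. \<psi> (fst t) (snd t))"
      by (rule sum.cong) auto
    ultimately show "(\<Sum>\<pi> | \<pi> \<in> sym_grp n \<and> (\<pi> a, \<pi> b) = t. \<psi> (\<pi> a) (\<pi> b)) = fact (n - 2) * \<psi> (fst t) (snd t)"
      by simp
  qed
  also have "\<dots> = fact (n - 2) * (\<Sum>i\<in>{1..n}. \<Sum>j\<in>{1..n} - {i}. \<psi> i j)"
    unfolding T_def by (simp add: sum.Sigma sum_distrib_left case_prod_beta)
  finally have s: "(\<Sum>\<pi>\<in>sym_grp n. \<psi> (\<pi> a) (\<pi> b)) = fact (n - 2) * (\<Sum>i\<in>{1..n}. \<Sum>j\<in>{1..n} - {i}. \<psi> i j)" .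
  have "2 \<le> n" using assms by auto
  then obtain m where m: "n = Suc (Suc m)" by (metis add_2_eq_Suc le_Suc_ex)
  have "fact n = real n * real (n - 1) * (fact (n - 2) :: real)" by (simp add: m algebra_simps)
  then show ?thesis unfolding pavg_def s by simp
qed

section \<open>Subcubes and slopes\<close>

definition lin :: "nat \<Rightarrow> (nat \<Rightarrow> nat \<Rightarrow> real) \<Rightarrow> (nat \<Rightarrow> nat) \<Rightarrow> real" where
  "lin n c \<pi> = (\<Sum>i=1..n. c i (\<pi> i))"

text \<open>The change of a linear function when rows \<open>i\<close> and \<open>u\<close>, with
  values \<open>j\<close> and \<open>v\<close>, exchange these values. As a mixed second difference
  it does not see row or column constants added to \<open>c\<close>.\<close>

definition quad :: "(nat \<Rightarrow> nat \<Rightarrow> real) \<Rightarrow> nat \<Rightarrow> nat \<Rightarrow> nat \<Rightarrow> nat \<Rightarrow> real" where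
  "quad c i u j v = c i v + c u j - c i j - c u v"

lemma lin_swap:
  assumes "i \<in> {1..n}" "u \<in> {1..n}" "i \<noteq> u"
  shows "lin n c (\<pi> \<circ> Transposition.transpose i u) = lin n c \<pi> + quad c i u (\<pi> i) (\<pi> u)"
proof -
  have split: "lin n c p = c i (p i) + c u (p u) + (\<Sum>t\<in>{1..n} - {i, u}. c t (p t))" for p
  proof -
    have "lin n c p = (\<Sum>t\<in>{i, u}. c t (p t)) + (\<Sum>t\<in>{1..n} - {i, u}. c t (p t))"
      unfolding lin_def using assms by (subst sum.subset_diff[of "{i, u}" "{1..n}"]) auto
    then show ?thesis using assms by simp
  qed
  have "(\<Sum>t\<in>{1..n} - {i, u}. c t ((\<pi> \<circ> Transposition.transpose i u) t)) = (\<Sum>t\<in>{1..n} - {i, u}. c t (\<pi> t))"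
    by (rule sum.cong) (auto simp: Transposition.transpose_def)
  then show ?thesis unfolding split[of "\<pi> \<circ> Transposition.transpose i u"] split[of \<pi>] quad_def by simp
qed

text \<open>The involution that exchanges \<open>k\<close> and \<open>k + h\<close> for every
  \<open>k\<close> in \<open>Y\<close>, written pointwise for \<open>Y \<subseteq> {1..h}\<close>;
  the test \<open>h < t\<close> guards the truncated subtraction.\<close>

definition swaps :: "nat \<Rightarrow> nat set \<Rightarrow> nat \<Rightarrow> nat" where
  "swaps h Y t = (if t \<in> Y then t + h else if h < t \<and> t - h \<in> Y then t - h else t)"

lemma swaps_empty: "swaps h {} = id"
  by (auto simp: swaps_def)

lemma swaps_insert:
  assumes "Y \<subseteq> {1..h}" "k \<in> {1..h}" "k \<notin> Y"
  shows "swaps h (insert k Y) = swaps h Y \<circ> Transposition.transpose k (k + h)"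
proof
  fix t
  show "swaps h (insert k Y) t = (swaps h Y \<circ> Transposition.transpose k (k + h)) t"
    using assms by (auto simp: swaps_def Transposition.transpose_def)
qed

lemma swaps_sym_grp:
  assumes "Y \<subseteq> {1..h}" "2 * h \<le> n"
  shows "swaps h Y \<in> sym_grp n"
proof -
  have "finite Y" using assms finite_subset by auto
  then show ?thesis using assms(1)
  proof (induction Y)
    case empty
    show ?case unfolding swaps_empty by (rule id_sym_grp)
  next
    case (insert k Y)
    then have "Transposition.transpose k (k + h) \<in> sym_grp n" using assms(2) by (intro sym_grp_transpose) auto
    moreover have "swaps h (insert k Y) = swaps h Y \<circ> Transposition.transpose k (k + h)"
      using insert by (intro swaps_insert) auto
    ultimately show ?case using insert by (metis insert_subset sym_grp_comp)
  qed
qed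

text \<open>Position \<open>p\<close> is placed in row \<open>\<sigma> p\<close> and gets the value
  \<open>\<pi> p\<close>; then positions \<open>k\<close> and \<open>k + h\<close> exchange their
  values for \<open>k\<close> in \<open>Y\<close>. Two separate permutations make the rows and the
  values of a pair independent.\<close>

definition cube_pt :: "nat \<Rightarrow> (nat \<Rightarrow> nat) \<Rightarrow> (nat \<Rightarrow> nat) \<Rightarrow> nat set \<Rightarrow> nat \<Rightarrow> nat" where
  "cube_pt h \<sigma> \<pi> Y = \<pi> \<circ> (swaps h Y \<circ> inv \<sigma>)"

text \<open>Swaps of disjoint pairs do not interact: each adds the slope of its own pair.\<close>

lemma lin_cube_pt:
  assumes "Y \<subseteq> {1..h}" "2 * h \<le> n" "\<sigma> \<in> sym_grp n" "\<pi> \<in> sym_grp n"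
  shows "lin n c (cube_pt h \<sigma> \<pi> Y)
     = lin n c (cube_pt h \<sigma> \<pi> {}) + (\<Sum>k\<in>Y. quad c (\<sigma> k) (\<sigma> (k + h)) (\<pi> k) (\<pi> (k + h)))"
proof -
  have "finite Y" using assms finite_subset by auto
  then show ?thesis using assms(1)
  proof (induction Y)
    case empty
    then show ?case by simp
  next
    case (insert k Y)
    have k: "k \<in> {1..h}" "Y \<subseteq> {1..h}" "k \<notin> Y" using insert by auto
    have bij: "bij \<sigma>" using assms(3) by (simp add: sym_grp_def permutes_bij)
    have invs [simp]: "inv \<sigma> (\<sigma> t) = t" for t using bij by (simp add: bij_is_inj)
    \<comment> \<open>Conjugation by \<open>\<sigma>\<close> turns the swap of two positions into
      the swap of their rows.\<close>
    have tr: "Transposition.transpose k (k + h) \<circ> inv \<sigma> = inv \<sigma> \<circ> Transposition.transpose (\<sigma> k) (\<sigma> (k + h))"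
    proof
      fix t
      have "inv \<sigma> t = s \<longleftrightarrow> t = \<sigma> s" for s using bij by (metis bij_inv_eq_iff)
      then show "(Transposition.transpose k (k + h) \<circ> inv \<sigma>) t = (inv \<sigma> \<circ> Transposition.transpose (\<sigma> k) (\<sigma> (k + h))) t"
        by (auto simp: Transposition.transpose_def)
    qed
    have "cube_pt h \<sigma> \<pi> (insert k Y) = \<pi> \<circ> (swaps h Y \<circ> (Transposition.transpose k (k + h) \<circ> inv \<sigma>))"
      unfolding cube_pt_def swaps_insert[OF k(2,1,3)] by (simp add: comp_assoc)
    also have "\<dots> = cube_pt h \<sigma> \<pi> Y \<circ> Transposition.transpose (\<sigma> k) (\<sigma> (k + h))"
      unfolding tr cube_pt_def by (simp add: comp_assoc)
    finally have step: "cube_pt h \<sigma> \<pi> (insert k Y) = cube_pt h \<sigma> \<pi> Y \<circ> Transposition.transpose (\<sigma> k) (\<sigma> (k + h))" .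
    have vals: "cube_pt h \<sigma> \<pi> Y (\<sigma> k) = \<pi> k" "cube_pt h \<sigma> \<pi> Y (\<sigma> (k + h)) = \<pi> (k + h)"
      using k by (auto simp: cube_pt_def swaps_def)
    have "lin n c (cube_pt h \<sigma> \<pi> (insert k Y))
       = lin n c (cube_pt h \<sigma> \<pi> Y) + quad c (\<sigma> k) (\<sigma> (k + h)) (\<pi> k) (\<pi> (k + h))"
      unfolding step
      by (subst lin_swap) (use k assms in \<open>auto simp: sym_grp_inj vals intro!: sym_grp_in[OF assms(3), simplified]\<close>)
    then show ?case using insert by simp
  qed
qed

lemma pavg_cube_pt:
  assumes "Y \<subseteq> {1..h}" "2 * h \<le> n"
  shows "pavg n (\<lambda>\<sigma>. pavg n (\<lambda>\<pi>. G (cube_pt h \<sigma> \<pi> Y))) = pavg n G"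
proof -
  have "pavg n (\<lambda>\<pi>. G (cube_pt h \<sigma> \<pi> Y)) = pavg n G" if "\<sigma> \<in> sym_grp n" for \<sigma>
    unfolding cube_pt_def
    by (intro pavg_compose_right sym_grp_comp sym_grp_inv swaps_sym_grp assms that)
  then show ?thesis by (simp cong: pavg_cong)
qed

text \<open>Here \<open>\<eta> \<sigma> \<pi>\<close> is the mean squared error on one subcube.
  Every point of a random subcube is uniform on the group, so the mean of \<open>\<eta>\<close> is
  the global error, and \<open>cube_fkn\<close> is applied on each subcube.\<close>

lemma random_cube_fkn:
  assumes h: "2 * h \<le> n" and f: "\<And>\<pi>. \<pi> \<in> sym_grp n \<Longrightarrow> f \<pi> \<in> {0, 1}"
    and close: "pavg n (\<lambda>\<pi>. (f \<pi> - (b + lin n c \<pi>))\<^sup>2) \<le> \<epsilon>"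
  defines "D \<equiv> \<lambda>\<sigma> \<pi> k. quad c (\<sigma> k) (\<sigma> (k + h)) (\<pi> k) (\<pi> (k + h))"
  shows "\<exists>\<eta>. pavg n (\<lambda>\<sigma>. pavg n (\<lambda>\<pi>. \<eta> \<sigma> \<pi>)) \<le> \<epsilon> \<and>
    (\<forall>\<sigma>\<in>sym_grp n. \<forall>\<pi>\<in>sym_grp n. 0 \<le> \<eta> \<sigma> \<pi> \<and>
        (\<Sum>k\<in>{1..h}. (D \<sigma> \<pi> k - of_int (rd (D \<sigma> \<pi> k)))\<^sup>2) \<le> 224 * \<eta> \<sigma> \<pi> \<and>
        real (card {k\<in>{1..h}. 1/2 \<le> \<bar>D \<sigma> \<pi> k\<bar>}) \<le> 1 + 288 * \<eta> \<sigma> \<pi>)"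
proof -
  define G where "G = (\<lambda>\<pi>. (f \<pi> - (b + lin n c \<pi>))\<^sup>2)"
  define \<eta> where "\<eta> = (\<lambda>\<sigma> \<pi>. cavg {1..h} (\<lambda>Y. G (cube_pt h \<sigma> \<pi> Y)))"
  have "pavg n (\<lambda>\<sigma>. pavg n (\<lambda>\<pi>. \<eta> \<sigma> \<pi>))
      = (\<Sum>Y\<in>Pow {1..h}. pavg n (\<lambda>\<sigma>. pavg n (\<lambda>\<pi>. G (cube_pt h \<sigma> \<pi> Y)))) / 2 ^ h"
    unfolding \<eta>_def cavg_def
    by (simp add: pavg_sum pavg_cmult[of _ "1 / 2 ^ h", simplified])
  also have "\<dots> = pavg n G" by (simp add: pavg_cube_pt h card_Pow)
  finally have av: "pavg n (\<lambda>\<sigma>. pavg n (\<lambda>\<pi>. \<eta> \<sigma> \<pi>)) \<le> \<epsilon>" using close by (simp add: G_def)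
  have eta: "\<eta> \<sigma> \<pi> = cavg {1..h} (\<lambda>Y. (f (cube_pt h \<sigma> \<pi> Y) - (b + lin n c (cube_pt h \<sigma> \<pi> {}) + (\<Sum>k\<in>Y. D \<sigma> \<pi> k)))\<^sup>2)"
    if "\<sigma> \<in> sym_grp n" "\<pi> \<in> sym_grp n" for \<sigma> \<pi>
    unfolding \<eta>_def G_def D_def
  proof (rule cavg_cong)
    fix Y assume "Y \<subseteq> {1..h}"
    from lin_cube_pt[OF this h that, of c]
    show "(f (cube_pt h \<sigma> \<pi> Y) - (b + lin n c (cube_pt h \<sigma> \<pi> Y)))\<^sup>2 =
       (f (cube_pt h \<sigma> \<pi> Y) - (b + lin n c (cube_pt h \<sigma> \<pi> {})
         + (\<Sum>k\<in>Y. quad c (\<sigma> k) (\<sigma> (k + h)) (\<pi> k) (\<pi> (k + h)))))\<^sup>2"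
      by (simp add: add.assoc)
  qed
  have bool: "f (cube_pt h \<sigma> \<pi> Y) \<in> {0, 1}" if "\<sigma> \<in> sym_grp n" "\<pi> \<in> sym_grp n" "Y \<subseteq> {1..h}" for \<sigma> \<pi> Y
    unfolding cube_pt_def by (intro f sym_grp_comp sym_grp_inv swaps_sym_grp that h)
  \<comment> \<open>The number 0 serves as the auxiliary coordinate of
    \<open>cube_fkn\<close>.\<close>
  have k0: "0 \<notin> {1..h}" by simp
  show ?thesis
  proof (intro exI[of _ \<eta>] conjI ballI)
    show "pavg n (\<lambda>\<sigma>. pavg n (\<lambda>\<pi>. \<eta> \<sigma> \<pi>)) \<le> \<epsilon>" by (rule av)
    fix \<sigma> \<pi> assume *: "\<sigma> \<in> sym_grp n" "\<pi> \<in> sym_grp n"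
    show "0 \<le> \<eta> \<sigma> \<pi>" unfolding \<eta>_def G_def by (rule cavg_nonneg) simp
    show "(\<Sum>k\<in>{1..h}. (D \<sigma> \<pi> k - of_int (rd (D \<sigma> \<pi> k)))\<^sup>2) \<le> 224 * \<eta> \<sigma> \<pi>"
      unfolding eta[OF *] by (rule cube_fkn(1)[OF finite_atLeastAtMost k0 bool[OF *]])
    show "real (card {k\<in>{1..h}. 1/2 \<le> \<bar>D \<sigma> \<pi> k\<bar>}) \<le> 1 + 288 * \<eta> \<sigma> \<pi>"
      unfolding eta[OF *] by (rule cube_fkn(2)[OF finite_atLeastAtMost k0 bool[OF *]])
  qed
qed

section \<open>Rounding the coefficients\<close>

lemma pavg_one_point:
  assumes "a \<in> {1..n}"
  shows "pavg n (\<lambda>\<pi>. \<psi> (\<pi> a)) = (\<Sum>j\<in>{1..n}. \<psi> j) / real n"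
proof (cases "n = 1")
  case True
  have "pavg n (\<lambda>\<pi>. \<psi> (\<pi> a)) = pavg n (\<lambda>\<pi>. \<psi> 1)"
    using sym_grp_in[OF _ assms] assms True by (intro pavg_cong) fastforce
  then show ?thesis using True by simp
next
  case False
  then have n: "2 \<le> n" using assms by simp
  obtain b where b: "b \<in> {1..n}" "a \<noteq> b"
  proof (cases "a = 1")
    case True
    then show ?thesis using n that[of 2] by simp
  next
    case False
    then show ?thesis using n that[of 1] by simp
  qed
  have "(\<Sum>i\<in>{1..n}. \<Sum>j\<in>{1..n} - {i}. \<psi> i) = real (n - 1) * (\<Sum>i\<in>{1..n}. \<psi> i)"
    by (simp add: sum_distrib_left)
  then show ?thesis using pavg_two_points[OF assms b, of "\<lambda>i j. \<psi> i"] n by simp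
qed

lemma sum_remove_one:
  fixes g :: "nat \<Rightarrow> real"
  assumes "a \<in> {l..n}"
  shows "(\<Sum>j\<in>{l..n} - {a}. g j) = (\<Sum>j\<in>{l..n}. g j) - g a"
  using assms by (simp add: sum_diff1)

text \<open>With the total \<open>T\<close>, row sums \<open>R\<close>, column sums \<open>C\<close>
  and sum of squares \<open>Q\<close>, Hoeffding's formula gives the variance \<open>(Q -
  (\<Sum>R\<^sup>2 + \<Sum>C\<^sup>2) / n + T\<^sup>2 / n\<^sup>2) / (n - 1)\<close>. Cauchy-Schwarz
  for the row sums absorbs the term with \<open>T\<close>.\<close>

lemma lin_variance:
  fixes e :: "nat \<Rightarrow> nat \<Rightarrow> real"
  assumes n: "2 \<le> n"
  defines "\<mu> \<equiv> (\<Sum>i=1..n. \<Sum>j=1..n. e i j) / real n"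
  shows "pavg n (\<lambda>\<pi>. (lin n e \<pi> - \<mu>)\<^sup>2) \<le> (\<Sum>i=1..n. \<Sum>j=1..n. (e i j)\<^sup>2) / real (n - 1)"
proof -
  define T Q where "T = (\<Sum>i=1..n. \<Sum>j=1..n. e i j)" and "Q = (\<Sum>i=1..n. \<Sum>j=1..n. (e i j)\<^sup>2)"
  define R C where "R = (\<lambda>i. \<Sum>j=1..n. e i j)" and "C = (\<lambda>j. \<Sum>i=1..n. e i j)"
  define N where "N = real n"
  have N: "real (n - 1) = N - 1" "2 \<le> N" using n by (auto simp: N_def of_nat_diff)
  have TR: "T = (\<Sum>i=1..n. R i)" by (simp add: T_def R_def)
  have TC: "T = (\<Sum>j=1..n. C j)" unfolding T_def C_def by (rule sum.swap)
  have mu: "\<mu> = T / N" by (simp add: \<mu>_def T_def N_def)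
  have mean: "pavg n (lin n e) = T / N"
    unfolding lin_def pavg_sum T_def N_def sum_divide_distrib[of _ "{1..n}"]
    by (intro sum.cong refl) (simp add: pavg_one_point sum_divide_distrib)
  have pair: "pavg n (\<lambda>\<pi>. e i (\<pi> i) * e k (\<pi> k)) = (\<Sum>j=1..n. e i j * (R k - e k j)) / (N * (N - 1))"
    if "i \<in> {1..n}" "k \<in> {1..n} - {i}" for i k
  proof -
    have "(\<Sum>j=1..n. \<Sum>l\<in>{1..n} - {j}. e i j * e k l) = (\<Sum>j=1..n. e i j * (R k - e k j))"
      by (rule sum.cong) (auto simp: sum_distrib_left[symmetric] R_def sum_remove_one)
    then show ?thesis using pavg_two_points[of i n k "\<lambda>j l. e i j * e k l"] that by (simp add: N N_def[symmetric])
  qed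
  have sq: "(lin n e \<pi>)\<^sup>2 = (\<Sum>i=1..n. (e i (\<pi> i))\<^sup>2) + (\<Sum>i=1..n. \<Sum>k\<in>{1..n} - {i}. e i (\<pi> i) * e k (\<pi> k))" for \<pi>
  proof -
    have "(lin n e \<pi>)\<^sup>2 = (\<Sum>i=1..n. \<Sum>k=1..n. e i (\<pi> i) * e k (\<pi> k))"
      by (simp add: lin_def power2_eq_square sum_product)
    also have "\<dots> = (\<Sum>i=1..n. (e i (\<pi> i))\<^sup>2 + (\<Sum>k\<in>{1..n} - {i}. e i (\<pi> i) * e k (\<pi> k)))"
    proof (rule sum.cong[OF refl])
      fix i assume "i \<in> {1..n}"
      then show "(\<Sum>k=1..n. e i (\<pi> i) * e k (\<pi> k)) = (e i (\<pi> i))\<^sup>2 + (\<Sum>k\<in>{1..n} - {i}. e i (\<pi> i) * e k (\<pi> k))"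
        by (subst sum.remove[of "{1..n}" i]) (auto simp: power2_eq_square)
    qed
    finally show ?thesis by (simp add: sum.distrib)
  qed
  \<comment> \<open>For fixed \<open>i\<close> and \<open>j\<close>, the entries in other rows and
    other columns sum to \<open>T - R i - C j + e i j\<close>.\<close>
  have cross: "(\<Sum>i=1..n. \<Sum>k\<in>{1..n} - {i}. \<Sum>j=1..n. e i j * (R k - e k j))
      = T\<^sup>2 - (\<Sum>i=1..n. (R i)\<^sup>2) - (\<Sum>j=1..n. (C j)\<^sup>2) + Q"
  proof -
    have "(\<Sum>k\<in>{1..n} - {i}. \<Sum>j=1..n. e i j * (R k - e k j)) = (\<Sum>j=1..n. e i j * (T - R i - C j + e i j))"
      if i: "i \<in> {1..n}" for i
    proof -
      have "(\<Sum>k\<in>{1..n} - {i}. \<Sum>j=1..n. e i j * (R k - e k j)) = (\<Sum>j=1..n. e i j * (\<Sum>k\<in>{1..n} - {i}. R k - e k j))"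
        by (subst sum.swap) (simp add: sum_distrib_left)
      moreover have "(\<Sum>k\<in>{1..n} - {i}. R k - e k j) = T - R i - C j + e i j" for j
        using i by (simp add: sum_remove_one sum_subtractf TR C_def)
      ultimately show ?thesis by simp
    qed
    then have "(\<Sum>i=1..n. \<Sum>k\<in>{1..n} - {i}. \<Sum>j=1..n. e i j * (R k - e k j))
       = (\<Sum>i=1..n. \<Sum>j=1..n. e i j * T - e i j * R i - e i j * C j + (e i j)\<^sup>2)"
      by (simp add: algebra_simps power2_eq_square)
    also have "\<dots> = (\<Sum>i=1..n. \<Sum>j=1..n. e i j * T) - (\<Sum>i=1..n. \<Sum>j=1..n. e i j * R i)
        - (\<Sum>j=1..n. \<Sum>i=1..n. e i j * C j) + Q"
      unfolding Q_def by (subst (4) sum.swap) (simp add: sum.distrib sum_subtractf)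
    also have "\<dots> = T\<^sup>2 - (\<Sum>i=1..n. (R i)\<^sup>2) - (\<Sum>j=1..n. (C j)\<^sup>2) + Q"
      by (simp add: sum_distrib_right[symmetric] R_def C_def T_def power2_eq_square)
    finally show ?thesis .
  qed
  have "pavg n (\<lambda>\<pi>. \<Sum>i=1..n. (e i (\<pi> i))\<^sup>2) = Q / N"
  proof -
    have "pavg n (\<lambda>\<pi>. (e i (\<pi> i))\<^sup>2) = (\<Sum>j=1..n. (e i j)\<^sup>2) / N" if "i \<in> {1..n}" for i
      using pavg_one_point[OF that, of "\<lambda>j. (e i j)\<^sup>2"] by (simp add: N_def)
    then show ?thesis by (simp add: pavg_sum Q_def sum_divide_distrib)
  qed
  moreover have "pavg n (\<lambda>\<pi>. \<Sum>i=1..n. \<Sum>k\<in>{1..n} - {i}. e i (\<pi> i) * e k (\<pi> k))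
     = (T\<^sup>2 - (\<Sum>i=1..n. (R i)\<^sup>2) - (\<Sum>j=1..n. (C j)\<^sup>2) + Q) / (N * (N - 1))"
    unfolding pavg_sum cross[symmetric] by (simp add: pair sum_divide_distrib)
  ultimately have m2: "pavg n (\<lambda>\<pi>. (lin n e \<pi>)\<^sup>2)
     = Q / N + (T\<^sup>2 - (\<Sum>i=1..n. (R i)\<^sup>2) - (\<Sum>j=1..n. (C j)\<^sup>2) + Q) / (N * (N - 1))"
    unfolding sq pavg_add by simp
  have "pavg n (\<lambda>\<pi>. (lin n e \<pi> - \<mu>)\<^sup>2) = pavg n (\<lambda>\<pi>. (lin n e \<pi>)\<^sup>2 + ((- 2 * \<mu>) * lin n e \<pi> + \<mu>\<^sup>2))"
    by (rule pavg_cong) (simp add: power2_eq_square algebra_simps)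
  also have "\<dots> = pavg n (\<lambda>\<pi>. (lin n e \<pi>)\<^sup>2) - \<mu>\<^sup>2"
    unfolding pavg_add pavg_cmult mean pavg_const
    using mu N by (simp add: power2_eq_square)
  also have "\<dots> \<le> Q / (N - 1)"
  proof -
    have cs: "T\<^sup>2 \<le> N * (\<Sum>i=1..n. (R i)\<^sup>2)"
      using sum_squared_le_sum_of_squares[of R "{1..n}"] by (simp add: TR N_def mult.commute)
    have "0 \<le> (\<Sum>j=1..n. (C j)\<^sup>2)" by (simp add: sum_nonneg)
    moreover have "T\<^sup>2 / N \<le> (\<Sum>i=1..n. (R i)\<^sup>2)" using cs N by (simp add: field_simps)
    ultimately have num: "T\<^sup>2 - (\<Sum>i=1..n. (R i)\<^sup>2) - (\<Sum>j=1..n. (C j)\<^sup>2) + Q \<le> T\<^sup>2 - T\<^sup>2 / N + Q"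
      by linarith
    have "Q / N + (T\<^sup>2 - (\<Sum>i=1..n. (R i)\<^sup>2) - (\<Sum>j=1..n. (C j)\<^sup>2) + Q) / (N * (N - 1))
        \<le> Q / N + (T\<^sup>2 - T\<^sup>2 / N + Q) / (N * (N - 1))"
      using N by (intro add_left_mono divide_right_mono num) auto
    also have "\<dots> = Q / (N - 1) + \<mu>\<^sup>2"
      unfolding mu using N by (simp add: field_simps power2_eq_square)
    finally show ?thesis unfolding m2 by simp
  qed
  finally show ?thesis by (simp only: N(1) Q_def)
qed

text \<open>Averaging \<open>A / a + B / b\<close>, whose mean is at most 2. The case
  \<open>a = 0\<close> is separate, since an error bound of 0 is allowed.\<close>

lemma two_averages:
  fixes A B :: "'a \<Rightarrow> real" and a b :: real
  assumes fin: "finite T" "T \<noteq> {}" and nn: "\<And>t. t \<in> T \<Longrightarrow> 0 \<le> A t" "\<And>t. t \<in> T \<Longrightarrow> 0 \<le> B t"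
    and a: "sum A T \<le> a * card T" and b: "sum B T \<le> b * card T" "0 < b"
  shows "\<exists>t\<in>T. A t \<le> 2 * a \<and> B t \<le> 2 * b"
proof (rule ccontr)
  assume neg: "\<not> ?thesis"
  have card: "0 < real (card T)" using fin by (simp add: card_gt_0_iff)
  have "0 \<le> a * card T" using sum_nonneg[of T A] nn a by force
  then have a0: "0 \<le> a" using card by (simp add: zero_le_mult_iff)
  show False
  proof (cases "a = 0")
    case True
    then have "sum A T = 0" using a sum_nonneg[of T A] nn by force
    then have "\<forall>t\<in>T. A t = 0" using fin nn by (simp add: sum_nonneg_eq_0_iff)
    then have "\<forall>t\<in>T. 2 * b < B t" using neg True by force
    then have "(\<Sum>t\<in>T. b) < sum B T" using fin b(2) by (intro sum_strict_mono) force+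
    then show False using b by (simp add: mult.commute)
  next
    case False
    with a0 have a1: "0 < a" by simp
    have "(\<Sum>t\<in>T. 2) < (\<Sum>t\<in>T. A t / a + B t / b)"
    proof (rule sum_strict_mono[OF fin])
      fix t assume t: "t \<in> T"
      then have "2 < A t / a \<or> 2 < B t / b" using neg a1 b(2) by (auto simp: not_le field_simps)
      then show "2 < A t / a + B t / b" using nn[OF t] a1 b(2) by (smt (verit) divide_nonneg_pos)
    qed
    also have "\<dots> = sum A T / a + sum B T / b" by (simp add: sum.distrib sum_divide_distrib)
    also have "\<dots> \<le> real (card T) + real (card T)" using a b a1 by (intro add_mono) (auto simp: field_simps)
    finally show False by simp
  qed
qed

section \<open>Choosing a base entry\<close>

definition quad_sum :: "nat \<Rightarrow> (nat \<Rightarrow> nat \<Rightarrow> nat \<Rightarrow> nat \<Rightarrow> real) \<Rightarrow> real" where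
  "quad_sum n \<phi> = (\<Sum>i\<in>{1..n}. \<Sum>u\<in>{1..n} - {i}. \<Sum>j\<in>{1..n}. \<Sum>v\<in>{1..n} - {j}. \<phi> i u j v)"

lemma pavg_quad:
  assumes "k \<in> {1..h}" "2 * h \<le> n"
  shows "pavg n (\<lambda>\<sigma>. pavg n (\<lambda>\<pi>. \<phi> (\<sigma> k) (\<sigma> (k + h)) (\<pi> k) (\<pi> (k + h)))) = quad_sum n \<phi> / (real n * real (n - 1))\<^sup>2"
proof -
  have k: "k \<in> {1..n}" "k + h \<in> {1..n}" "k \<noteq> k + h" using assms by auto
  show ?thesis
    unfolding pavg_two_points[OF k, of "\<lambda>j v. \<phi> _ _ j v"]
      pavg_two_points[OF k, of "\<lambda>i u. (\<Sum>j\<in>{1..n}. \<Sum>v\<in>{1..n} - {j}. \<phi> i u j v) / (real n * real (n - 1))"]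
    by (simp add: quad_sum_def sum_divide_distrib power2_eq_square)
qed

text \<open>All pairs of the random pairing have the same law, so a bound for the sum over one
  pairing bounds the total over all squares. The factor 3 is \<open>n \<le> 3 * (n div 2)\<close>
  for \<open>n \<ge> 2\<close>.\<close>

lemma quad_sum_bound:
  assumes n: "2 \<le> n"
    and *: "pavg n (\<lambda>\<sigma>. pavg n (\<lambda>\<pi>. \<Sum>k\<in>{1..n div 2}. \<phi> (\<sigma> k) (\<sigma> (k + n div 2)) (\<pi> k) (\<pi> (k + n div 2)))) \<le> B"
    and B: "0 \<le> B"
  shows "quad_sum n \<phi> \<le> 3 * B * real n * (real (n - 1))\<^sup>2"
proof -
  define h where "h = n div 2"
  have h: "2 * h \<le> n" "n \<le> 3 * h" "0 < h" using n by (auto simp: h_def)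
  have "real h * (quad_sum n \<phi> / (real n * real (n - 1))\<^sup>2) \<le> B"
    using * pavg_quad[OF _ h(1), of _ \<phi>] by (simp add: pavg_sum h_def)
  then have "quad_sum n \<phi> \<le> B / real h * (real n * real (n - 1))\<^sup>2"
    using h n by (simp add: field_simps)
  also have "\<dots> \<le> (3 * B / real n) * (real n * real (n - 1))\<^sup>2"
  proof (rule mult_right_mono)
    have "B * real n \<le> B * (3 * real h)" using h B by (intro mult_left_mono) auto
    then show "B / real h \<le> 3 * B / real n" using h n by (simp add: field_simps)
  qed simp
  also have "\<dots> = 3 * B * real n * (real (n - 1))\<^sup>2" using n by (simp add: power2_eq_square field_simps)
  finally show ?thesis .
qed

text \<open>The sum is grouped by \<open>(i, v)\<close>, the entry that is to become the base point,
  so that a good one can be picked by averaging.\<close>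

lemma quad_sum_base:
  "quad_sum n \<phi> = (\<Sum>(i, v)\<in>{1..n} \<times> {1..n}. \<Sum>u\<in>{1..n} - {i}. \<Sum>j\<in>{1..n} - {v}. \<phi> i u j v)"
proof -
  have "(\<Sum>j\<in>{1..n}. \<Sum>v\<in>{1..n} - {j}. \<phi> i u j v) = (\<Sum>v\<in>{1..n}. \<Sum>j\<in>{1..n} - {v}. \<phi> i u j v)" for i u
  proof -
    have "(\<Sum>j\<in>{1..n}. \<Sum>v\<in>{1..n} - {j}. \<phi> i u j v) = (\<Sum>j\<in>{1..n}. \<Sum>v\<in>{v\<in>{1..n}. v \<noteq> j}. \<phi> i u j v)"
      by (intro sum.cong) auto
    also have "\<dots> = (\<Sum>v\<in>{1..n}. \<Sum>j\<in>{j\<in>{1..n}. v \<noteq> j}. \<phi> i u j v)"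
      by (rule sum.swap_restrict) auto
    also have "\<dots> = (\<Sum>v\<in>{1..n}. \<Sum>j\<in>{1..n} - {v}. \<phi> i u j v)"
      by (intro sum.cong) auto
    finally show ?thesis .
  qed
  then have "quad_sum n \<phi> = (\<Sum>i\<in>{1..n}. \<Sum>u\<in>{1..n} - {i}. \<Sum>v\<in>{1..n}. \<Sum>j\<in>{1..n} - {v}. \<phi> i u j v)"
    by (simp add: quad_sum_def)
  also have "\<dots> = (\<Sum>i\<in>{1..n}. \<Sum>v\<in>{1..n}. \<Sum>u\<in>{1..n} - {i}. \<Sum>j\<in>{1..n} - {v}. \<phi> i u j v)"
    by (intro sum.cong refl sum.swap)
  finally show ?thesis by (simp add: sum.cartesian_product)
qed

text \<open>The matrix \<open>quad c i0 u j v0\<close> arises from \<open>c\<close> by adding row,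
  column and global constants, so it gives the same function up to a constant; it vanishes on row
  \<open>i0\<close> and column \<open>v0\<close>.\<close>

lemma lin_quad_base:
  assumes "\<pi> \<in> sym_grp n"
  shows "lin n c \<pi> = (\<Sum>j=1..n. c i0 j) + (\<Sum>u=1..n. c u v0) - real n * c i0 v0 + lin n (\<lambda>u j. quad c i0 u j v0) \<pi>"
proof -
  have "(\<Sum>u=1..n. c i0 (\<pi> u)) = (\<Sum>j=1..n. c i0 j)"
    using sum.permute[of \<pi> "{1..n}" "c i0"] assms by (simp add: sym_grp_def comp_def)
  then show ?thesis by (simp add: lin_def quad_def sum.distrib sum_subtractf)
qed

text \<open>Averaging yields a base entry for which the slopes \<open>quad c i0 u j v0\<close> have
  total squared rounding error \<open>O(\<epsilon> * n)\<close> and at most \<open>12 * n\<close> of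
  them are large. By \<open>lin_variance\<close> rounding them costs \<open>O(\<epsilon>)\<close> up
  to a constant, which is rounded at the end.\<close>

lemma integer_approximation:
  assumes n: "2 \<le> n" and f: "\<And>\<pi>. \<pi> \<in> sym_grp n \<Longrightarrow> f \<pi> \<in> {0, 1}"
    and close: "pavg n (\<lambda>\<pi>. (f \<pi> - lin n c \<pi>)\<^sup>2) \<le> \<epsilon>" and eps: "0 \<le> \<epsilon>" "\<epsilon> \<le> 1 / 288"
  shows "\<exists>(b :: int) (m :: nat \<Rightarrow> nat \<Rightarrow> int). (\<forall>i j. m i j \<in> {-1, 0, 1}) \<and>
     card {(i, j). i \<in> {1..n} \<and> j \<in> {1..n} \<and> m i j \<noteq> 0} \<le> 12 * n \<and>
     pavg n (\<lambda>\<pi>. (f \<pi> - (of_int b + lin n (\<lambda>i j. of_int (m i j)) \<pi>))\<^sup>2) \<le> 22000 * \<epsilon>"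
proof -
  define h where "h = n div 2"
  have h: "2 * h \<le> n" by (simp add: h_def)
  let ?D = "\<lambda>\<sigma> \<pi> k. quad c (\<sigma> k) (\<sigma> (k + h)) (\<pi> k) (\<pi> (k + h))"
  define \<phi>1 \<phi>2 where "\<phi>1 = (\<lambda>i u j v. (quad c i u j v - of_int (rd (quad c i u j v)))\<^sup>2)"
    and "\<phi>2 = (\<lambda>i u j v. if 1/2 \<le> \<bar>quad c i u j v\<bar> then 1 else 0 :: real)"
  have close0: "pavg n (\<lambda>\<pi>. (f \<pi> - (0 + lin n c \<pi>))\<^sup>2) \<le> \<epsilon>" using close by simp
  have "\<exists>\<eta>. pavg n (\<lambda>\<sigma>. pavg n (\<lambda>\<pi>. \<eta> \<sigma> \<pi>)) \<le> \<epsilon> \<and>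
    (\<forall>\<sigma>\<in>sym_grp n. \<forall>\<pi>\<in>sym_grp n. 0 \<le> \<eta> \<sigma> \<pi> \<and>
        (\<Sum>k\<in>{1..h}. (?D \<sigma> \<pi> k - of_int (rd (?D \<sigma> \<pi> k)))\<^sup>2) \<le> 224 * \<eta> \<sigma> \<pi> \<and>
        real (card {k\<in>{1..h}. 1/2 \<le> \<bar>?D \<sigma> \<pi> k\<bar>}) \<le> 1 + 288 * \<eta> \<sigma> \<pi>)"
    by (rule random_cube_fkn[where f=f, OF h _ close0]) (rule f)
  then obtain \<eta> where \<eta>: "pavg n (\<lambda>\<sigma>. pavg n (\<lambda>\<pi>. \<eta> \<sigma> \<pi>)) \<le> \<epsilon>"
    "\<And>\<sigma> \<pi>. \<sigma> \<in> sym_grp n \<Longrightarrow> \<pi> \<in> sym_grp n \<Longrightarrow>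
        (\<Sum>k\<in>{1..h}. (?D \<sigma> \<pi> k - of_int (rd (?D \<sigma> \<pi> k)))\<^sup>2) \<le> 224 * \<eta> \<sigma> \<pi>"
    "\<And>\<sigma> \<pi>. \<sigma> \<in> sym_grp n \<Longrightarrow> \<pi> \<in> sym_grp n \<Longrightarrow>
        real (card {k\<in>{1..h}. 1/2 \<le> \<bar>?D \<sigma> \<pi> k\<bar>}) \<le> 1 + 288 * \<eta> \<sigma> \<pi>"
    by blast
  have "pavg n (\<lambda>\<sigma>. pavg n (\<lambda>\<pi>. \<Sum>k\<in>{1..h}. \<phi>1 (\<sigma> k) (\<sigma> (k + h)) (\<pi> k) (\<pi> (k + h)))) \<le> 224 * \<epsilon>"
  proof -
    have "pavg n (\<lambda>\<sigma>. pavg n (\<lambda>\<pi>. \<Sum>k\<in>{1..h}. \<phi>1 (\<sigma> k) (\<sigma> (k + h)) (\<pi> k) (\<pi> (k + h))))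
       \<le> pavg n (\<lambda>\<sigma>. pavg n (\<lambda>\<pi>. 224 * \<eta> \<sigma> \<pi>))"
      using \<eta>(2) by (intro pavg_mono) (simp add: \<phi>1_def)
    also have "\<dots> \<le> 224 * \<epsilon>" using \<eta>(1) by (simp add: pavg_cmult)
    finally show ?thesis .
  qed
  then have q1: "quad_sum n \<phi>1 \<le> 3 * (224 * \<epsilon>) * real n * (real (n - 1))\<^sup>2"
    using eps unfolding h_def by (intro quad_sum_bound[OF n]) auto
  \<comment> \<open>Up to the error a subcube has at most one large slope; the mean count is at most
    \<open>1 + 288 * \<epsilon> \<le> 2\<close>.\<close>
  have "pavg n (\<lambda>\<sigma>. pavg n (\<lambda>\<pi>. \<Sum>k\<in>{1..h}. \<phi>2 (\<sigma> k) (\<sigma> (k + h)) (\<pi> k) (\<pi> (k + h)))) \<le> 2"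
  proof -
    have "(\<Sum>k\<in>{1..h}. \<phi>2 (\<sigma> k) (\<sigma> (k + h)) (\<pi> k) (\<pi> (k + h))) = real (card {k\<in>{1..h}. 1/2 \<le> \<bar>?D \<sigma> \<pi> k\<bar>})" for \<sigma> \<pi>
      by (simp add: \<phi>2_def sum.If_cases Int_def)
    then have "pavg n (\<lambda>\<sigma>. pavg n (\<lambda>\<pi>. \<Sum>k\<in>{1..h}. \<phi>2 (\<sigma> k) (\<sigma> (k + h)) (\<pi> k) (\<pi> (k + h))))
       \<le> pavg n (\<lambda>\<sigma>. pavg n (\<lambda>\<pi>. 1 + 288 * \<eta> \<sigma> \<pi>))"
      using \<eta>(3) by (intro pavg_mono) simp
    also have "\<dots> \<le> 2" using \<eta>(1) eps by (simp add: pavg_cmult pavg_add)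
    finally show ?thesis .
  qed
  then have q2: "quad_sum n \<phi>2 \<le> 3 * 2 * real n * (real (n - 1))\<^sup>2"
    unfolding h_def by (intro quad_sum_bound[OF n]) auto
  define T where "T = {1..n} \<times> {1..n}"
  define A B where "A = (\<lambda>(i, v). \<Sum>u\<in>{1..n} - {i}. \<Sum>j\<in>{1..n} - {v}. \<phi>1 i u j v)"
    and "B = (\<lambda>(i, v). \<Sum>u\<in>{1..n} - {i}. \<Sum>j\<in>{1..n} - {v}. \<phi>2 i u j v)"
  have nn: "0 \<le> \<phi>1 i u j v" "0 \<le> \<phi>2 i u j v" for i u j v by (simp_all add: \<phi>1_def \<phi>2_def)
  have cardT: "real (card T) = real n * real n" by (simp add: T_def)
  have n1: "(real (n - 1))\<^sup>2 \<le> real n * real n" unfolding power2_eq_square by (intro mult_mono) auto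
  have "\<exists>t\<in>T. A t \<le> 2 * (672 * \<epsilon> * real n) \<and> B t \<le> 2 * (6 * real n)"
  proof (rule two_averages)
    show "finite T" "T \<noteq> {}" using n by (auto simp: T_def)
    show "0 \<le> A t" "0 \<le> B t" for t
      using nn by (auto simp: A_def B_def split: prod.splits intro!: sum_nonneg)
    have "sum A T = quad_sum n \<phi>1" "sum B T = quad_sum n \<phi>2"
      unfolding quad_sum_base A_def B_def T_def by (rule refl)+
    moreover have "3 * (224 * \<epsilon>) * real n * (real (n - 1))\<^sup>2 \<le> 3 * (224 * \<epsilon>) * real n * (real n * real n)"
      using eps by (intro mult_left_mono n1) auto
    moreover have "3 * 2 * real n * (real (n - 1))\<^sup>2 \<le> 3 * 2 * real n * (real n * real n)"
      by (intro mult_left_mono n1) auto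
    ultimately show "sum A T \<le> 672 * \<epsilon> * real n * card T" "sum B T \<le> 6 * real n * card T"
      using q1 q2 unfolding cardT by linarith+
  qed (use n in auto)
  then obtain i0 v0 where base: "i0 \<in> {1..n}" "v0 \<in> {1..n}"
    and A0: "A (i0, v0) \<le> 1344 * \<epsilon> * real n" and B0: "B (i0, v0) \<le> 12 * real n"
    by (auto simp: T_def)
  define c' where "c' = (\<lambda>u j. quad c i0 u j v0)"
  define m where "m = (\<lambda>u j. rd (c' u j))"
  define e where "e = (\<lambda>u j. c' u j - of_int (m u j))"
  have zero: "c' i0 j = 0" "c' u v0 = 0" for u j by (auto simp: c'_def quad_def)
  have full: "(\<Sum>u=1..n. \<Sum>j=1..n. g u j) = (\<Sum>u\<in>{1..n} - {i0}. \<Sum>j\<in>{1..n} - {v0}. g u j)"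
    if "\<And>j. g i0 j = 0" "\<And>u. g u v0 = 0" for g :: "nat \<Rightarrow> nat \<Rightarrow> real"
    using base that by (simp add: sum_remove_one)
  have e2: "(\<Sum>u=1..n. \<Sum>j=1..n. (e u j)\<^sup>2) \<le> 1344 * \<epsilon> * n"
  proof -
    have "e i0 j = 0" "e u v0 = 0" for u j by (simp_all add: e_def m_def zero rd_def)
    then have "(\<Sum>u=1..n. \<Sum>j=1..n. (e u j)\<^sup>2) = (\<Sum>u\<in>{1..n} - {i0}. \<Sum>j\<in>{1..n} - {v0}. (e u j)\<^sup>2)"
      by (intro full) simp_all
    also have "\<dots> = A (i0, v0)" by (simp add: A_def \<phi>1_def e_def m_def c'_def)
    finally show ?thesis using A0 by simp
  qed
  have "real (card {(i, j). i \<in> {1..n} \<and> j \<in> {1..n} \<and> m i j \<noteq> 0}) \<le> 12 * real n"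
  proof -
    have "real (card {(i, j). i \<in> {1..n} \<and> j \<in> {1..n} \<and> m i j \<noteq> 0})
       = (\<Sum>t\<in>{t\<in>T. m (fst t) (snd t) \<noteq> 0}. 1)"
      by (auto simp: T_def intro!: arg_cong[where f=card])
    also have "\<dots> = (\<Sum>(u, j)\<in>T. if m u j \<noteq> 0 then 1 else 0)"
      by (subst sum.inter_filter) (auto simp: T_def case_prod_beta)
    also have "\<dots> = (\<Sum>u=1..n. \<Sum>j=1..n. if m u j \<noteq> 0 then 1 else 0)"
      by (simp add: T_def sum.cartesian_product)
    also have "\<dots> = (\<Sum>u\<in>{1..n} - {i0}. \<Sum>j\<in>{1..n} - {v0}. if m u j \<noteq> 0 then 1 else 0)"
      by (rule full) (auto simp: m_def zero rd_def)
    also have "\<dots> \<le> (\<Sum>u\<in>{1..n} - {i0}. \<Sum>j\<in>{1..n} - {v0}. \<phi>2 i0 u j v0)"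
      by (intro sum_mono) (auto simp: m_def \<phi>2_def c'_def rd_def)
    also have "\<dots> \<le> 12 * real n" using B0 by (simp add: B_def)
    finally show ?thesis .
  qed
  then have cardm: "card {(i, j). i \<in> {1..n} \<and> j \<in> {1..n} \<and> m i j \<noteq> 0} \<le> 12 * n" by linarith
  define K \<mu> where "K = (\<Sum>j=1..n. c i0 j) + (\<Sum>u=1..n. c u v0) - real n * c i0 v0"
    and "\<mu> = (\<Sum>i=1..n. \<Sum>j=1..n. e i j) / real n"
  define L where "L = lin n (\<lambda>i j. of_int (m i j))"
  have dec: "lin n c \<pi> = K + (L \<pi> + lin n e \<pi>)" if "\<pi> \<in> sym_grp n" for \<pi>
    using lin_quad_base[OF that, of c i0 v0]
    by (simp add: K_def L_def lin_def e_def c'_def sum.distrib[symmetric])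
  \<comment> \<open>As \<open>f - L\<close> is integer-valued, replacing the real constant by its
    nearest integer at most doubles the distance to it.\<close>
  define b where "b = round (K + \<mu>)"
  have pt: "(f \<pi> - (of_int b + L \<pi>))\<^sup>2 \<le> 8 * (f \<pi> - lin n c \<pi>)\<^sup>2 + 8 * (lin n e \<pi> - \<mu>)\<^sup>2"
    if \<pi>: "\<pi> \<in> sym_grp n" for \<pi>
  proof -
    have "L \<pi> = of_int (\<Sum>i=1..n. m i (\<pi> i))" by (simp add: L_def lin_def)
    moreover have "f \<pi> \<in> {of_int 0, of_int 1}" using f[OF \<pi>] by simp
    ultimately obtain z :: int where z: "f \<pi> - L \<pi> = of_int z"
      by (metis insert_iff of_int_diff singletonD)
    have rnd: "\<bar>K + \<mu> - of_int b\<bar> \<le> 1/2"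
      unfolding b_def using of_int_round_abs_le[of "K + \<mu>"] by (simp add: abs_minus_commute)
    have "\<bar>of_int z - of_int b\<bar> \<le> 2 * \<bar>of_int z - (K + \<mu>)\<bar>"
    proof (cases "z = b")
      case False
      then have "1 \<le> \<bar>z - b\<bar>" by simp
      then have "1 \<le> \<bar>of_int z - of_int b :: real\<bar>"
        by (metis of_int_1_le_iff of_int_abs of_int_diff)
      moreover have "\<bar>of_int z - of_int b :: real\<bar> \<le> \<bar>of_int z - (K + \<mu>)\<bar> + \<bar>K + \<mu> - of_int b\<bar>"
        by linarith
      moreover have "w \<le> 2 * a" if "1 \<le> w" "w \<le> a + r" "r \<le> 1/2" for w a r :: real
        using that by linarith
      ultimately show ?thesis using rnd by blast
    qed simp
    then have "(of_int z - of_int b)\<^sup>2 \<le> (2 * (of_int z - (K + \<mu>)))\<^sup>2"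
      unfolding abs_le_square_iff[symmetric] by (simp only: abs_mult abs_numeral)
    also have "of_int z - (K + \<mu>) = (f \<pi> - lin n c \<pi>) + (lin n e \<pi> - \<mu>)"
      using z[symmetric] dec[OF \<pi>] by simp
    also have "(2 * ((f \<pi> - lin n c \<pi>) + (lin n e \<pi> - \<mu>)))\<^sup>2 = 4 * ((f \<pi> - lin n c \<pi>) + (lin n e \<pi> - \<mu>))\<^sup>2"
      by (simp only: power_mult_distrib) simp
    also have "\<dots> \<le> 8 * (f \<pi> - lin n c \<pi>)\<^sup>2 + 8 * (lin n e \<pi> - \<mu>)\<^sup>2"
      using sum_squares_bound[of "f \<pi> - lin n c \<pi>" "lin n e \<pi> - \<mu>"] by (simp add: power2_sum)
    finally show ?thesis using z by (simp add: algebra_simps)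
  qed
  have "pavg n (\<lambda>\<pi>. (f \<pi> - (of_int b + L \<pi>))\<^sup>2)
     \<le> pavg n (\<lambda>\<pi>. 8 * (f \<pi> - lin n c \<pi>)\<^sup>2 + 8 * (lin n e \<pi> - \<mu>)\<^sup>2)"
    by (rule pavg_mono) (rule pt)
  also have "\<dots> \<le> 8 * \<epsilon> + 8 * (2688 * \<epsilon>)"
  proof -
    have "pavg n (\<lambda>\<pi>. (lin n e \<pi> - \<mu>)\<^sup>2) \<le> 1344 * \<epsilon> * n / real (n - 1)"
      using lin_variance[OF n, of e] e2 unfolding \<mu>_def by (meson divide_right_mono of_nat_0_le_iff order_trans)
    also have "\<dots> \<le> 2688 * \<epsilon>"
    proof -
      have "real n \<le> 2 * real (n - 1)" using n by (simp add: of_nat_diff)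
      then have "\<epsilon> * real n \<le> \<epsilon> * (2 * real (n - 1))" using eps by (intro mult_left_mono)
      then show ?thesis using n by (simp add: field_simps)
    qed
    finally show ?thesis using close by (simp add: pavg_add pavg_cmult)
  qed
  also have "\<dots> \<le> 22000 * \<epsilon>" using eps by simp
  finally have "pavg n (\<lambda>\<pi>. (f \<pi> - (of_int b + L \<pi>))\<^sup>2) \<le> 22000 * \<epsilon>" .
  moreover have "m i j \<in> {-1, 0, 1}" for i j by (auto simp: m_def rd_def)
  ultimately show ?thesis using cardm unfolding L_def by blast
qed

section \<open>Exactly linear Boolean functions\<close>

text \<open>Differences in -1, 0, 1 allow at most two values of \<open>p\<close>. Either one of them
  is attained at most once, or both are attained at least twice.\<close>

lemma star_or_balanced:
  fixes p :: "'a \<Rightarrow> real"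
  assumes int: "\<And>i u. i \<in> X \<Longrightarrow> u \<in> X \<Longrightarrow> p i - p u \<in> {-1, 0, 1}"
  shows "(\<exists>x. \<forall>i\<in>X - {x}. \<forall>u\<in>X - {x}. p i = p u) \<or>
    (\<exists>a\<in>X. \<exists>b\<in>X. \<exists>c\<in>X. \<exists>d\<in>X. a \<noteq> b \<and> c \<noteq> d \<and> p a = p b \<and> p c = p d \<and> p a \<noteq> p c)"
proof (rule disjCI)
  assume nb: "\<not> (\<exists>a\<in>X. \<exists>b\<in>X. \<exists>c\<in>X. \<exists>d\<in>X. a \<noteq> b \<and> c \<noteq> d \<and> p a = p b \<and> p c = p d \<and> p a \<noteq> p c)"
  have three: "p i = p u \<or> p u = p w \<or> p i = p w" if "i \<in> X" "u \<in> X" "w \<in> X" for i u w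
    using int[OF that(1,2)] int[OF that(2,3)] int[OF that(1,3)] by auto
  show "\<exists>x. \<forall>i\<in>X - {x}. \<forall>u\<in>X - {x}. p i = p u"
  proof (rule ccontr)
    assume ns: "\<not> ?thesis"
    obtain i u where iu: "i \<in> X" "u \<in> X" "p i \<noteq> p u" using ns by blast
    obtain i' u' where 1: "i' \<in> X - {i}" "u' \<in> X - {i}" "p i' \<noteq> p u'" using ns by blast
    obtain j where j: "j \<in> X" "j \<noteq> i" "p j = p i"
      using three[of i i' u'] three[of i i' u] three[of i u' u] iu 1 by (metis DiffE insertCI)
    obtain i'' u'' where 2: "i'' \<in> X - {u}" "u'' \<in> X - {u}" "p i'' \<noteq> p u''" using ns by blast
    obtain w where w: "w \<in> X" "w \<noteq> u" "p w = p u"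
      using three[of u i'' u''] three[of u i'' i] three[of u u'' i] iu 2 by (metis DiffE insertCI)
    show False using nb iu j w by metis
  qed
qed

text \<open>The pairs separated by a balanced function contain a four-cycle, and the pairs separated by
  \<open>q\<close> would have to be vertex covers of it.\<close>

lemma balanced_kills:
  fixes p q :: "'a \<Rightarrow> real"
  assumes abcd: "a \<in> X" "b \<in> X" "c \<in> X" "d \<in> X" "a \<noteq> b" "c \<noteq> d" "p a = p b" "p c = p d" "p a \<noteq> p c"
    and disj: "\<And>s t u w. {s, t, u, w} \<subseteq> X \<Longrightarrow> {s, t} \<inter> {u, w} = {} \<Longrightarrow> p s \<noteq> p t \<Longrightarrow> q u = q w"
    and uw: "u \<in> X" "w \<in> X"
  shows "q u = q w"
proof -
  have 1: "q u = q w" if "u \<in> X" "w \<in> X" "{s, t} \<inter> {u, w} = {}" "s \<in> {a, b}" "t \<in> {c, d}" for s t u w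
    by (rule disj[of s t u w]) (use that abcd in auto)
  have ac: "a \<noteq> c" "a \<noteq> d" "b \<noteq> c" "b \<noteq> d" using abcd by auto
  have qac: "q a = q c" "q b = q c" "q a = q d" "q b = q d"
    using 1[of a c b d] 1[of b c a d] 1[of a d b c] 1[of b d a c] abcd ac by auto
  show ?thesis
  proof (cases "\<exists>s t. s \<in> {a, b} \<and> t \<in> {c, d} \<and> {s, t} \<inter> {u, w} = {}")
    case True
    then show ?thesis using 1[OF uw] by blast
  next
    case False
    then have "s \<in> {u, w} \<or> t \<in> {u, w}" if "s \<in> {a, b}" "t \<in> {c, d}" for s t
      using that by blast
    then have "(a \<in> {u, w} \<and> b \<in> {u, w}) \<or> (c \<in> {u, w} \<and> d \<in> {u, w})" by blast
    then have "{u, w} = {a, b} \<or> {u, w} = {c, d}" using abcd by auto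
    then show ?thesis using qac by (auto simp: doubleton_eq_iff)
  qed
qed

lemma ex_third:
  assumes "finite X" "3 \<le> card X"
  shows "\<exists>z\<in>X. z \<noteq> x \<and> z \<noteq> y"
proof (rule ccontr)
  assume "\<not> ?thesis"
  then have "card X \<le> card {x, y}" by (intro card_mono) auto
  also have "\<dots> \<le> 2" by (simp add: card_insert_if)
  finally show False using assms by simp
qed

lemma ex_two_more:
  assumes "finite X" "4 \<le> card X"
  shows "\<exists>z\<in>X - {x, y}. \<exists>w\<in>X - {x, y}. z \<noteq> w"
proof -
  obtain z where z: "z \<in> X" "z \<noteq> x" "z \<noteq> y" using ex_third[of X x y] assms by auto
  have "3 \<le> card (X - {z})" using assms z by simp
  then obtain w where "w \<in> X - {z}" "w \<noteq> x" "w \<noteq> y" using ex_third[of "X - {z}" x y] assms by auto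
  with z show ?thesis by auto
qed

text \<open>The slopes in columns \<open>j\<close>, \<open>v\<close> are differences of the function
  \<open>d j v\<close> of the row. If some \<open>d j v\<close> is balanced, all slopes avoiding
  columns \<open>j\<close> and \<open>v\<close> vanish, and one of these two columns carries
  everything. Otherwise each nonconstant \<open>d j v\<close> has a single exceptional row, and this
  row is the same for all pairs of columns.\<close>

lemma exact_line_structure:
  fixes c :: "nat \<Rightarrow> nat \<Rightarrow> real"
  assumes n: "3 \<le> card X" and fin: "finite X"
    and int: "\<And>i u j v. {i, u, j, v} \<subseteq> X \<Longrightarrow> quad c i u j v \<in> {-1, 0, 1}"
    and disj: "\<And>i u j v k w l z. {i, u, j, v, k, w, l, z} \<subseteq> X \<Longrightarrow> {i, u} \<inter> {k, w} = {} \<Longrightarrow>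
        {j, v} \<inter> {l, z} = {} \<Longrightarrow> quad c i u j v \<noteq> 0 \<Longrightarrow> quad c k w l z = 0"
    and cyc: "\<And>x y z j v l. {x, y, z, j, v, l} \<subseteq> X \<Longrightarrow> card {x, y, z} = 3 \<Longrightarrow> card {j, v, l} = 3 \<Longrightarrow>
        \<bar>quad c x z j v + quad c y z v l\<bar> \<le> 1"
  shows "(\<exists>x. \<forall>i\<in>X - {x}. \<forall>u\<in>X - {x}. \<forall>j\<in>X. \<forall>v\<in>X. quad c i u j v = 0) \<or>
    (\<exists>y. \<forall>i\<in>X. \<forall>u\<in>X. \<forall>j\<in>X - {y}. \<forall>v\<in>X - {y}. quad c i u j v = 0)"
proof -
  define d where "d = (\<lambda>j v i. c i v - c i j)"
  have qd: "quad c i u j v = d j v i - d j v u" for i u j v by (simp add: quad_def d_def)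
  have dadd: "d j l i = d j v i + d v l i" for j v l i by (simp add: d_def)
  have dint: "d j v i - d j v u \<in> {-1, 0, 1}" if "i \<in> X" "u \<in> X" "j \<in> X" "v \<in> X" for i u j v
    using int[of i u j v] that by (simp add: qd)
  have dd: "d l z k = d l z w" if "{i, u, j, v, k, w, l, z} \<subseteq> X" "{i, u} \<inter> {k, w} = {}" "{j, v} \<inter> {l, z} = {}"
    "d j v i \<noteq> d j v u" for i u j v k w l z
    using disj[OF that(1-3)] that(4) by (simp add: qd)
  define bal where "bal = (\<lambda>j v. \<exists>a\<in>X. \<exists>b\<in>X. \<exists>c\<in>X. \<exists>d'\<in>X. a \<noteq> b \<and> c \<noteq> d' \<and>
      d j v a = d j v b \<and> d j v c = d j v d' \<and> d j v a \<noteq> d j v c)"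
  show ?thesis
  proof (cases "\<exists>j\<in>X. \<exists>v\<in>X. bal j v")
    case True
    then obtain j v a b e g where jv: "j \<in> X" "v \<in> X" and abeg: "a \<in> X" "b \<in> X" "e \<in> X" "g \<in> X"
      "a \<noteq> b" "e \<noteq> g" "d j v a = d j v b" "d j v e = d j v g" "d j v a \<noteq> d j v e"
      unfolding bal_def by blast
    have dist: "a \<noteq> e" "a \<noteq> g" "b \<noteq> e" "b \<noteq> g" using abeg by auto
    have jv': "j \<noteq> v" using abeg by (auto simp: d_def)
    have "card {a, b, e, g} = 4" using abeg dist by simp
    then have X4: "4 \<le> card X" using card_mono[OF fin, of "{a, b, e, g}"] abeg by simp
    \<comment> \<open>A pair of rows separated by \<open>d j v\<close> rules out slopes in disjoint
      rows and columns; a balanced function separates enough pairs to rule out all rows.\<close>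
    have others: "d l z u = d l z w" if "l \<in> X - {j, v}" "z \<in> X - {j, v}" "u \<in> X" "w \<in> X" for l z u w
    proof (rule balanced_kills[OF abeg _ that(3,4)])
      show "d l z u = d l z w" if "{s, t, u, w} \<subseteq> X" "{s, t} \<inter> {u, w} = {}" "d j v s \<noteq> d j v t" for s t u w
        by (rule dd[of s t j v]) (use that jv \<open>l \<in> X - {j, v}\<close> \<open>z \<in> X - {j, v}\<close> in auto)
    qed
    obtain l l' where l: "l \<in> X - {j, v}" "l' \<in> X - {j, v}" "l \<noteq> l'"
      using ex_two_more[OF fin X4] by blast
    \<comment> \<open>Up to constants \<open>d j v\<close> is \<open>p - q\<close>. The columns
      \<open>l\<close> and \<open>l'\<close> are distinct, so the column pairs of \<open>p\<close>
      and \<open>q\<close> are disjoint and the two functions cannot separate disjoint pairs of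
      rows.\<close>
    define p q where "p = d j l" and "q = d v l'"
    have pq: "q u = q w" if "{s, t, u, w} \<subseteq> X" "{s, t} \<inter> {u, w} = {}" "p s \<noteq> p t" for s t u w
      unfolding q_def by (rule dd[of s t j l]) (use that l jv jv' in \<open>auto simp: p_def\<close>)
    have qp: "p u = p w" if "{s, t, u, w} \<subseteq> X" "{s, t} \<inter> {u, w} = {}" "q s \<noteq> q t" for s t u w
      unfolding p_def by (rule dd[of s t v l']) (use that l jv jv' in \<open>auto simp: q_def\<close>)
    have djv: "d j v i - d j v u = (p i - p u) - (q i - q u)" if "i \<in> X" "u \<in> X" for i u
      using dadd[of j v i l] dadd[of j v u l] dadd[of l v i l'] dadd[of l v u l'] others[OF l(1,2) that]
      by (auto simp: p_def q_def d_def)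
    \<comment> \<open>If \<open>q\<close> is constant, column \<open>v\<close> behaves like the
      others and \<open>j\<close> is the exceptional one; if \<open>p\<close> is constant, the roles
      are exchanged.\<close>
    have qcol: "\<exists>y. \<forall>i\<in>X. \<forall>u\<in>X. \<forall>j\<in>X - {y}. \<forall>v\<in>X - {y}. quad c i u j v = 0"
      if "(\<forall>u\<in>X. \<forall>w\<in>X. p u = p w) \<or> (\<forall>u\<in>X. \<forall>w\<in>X. q u = q w)"
      using that
    proof
      assume q0: "\<forall>u\<in>X. \<forall>w\<in>X. q u = q w"
      have "d l z u = d l z w" if "l \<in> X - {j}" "z \<in> X - {j}" "u \<in> X" "w \<in> X" for l z u w
      proof -
        have *: "d l' s u = d l' s w" if "s \<in> X - {j}" for s
          using others[of l' s u w] q0 l that \<open>u \<in> X\<close> \<open>w \<in> X\<close> by (cases "s = v") (force simp: q_def d_def)+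
        show ?thesis using *[OF that(1)] *[OF that(2)] by (simp add: d_def)
      qed
      then show ?thesis by (auto simp: qd intro!: exI[of _ j])
    next
      assume p0: "\<forall>u\<in>X. \<forall>w\<in>X. p u = p w"
      have "d l' z u = d l' z w" if "l' \<in> X - {v}" "z \<in> X - {v}" "u \<in> X" "w \<in> X" for l' z u w
      proof -
        have *: "d l s u = d l s w" if "s \<in> X - {v}" for s
          using others[of l s u w] p0 l that \<open>u \<in> X\<close> \<open>w \<in> X\<close> by (cases "s = j") (force simp: p_def d_def)+
        show ?thesis using *[OF that(1)] *[OF that(2)] by (simp add: d_def)
      qed
      then show ?thesis by (auto simp: qd intro!: exI[of _ v])
    qed
    have pint: "p i - p u \<in> {-1, 0, 1}" "q i - q u \<in> {-1, 0, 1}" if "i \<in> X" "u \<in> X" for i u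
      using dint[of i u j l] dint[of i u v l'] that jv l by (auto simp: p_def q_def)
    show ?thesis
    proof (cases "(\<exists>x. \<forall>i\<in>X - {x}. \<forall>u\<in>X - {x}. p i = p u) \<and> (\<exists>x. \<forall>i\<in>X - {x}. \<forall>u\<in>X - {x}. q i = q u)")
      case True
      then obtain x y where x: "\<And>i u. i \<in> X - {x} \<Longrightarrow> u \<in> X - {x} \<Longrightarrow> p i = p u"
        and y: "\<And>i u. i \<in> X - {y} \<Longrightarrow> u \<in> X - {y} \<Longrightarrow> q i = q u" by blast
      \<comment> \<open>Two nonconstant stars with different centres would separate disjoint pairs
        of rows; with a common centre, \<open>d j v\<close> would be constant off it and not
        balanced.\<close>
      have "(\<forall>u\<in>X. \<forall>w\<in>X. p u = p w) \<or> (\<forall>u\<in>X. \<forall>w\<in>X. q u = q w)"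
      proof (rule ccontr)
        assume "\<not> ?thesis"
        then obtain s t s' t' where st: "s \<in> X" "t \<in> X" "p s \<noteq> p t" and st': "s' \<in> X" "t' \<in> X" "q s' \<noteq> q t'" by blast
        then have xX: "x \<in> X" "y \<in> X" using x[of s t] y[of s' t'] by auto
        have px: "p x \<noteq> p i" if "i \<in> X - {x}" for i using x that st by (metis DiffI singletonD)
        have qy: "q y \<noteq> q i" if "i \<in> X - {y}" for i using y that st' by (metis DiffI singletonD)
        have "x = y"
        proof (rule ccontr)
          assume xy: "x \<noteq> y"
          obtain z w where zw: "z \<in> X - {x, y}" "w \<in> X - {x, y}" "z \<noteq> w"
            using ex_two_more[OF fin X4] by blast
          then show False using pq[of x z y w] px[of z] qy[of w] xX xy by auto
        qed
        then have "d j v i = d j v u" if "i \<in> X - {x}" "u \<in> X - {x}" for i u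
          using djv[of i u] x[OF that] y[of i u] that by auto
        then show False using abeg dist by (metis DiffI singletonD)
      qed
      then show ?thesis using qcol by blast
    next
      case False
      then consider "\<not> (\<exists>x. \<forall>i\<in>X - {x}. \<forall>u\<in>X - {x}. p i = p u)" | "\<not> (\<exists>x. \<forall>i\<in>X - {x}. \<forall>u\<in>X - {x}. q i = q u)" by blast
      then have "(\<forall>u\<in>X. \<forall>w\<in>X. p u = p w) \<or> (\<forall>u\<in>X. \<forall>w\<in>X. q u = q w)"
      proof cases
        case 1
        then obtain a b e g where 0: "a \<in> X" "b \<in> X" "e \<in> X" "g \<in> X" "a \<noteq> b" "e \<noteq> g" "p a = p b" "p e = p g" "p a \<noteq> p e"
          using star_or_balanced[of X p] pint(1) by blast
        have "q u = q w" if "u \<in> X" "w \<in> X" for u w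
          by (rule balanced_kills[OF 0 _ that]) (rule pq)
        then show ?thesis by blast
      next
        case 2
        then obtain a b e g where 0: "a \<in> X" "b \<in> X" "e \<in> X" "g \<in> X" "a \<noteq> b" "e \<noteq> g" "q a = q b" "q e = q g" "q a \<noteq> q e"
          using star_or_balanced[of X q] pint(2) by blast
        have "p u = p w" if "u \<in> X" "w \<in> X" for u w
          by (rule balanced_kills[OF 0 _ that]) (rule qp)
        then show ?thesis by blast
      qed
      then show ?thesis using qcol by blast
    qed
  next
    case False
    have star: "\<exists>x. \<forall>i\<in>X - {x}. \<forall>u\<in>X - {x}. d j v i = d j v u" if "j \<in> X" "v \<in> X" for j v
      using star_or_balanced[of X "d j v"] dint that False unfolding bal_def by blast
    \<comment> \<open>So \<open>act j v x\<close> says that \<open>d j v\<close> is not constant and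
      that \<open>x\<close> is its single exceptional row.\<close>
    define act where "act = (\<lambda>j v x. j \<in> X \<and> v \<in> X \<and> x \<in> X \<and> (\<forall>z\<in>X - {x}. d j v x \<noteq> d j v z) \<and>
        (\<forall>i\<in>X - {x}. \<forall>u\<in>X - {x}. d j v i = d j v u))"
    have act_ex: "\<exists>x. act j v x" if jv: "j \<in> X" "v \<in> X" and iu: "i \<in> X" "u \<in> X" "d j v i \<noteq> d j v u" for j v i u
    proof -
      obtain x where x: "\<forall>i\<in>X - {x}. \<forall>u\<in>X - {x}. d j v i = d j v u" using star[OF jv] by blast
      have "x \<in> X" using x iu by fastforce
      moreover have "d j v x \<noteq> d j v z" if "z \<in> X - {x}" for z using x iu that by (metis DiffI singletonD)
      ultimately show ?thesis using x jv unfolding act_def by blast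
    qed
    have act_sym: "act v j x" if "act j v x" for j v x
    proof -
      have "d v j i = d v j u \<longleftrightarrow> d j v i = d j v u" for i u by (auto simp: d_def)
      then show ?thesis using that unfolding act_def by blast
    qed
    have act_mem: "j \<in> X" "v \<in> X" "x \<in> X" if "act j v x" for j v x
      using that unfolding act_def by blast+
    have act_ne: "d j v x \<noteq> d j v z" if "act j v x" "z \<in> X" "z \<noteq> x" for j v x z
      using that unfolding act_def by blast
    have act_eq: "d j v i = d j v u" if "act j v x" "i \<in> X" "i \<noteq> x" "u \<in> X" "u \<noteq> x" for j v x i u
      using that unfolding act_def by blast
    have act_cols: "j \<noteq> v" if "act j v x" for j v x
      using act_ne[OF that] ex_third[OF fin n, of x x] by (auto simp: d_def)
    have share: "x = y" if 1: "act j v x" and 2: "act v l y" and jl: "j \<noteq> l" for j v l x y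
    proof (rule ccontr)
      assume xy: "x \<noteq> y"
      note mem = act_mem[OF 1] act_mem[OF 2]
      obtain z where z: "z \<in> X" "z \<noteq> x" "z \<noteq> y" using ex_third[OF fin n] by blast
      note cols = act_cols[OF 1] act_cols[OF 2]
      \<comment> \<open>The 3-cycle bound forces these two nonzero slopes to have opposite signs, so
        their difference, itself a slope, would be 2 or -2.\<close>
      have "\<bar>quad c x z j v + quad c y z v l\<bar> \<le> 1"
        by (rule cyc) (use mem z xy cols jl in auto)
      moreover have "quad c x y j l \<in> {-1, 0, 1}" "quad c x z j v \<in> {-1, 0, 1}" "quad c y z v l \<in> {-1, 0, 1}"
        using int[of x y j l] int[of x z j v] int[of y z v l] mem z by simp_all
      moreover have "quad c x z j v \<noteq> 0" "quad c y z v l \<noteq> 0"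
        using act_ne[OF 1, of z] act_ne[OF 2, of z] z by (auto simp: qd)
      moreover have "quad c x y j l = quad c x z j v - quad c y z v l"
        using act_eq[OF 1, of y z] act_eq[OF 2, of x z] mem z xy by (simp add: qd dadd[of j l _ v])
      ultimately show False by auto
    qed
    have same: "x = y" if 1: "act j v x" and 2: "act l z y" for j v l z x y
    proof (cases "{j, v} \<inter> {l, z} = {}")
      case True
      note mem = act_mem[OF 1] act_mem[OF 2]
      note cols = act_cols[OF 1] act_cols[OF 2]
      have "card {j, v, l, z} = 4" using True cols by auto
      then have X4: "4 \<le> card X" using card_mono[OF fin, of "{j, v, l, z}"] mem by simp
      show ?thesis
      proof (rule ccontr)
        assume xy: "x \<noteq> y"
        obtain s w where sw: "s \<in> X - {x, y}" "w \<in> X - {x, y}" "s \<noteq> w"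
          using ex_two_more[OF fin X4] by blast
        have "d j v x \<noteq> d j v s" using act_ne[OF 1] sw by blast
        then have "d l z y = d l z w"
          by (rule dd[rotated 3]) (use mem sw xy True in auto)
        then show False using act_ne[OF 2, of w] sw by auto
      qed
    next
      case False
      note jv = act_cols[OF 1]
      consider "{l, z} = {j, v}" | "j = l" "v \<noteq> z" | "j = z" "v \<noteq> l" | "v = l" "j \<noteq> z" | "v = z" "j \<noteq> l"
        using False jv by auto
      then show ?thesis
      proof cases
        case 1
        then have 3: "act j v y" using 2 act_sym by (auto simp: doubleton_eq_iff)
        show ?thesis
        proof (rule ccontr)
          assume xy: "x \<noteq> y"
          obtain z where "z \<in> X" "z \<noteq> x" "z \<noteq> y" using ex_third[OF fin n] by blast
          then show False using act_ne[OF 3, of x] act_ne[OF 3, of z] act_eq[OF \<open>act j v x\<close>, of y z] xy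
              act_mem[OF 3] act_mem[OF \<open>act j v x\<close>] by auto
        qed
      next
        case 2
        then show ?thesis using share[of v j x z y] \<open>act l z y\<close> act_sym[OF 1] by auto
      next
        case 3
        then show ?thesis using share[of v j x l y] act_sym[OF 2] act_sym[OF 1] by auto
      next
        case 4
        then show ?thesis using share[of j v x z y] 1 2 by auto
      next
        case 5
        then show ?thesis using share[of j v x l y] 1 act_sym[OF 2] by auto
      qed
    qed
    show ?thesis
    proof (cases "\<exists>j v x. act j v x")
      case True
      then obtain j0 v0 x where x: "act j0 v0 x" by blast
      have "quad c i u j v = 0" if "i \<in> X - {x}" "u \<in> X - {x}" "j \<in> X" "v \<in> X" for i u j v
      proof (rule ccontr)
        assume "quad c i u j v \<noteq> 0"
        then have ne: "d j v i \<noteq> d j v u" by (simp add: qd)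
        have "i \<in> X" "u \<in> X" using that by auto
        then obtain y where "act j v y" using act_ex[OF \<open>j \<in> X\<close> \<open>v \<in> X\<close> _ _ ne] by blast
        then have "act j v x" using same[OF x] by blast
        then show False using ne act_eq that by blast
      qed
      then show ?thesis by blast
    next
      case False
      then have "quad c i u j v = 0" if "i \<in> X" "u \<in> X" "j \<in> X" "v \<in> X" for i u j v
        using act_ex that by (metis cancel_comm_monoid_add_class.diff_cancel qd)
      then show ?thesis by auto
    qed
  qed
qed

section \<open>Functions of one row or one column\<close>

lemma row_dictator:
  assumes "x \<in> {1..n}"
  shows "dictator n (\<lambda>\<pi>. if P (\<pi> x) then 1 else 0)"
  unfolding dictator_def
proof (intro exI[of _ "{x} \<times> {j\<in>{1..n}. P j}"] conjI ballI)
  show "{x} \<times> {j\<in>{1..n}. P j} \<subseteq> {1..n} \<times> {1..n}" using assms by auto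
  show "(\<exists>a. \<forall>(i, j)\<in>{x} \<times> {j\<in>{1..n}. P j}. i = a) \<or> (\<exists>b. \<forall>(i, j)\<in>{x} \<times> {j\<in>{1..n}. P j}. j = b)"
    by auto
  fix \<pi> assume \<pi>: "\<pi> \<in> sym_grp n"
  have "(\<Sum>(i, j)\<in>{x} \<times> {j\<in>{1..n}. P j}. perm_entry i j \<pi>) = (\<Sum>j\<in>{j\<in>{1..n}. P j}. if \<pi> x = j then 1 else 0)"
    by (simp add: sum.cartesian_product[symmetric] perm_entry_def)
  also have "\<dots> = (if P (\<pi> x) then 1 else 0)"
    using sym_grp_in[OF \<pi> assms] by (simp add: sum.delta')
  finally show "(if P (\<pi> x) then 1 else 0) = (\<Sum>(i, j)\<in>{x} \<times> {j\<in>{1..n}. P j}. perm_entry i j \<pi>)" by simp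
qed

lemma sym_grp_inv_iff: "\<pi> \<in> sym_grp n \<Longrightarrow> \<pi> i = y \<longleftrightarrow> i = inv \<pi> y"
  unfolding sym_grp_def by (metis mem_Collect_eq permutes_inv_eq)

lemma col_dictator:
  assumes "y \<in> {1..n}"
  shows "dictator n (\<lambda>\<pi>. if P (inv \<pi> y) then 1 else 0)"
  unfolding dictator_def
proof (intro exI[of _ "{i\<in>{1..n}. P i} \<times> {y}"] conjI ballI)
  show "{i\<in>{1..n}. P i} \<times> {y} \<subseteq> {1..n} \<times> {1..n}" using assms by auto
  show "(\<exists>a. \<forall>(i, j)\<in>{i\<in>{1..n}. P i} \<times> {y}. i = a) \<or> (\<exists>b. \<forall>(i, j)\<in>{i\<in>{1..n}. P i} \<times> {y}. j = b)"
    by auto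
  fix \<pi> assume \<pi>: "\<pi> \<in> sym_grp n"
  have "(\<Sum>(i, j)\<in>{i\<in>{1..n}. P i} \<times> {y}. perm_entry i j \<pi>) = (\<Sum>i\<in>{i\<in>{1..n}. P i}. if inv \<pi> y = i then 1 else 0)"
    unfolding sum.cartesian_product[symmetric] perm_entry_def
    by (rule sum.cong) (auto simp: sym_grp_inv_iff[OF \<pi>])
  also have "\<dots> = (if P (inv \<pi> y) then 1 else 0)"
    using sym_grp_in[OF sym_grp_inv[OF \<pi>] assms] by (simp add: sum.delta')
  finally show "(if P (inv \<pi> y) then 1 else 0) = (\<Sum>(i, j)\<in>{i\<in>{1..n}. P i} \<times> {y}. perm_entry i j \<pi>)" by simp
qed

lemma sum_permuted: "\<pi> \<in> sym_grp n \<Longrightarrow> (\<Sum>i=1..n. g (\<pi> i)) = (\<Sum>j=1..n. g j :: real)"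
  using sum.permute[of \<pi> "{1..n}" g] by (simp add: sym_grp_def comp_def)

lemma lin_inv:
  assumes "\<pi> \<in> sym_grp n"
  shows "lin n c \<pi> = lin n (\<lambda>j i. c i j) (inv \<pi>)"
proof -
  have "inv \<pi> (\<pi> i) = i" for i using sym_grp_inv_iff[OF assms] by metis
  then show ?thesis
    using sum_permuted[OF assms, of "\<lambda>j. c (inv \<pi> j) j"] by (simp add: lin_def)
qed

text \<open>Any two rows other than \<open>x\<close> differ by a constant. Writing every row as row
  \<open>k\<close> plus a constant leaves only \<open>c x - c k\<close> at \<open>\<pi> x\<close>,
  because row \<open>k\<close> summed over all values is constant.\<close>

lemma lin_one_row:
  assumes x: "x \<in> {1..n}"
    and q: "\<And>i u j v. i \<in> {1..n} - {x} \<Longrightarrow> u \<in> {1..n} - {x} \<Longrightarrow> j \<in> {1..n} \<Longrightarrow> v \<in> {1..n} \<Longrightarrow> quad c i u j v = 0"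
  shows "\<exists>P. \<forall>\<pi>\<in>sym_grp n. lin n c \<pi> = P (\<pi> x)"
proof (cases "{1..n} - {x} = {}")
  case True
  then have "{1..n} = {x}" using x by blast
  then show ?thesis by (intro exI[of _ "c x"]) (simp add: lin_def)
next
  case False
  then obtain k where k: "k \<in> {1..n} - {x}" by blast
  define r where "r = (\<lambda>i. if i = x then 0 else c i x - c k x)"
  define S where "S = (\<Sum>j=1..n. c k j) + (\<Sum>i=1..n. r i)"
  have "lin n c \<pi> = S + (c x (\<pi> x) - c k (\<pi> x))" if \<pi>: "\<pi> \<in> sym_grp n" for \<pi>
  proof -
    have "c i (\<pi> i) = c k (\<pi> i) + r i + (if i = x then c x (\<pi> x) - c k (\<pi> x) else 0)" if "i \<in> {1..n}" for i
      using q[of i k x "\<pi> i"] that k x sym_grp_in[OF \<pi> that] by (auto simp: r_def quad_def)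
    then have "lin n c \<pi> = (\<Sum>i=1..n. c k (\<pi> i) + r i + (if i = x then c x (\<pi> x) - c k (\<pi> x) else 0))"
      unfolding lin_def by (rule sum.cong[OF refl])
    also have "\<dots> = S + (c x (\<pi> x) - c k (\<pi> x))"
      using x sum_permuted[OF \<pi>, of "c k"] by (simp add: sum.distrib S_def)
    finally show ?thesis .
  qed
  then show ?thesis by (intro exI[of _ "\<lambda>j. S + (c x j - c k j)"]) simp
qed

text \<open>The hypotheses of \<open>exact_line_structure\<close> come from one swap, from two
  disjoint swaps, and from a 3-cycle written as two overlapping swaps; each time the values of
  \<open>f\<close> involved must stay in 0, 1.\<close>

lemma exact_dictator:
  assumes n: "2 \<le> n" and f: "\<And>\<pi>. \<pi> \<in> sym_grp n \<Longrightarrow> f \<pi> \<in> {0, 1}"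
    and lin: "\<And>\<pi>. \<pi> \<in> sym_grp n \<Longrightarrow> f \<pi> = b + lin n c \<pi>"
  shows "\<exists>g. dictator n g \<and> (\<forall>\<pi>\<in>sym_grp n. f \<pi> = g \<pi>)"
proof -
  define X where "X = {1..n}"
  have presc: "\<exists>\<pi>\<in>sym_grp n. map \<pi> xs = ys"
    if "distinct xs" "distinct ys" "set xs \<subseteq> X" "set ys \<subseteq> X" "length xs = length ys" for xs ys
    using exists_permutes_prescribed[OF _ that] by (auto simp: X_def sym_grp_def)
  have step: "\<pi> \<circ> Transposition.transpose i u \<in> sym_grp n \<and>
      f (\<pi> \<circ> Transposition.transpose i u) = f \<pi> + quad c i u (\<pi> i) (\<pi> u)"
    if "\<pi> \<in> sym_grp n" "i \<in> X" "u \<in> X" "i \<noteq> u" for \<pi> i u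
  proof -
    have "\<pi> \<circ> Transposition.transpose i u \<in> sym_grp n"
      using that by (intro sym_grp_comp sym_grp_transpose) (auto simp: X_def)
    then show ?thesis using that lin_swap[of i n u c \<pi>] lin by (simp add: X_def)
  qed
  have quad0: "quad c i i j v = 0" "quad c i u j j = 0" for i u j v by (auto simp: quad_def)
  have int: "quad c i u j v \<in> {-1, 0, 1}" if X: "{i, u, j, v} \<subseteq> X" for i u j v
  proof (cases "i = u \<or> j = v")
    case True
    then show ?thesis by (auto simp: quad0)
  next
    case False
    obtain \<pi> where \<pi>: "\<pi> \<in> sym_grp n" "map \<pi> [i, u] = [j, v]"
      using presc[of "[i, u]" "[j, v]"] X False by auto
    then show ?thesis using step[of \<pi> i u] X False f[of \<pi>] f[of "\<pi> \<circ> Transposition.transpose i u"] by auto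
  qed
  have disj: "quad c k w l z = 0"
    if X: "{i, u, j, v, k, w, l, z} \<subseteq> X" and D: "{i, u} \<inter> {k, w} = {}" "{j, v} \<inter> {l, z} = {}"
      and Q: "quad c i u j v \<noteq> 0" for i u j v k w l z
  proof (cases "k = w \<or> l = z")
    case True
    then show ?thesis by (auto simp: quad0)
  next
    case False
    have ne: "i \<noteq> u" "j \<noteq> v" using Q by (auto simp: quad0)
    obtain \<pi> where \<pi>: "\<pi> \<in> sym_grp n" "map \<pi> [i, u, k, w] = [j, v, l, z]"
      using presc[of "[i, u, k, w]" "[j, v, l, z]"] X D False ne by auto
    let ?\<pi>1 = "\<pi> \<circ> Transposition.transpose i u"
    have 1: "?\<pi>1 \<in> sym_grp n" "f ?\<pi>1 = f \<pi> + quad c i u j v"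
      using step[OF \<pi>(1), of i u] \<pi>(2) X ne by auto
    have "?\<pi>1 k = l" "?\<pi>1 w = z" using \<pi>(2) D by (auto simp: Transposition.transpose_def)
    then have 2: "f (?\<pi>1 \<circ> Transposition.transpose k w) \<in> {0, 1}"
       "f (?\<pi>1 \<circ> Transposition.transpose k w) = f \<pi> + quad c i u j v + quad c k w l z"
      using step[OF 1(1), of k w] X False f[of "?\<pi>1 \<circ> Transposition.transpose k w"] 1(2) by auto
    have 3: "f (\<pi> \<circ> Transposition.transpose k w) \<in> {0, 1}"
       "f (\<pi> \<circ> Transposition.transpose k w) = f \<pi> + quad c k w l z"
      using step[OF \<pi>(1), of k w] X False f[of "\<pi> \<circ> Transposition.transpose k w"] \<pi>(2) by auto
    show ?thesis using f[OF \<pi>(1)] f[OF 1(1)] 1(2) 2 3 Q by auto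
  qed
  have cyc: "\<bar>quad c x z j v + quad c y z v l\<bar> \<le> 1"
    if X: "{x, y, z, j, v, l} \<subseteq> X" and "card {x, y, z} = 3" "card {j, v, l} = 3" for x y z j v l
  proof -
    have ne: "x \<noteq> y" "x \<noteq> z" "y \<noteq> z" "j \<noteq> v" "j \<noteq> l" "v \<noteq> l"
      using that(2,3) by (auto simp: card_insert_if split: if_splits)
    obtain \<pi> where \<pi>: "\<pi> \<in> sym_grp n" "map \<pi> [x, y, z] = [j, v, l]"
      using presc[of "[x, y, z]" "[j, v, l]"] X ne by auto
    let ?\<pi>1 = "\<pi> \<circ> Transposition.transpose y z"
    have 1: "?\<pi>1 \<in> sym_grp n" "f ?\<pi>1 = f \<pi> + quad c y z v l"
      using step[OF \<pi>(1), of y z] \<pi>(2) X ne by auto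
    have "?\<pi>1 x = j" "?\<pi>1 z = v" using \<pi>(2) ne by (auto simp: Transposition.transpose_def)
    then have "f (?\<pi>1 \<circ> Transposition.transpose x z) \<in> {0, 1}"
       "f (?\<pi>1 \<circ> Transposition.transpose x z) = f \<pi> + quad c y z v l + quad c x z j v"
      using step[OF 1(1), of x z] X ne f[of "?\<pi>1 \<circ> Transposition.transpose x z"] 1(2) by auto
    then show ?thesis using f[OF \<pi>(1)] by auto
  qed
  \<comment> \<open>A Boolean function that depends on \<open>h \<pi>\<close> alone is an indicator
    of \<open>h \<pi>\<close>; later \<open>h\<close> is the value at a row or the preimage of a
    column.\<close>
  have finish: ?thesis if P: "\<forall>\<pi>\<in>sym_grp n. lin n c \<pi> = P (h \<pi>)"
    and d: "\<And>Q. dictator n (\<lambda>\<pi>. if Q (h \<pi>) then 1 else 0)" for P :: "nat \<Rightarrow> real" and h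
  proof (intro exI conjI ballI)
    show "dictator n (\<lambda>\<pi>. if b + P (h \<pi>) = 1 then 1 else 0)" by (rule d)
    show "f \<pi> = (if b + P (h \<pi>) = 1 then 1 else 0)" if "\<pi> \<in> sym_grp n" for \<pi>
      using f[OF that] lin[OF that] P that by auto
  qed
  have row: ?thesis if x: "x \<in> X" and q: "\<forall>i\<in>X - {x}. \<forall>u\<in>X - {x}. \<forall>j\<in>X. \<forall>v\<in>X. quad c i u j v = 0" for x
  proof -
    obtain P where "\<forall>\<pi>\<in>sym_grp n. lin n c \<pi> = P (\<pi> x)"
      using lin_one_row[of x n c] x q unfolding X_def by blast
    then show ?thesis by (rule finish) (rule row_dictator, use x in \<open>simp add: X_def\<close>)
  qed
  have col: ?thesis if y: "y \<in> X" and q: "\<forall>i\<in>X. \<forall>u\<in>X. \<forall>j\<in>X - {y}. \<forall>v\<in>X - {y}. quad c i u j v = 0" for y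
  proof -
    have tr: "quad (\<lambda>j i. c i j) j v i u = quad c i u j v" for i u j v by (simp add: quad_def)
    obtain P where "\<forall>\<pi>\<in>sym_grp n. lin n (\<lambda>j i. c i j) \<pi> = P (\<pi> y)"
      using lin_one_row[of y n "\<lambda>j i. c i j"] y q unfolding X_def tr by blast
    then have "\<forall>\<pi>\<in>sym_grp n. lin n c \<pi> = P (inv \<pi> y)" by (simp add: lin_inv[of _ n c] sym_grp_inv)
    then show ?thesis by (rule finish) (rule col_dictator, use y in \<open>simp add: X_def\<close>)
  qed
  have 1: "1 \<in> X" using n by (simp add: X_def)
  show ?thesis
  proof (cases "3 \<le> n")
    case True
    then have "3 \<le> card X" "finite X" by (simp_all add: X_def)
    then have "(\<exists>x. \<forall>i\<in>X - {x}. \<forall>u\<in>X - {x}. \<forall>j\<in>X. \<forall>v\<in>X. quad c i u j v = 0) \<or>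
      (\<exists>y. \<forall>i\<in>X. \<forall>u\<in>X. \<forall>j\<in>X - {y}. \<forall>v\<in>X - {y}. quad c i u j v = 0)"
      by (rule exact_line_structure) (fact int, fact disj, fact cyc)
    then show ?thesis
    proof (elim disjE exE)
      fix x assume x: "\<forall>i\<in>X - {x}. \<forall>u\<in>X - {x}. \<forall>j\<in>X. \<forall>v\<in>X. quad c i u j v = 0"
      show ?thesis
      proof (cases "x \<in> X")
        case True
        then show ?thesis using x by (rule row)
      next
        case False
        then show ?thesis using row[OF 1] x by blast
      qed
    next
      fix y assume y: "\<forall>i\<in>X. \<forall>u\<in>X. \<forall>j\<in>X - {y}. \<forall>v\<in>X - {y}. quad c i u j v = 0"
      show ?thesis
      proof (cases "y \<in> X")
        case True
        then show ?thesis using y by (rule col)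
      next
        case False
        then show ?thesis using col[OF 1] y by blast
      qed
    qed
  next
    case False
    \<comment> \<open>For \<open>n = 2\<close>, deleting row 1 leaves a single row, where all slopes
      are trivially 0.\<close>
    then have "X - {1} = {2}" using n by (auto simp: X_def)
    then show ?thesis using row[OF 1] by (auto simp: quad0)
  qed
qed

section \<open>Counting conflicting entries\<close>

text \<open>Among three values one has frequency at least a third. A nonzero \<open>t\<close> is
  chosen only when 0 is rarer than that, and then more than half of the entries are nonzero.\<close>

lemma frequent_value:
  fixes r :: "nat \<Rightarrow> int"
  assumes fin: "finite X" and r: "\<And>j. j \<in> X \<Longrightarrow> r j \<in> {-1, 0, 1}"
  shows "\<exists>t. card X \<le> 3 * card {j\<in>X. r j = t} \<and> (t \<noteq> 0 \<longrightarrow> card X \<le> 2 * card {j\<in>X. r j \<noteq> 0})"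
proof -
  have "card X \<le> card ({j\<in>X. r j = 0} \<union> {j\<in>X. r j \<noteq> 0})" using fin by (intro card_mono) auto
  also have "\<dots> \<le> card {j\<in>X. r j = 0} + card {j\<in>X. r j \<noteq> 0}" by (rule card_Un_le)
  finally have a: "card X \<le> card {j\<in>X. r j = 0} + card {j\<in>X. r j \<noteq> 0}" .
  have "card {j\<in>X. r j \<noteq> 0} \<le> card ({j\<in>X. r j = 1} \<union> {j\<in>X. r j = -1})"
    using fin r by (intro card_mono) auto
  also have "\<dots> \<le> card {j\<in>X. r j = 1} + card {j\<in>X. r j = -1}" by (rule card_Un_le)
  finally have b: "card {j\<in>X. r j \<noteq> 0} \<le> card {j\<in>X. r j = 1} + card {j\<in>X. r j = -1}" .
  consider "card X \<le> 3 * card {j\<in>X. r j = 0}"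
    | "3 * card {j\<in>X. r j = 0} < card X" "card X \<le> 3 * card {j\<in>X. r j = 1}"
    | "3 * card {j\<in>X. r j = 0} < card X" "card X \<le> 3 * card {j\<in>X. r j = -1}"
    using a b by linarith
  then show ?thesis
  proof cases
    case 1
    then show ?thesis by (intro exI[of _ 0]) simp
  next
    case 2
    then show ?thesis using a by (intro exI[of _ 1]) simp
  next
    case 3
    then show ?thesis using a by (intro exI[of _ "-1"]) simp
  qed
qed

section \<open>Sparse normal form of the integer coefficients\<close>

definition supp :: "nat \<Rightarrow> (nat \<Rightarrow> nat \<Rightarrow> int) \<Rightarrow> (nat \<times> nat) set" where
  "supp n m = {(i, j). i \<in> {1..n} \<and> j \<in> {1..n} \<and> m i j \<noteq> 0}"

lemma finite_supp [simp]: "finite (supp n m)"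
  by (rule finite_subset[of _ "{1..n} \<times> {1..n}"]) (auto simp: supp_def)

lemma card_supp_rows: "card (supp n m) = (\<Sum>i=1..n. card {j\<in>{1..n}. m i j \<noteq> 0})"
proof -
  have "supp n m = Sigma {1..n} (\<lambda>i. {j\<in>{1..n}. m i j \<noteq> 0})" by (auto simp: supp_def)
  then show ?thesis by simp
qed

lemma card_supp_transpose: "card (supp n (\<lambda>j i. m i j)) = card (supp n m)"
  by (rule bij_betw_same_card[of prod.swap]) (auto simp: bij_betw_def supp_def image_iff)

text \<open>A row with nonzero \<open>u i\<close> contains at least \<open>n / 2\<close> of the at
  most \<open>12 * n\<close> nonzero entries, so there are at most 24 such rows.\<close>

lemma frequent_row_values:
  assumes m: "\<And>i j. m i j \<in> {-1, 0, 1}" and supp: "card (supp n m) \<le> 12 * n"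
  shows "\<exists>u. (\<forall>i\<in>{1..n}. n \<le> 3 * card {j\<in>{1..n}. m i j = u i}) \<and> card {i\<in>{1..n}. u i \<noteq> 0} \<le> 24"
proof -
  have "\<exists>t. n \<le> 3 * card {j\<in>{1..n}. m i j = t} \<and> (t \<noteq> 0 \<longrightarrow> n \<le> 2 * card {j\<in>{1..n}. m i j \<noteq> 0})" for i
    using frequent_value[of "{1..n}" "m i"] m by simp
  then have "\<exists>u. \<forall>i. n \<le> 3 * card {j\<in>{1..n}. m i j = u i} \<and> (u i \<noteq> 0 \<longrightarrow> n \<le> 2 * card {j\<in>{1..n}. m i j \<noteq> 0})"
    by (intro choice allI)
  then obtain u where u: "\<And>i. n \<le> 3 * card {j\<in>{1..n}. m i j = u i}"
    "\<And>i. u i \<noteq> 0 \<Longrightarrow> n \<le> 2 * card {j\<in>{1..n}. m i j \<noteq> 0}" by blast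
  define H where "H = {i\<in>{1..n}. u i \<noteq> 0}"
  have "card H * n = (\<Sum>i\<in>H. n)" by simp
  also have "\<dots> \<le> (\<Sum>i\<in>H. 2 * card {j\<in>{1..n}. m i j \<noteq> 0})"
    by (rule sum_mono) (use u(2) in \<open>simp add: H_def\<close>)
  also have "\<dots> \<le> (\<Sum>i=1..n. 2 * card {j\<in>{1..n}. m i j \<noteq> 0})"
    by (rule sum_mono2) (auto simp: H_def)
  also have "\<dots> \<le> 24 * n" using supp by (simp add: card_supp_rows flip: sum_distrib_left)
  finally have "card H \<le> 24 \<or> n = 0" by auto
  moreover have "H = {}" if "n = 0" using that by (auto simp: H_def)
  ultimately have "card H \<le> 24" by auto
  then show ?thesis using u(1) unfolding H_def by blast
qed

text \<open>The row shift makes the frequent value zero; the column shift can spoil this only in the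
  at most 24 columns where \<open>v\<close> is nonzero.\<close>

lemma sparse_rows_after_shift:
  assumes u: "\<And>i. i \<in> {1..n} \<Longrightarrow> n \<le> 3 * card {j\<in>{1..n}. m i j = u i}"
    and v: "card {j\<in>{1..n}. v j \<noteq> 0} \<le> 24" and i: "i \<in> {1..n}"
  shows "real n / 3 - 24 \<le> card {j\<in>{1..n}. m i j - u i - v j = (0 :: int)}"
proof -
  define Z V where "Z = {j\<in>{1..n}. m i j - u i - v j = (0 :: int)}" and "V = {j\<in>{1..n}. v j \<noteq> 0}"
  have "{j\<in>{1..n}. m i j = u i} \<subseteq> Z \<union> V" by (auto simp: Z_def V_def)
  then have "card {j\<in>{1..n}. m i j = u i} \<le> card (Z \<union> V)"
    by (intro card_mono) (auto simp: Z_def V_def)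
  also have "\<dots> \<le> card Z + card V" by (rule card_Un_le)
  also have "\<dots> \<le> card Z + 24" using v unfolding V_def by (rule add_left_mono)
  finally have "3 * card {j\<in>{1..n}. m i j = u i} \<le> 3 * (card Z + 24)" by (rule mult_le_mono2)
  then have "n \<le> 3 * (card Z + 24)" by (rule le_trans[OF u[OF i]])
  then have "real n \<le> real (3 * (card Z + 24))" by (rule of_nat_mono)
  then have "real n / 3 - 24 \<le> card Z" by simp
  then show ?thesis unfolding Z_def .
qed

text \<open>Frequent values of rows and columns are subtracted at the price of a constant
  \<open>s\<close>. The many zeros in every line are what allows a nonzero entry to be completed to
  a nonzero slope; the at most 24 shifted rows and 24 shifted columns add \<open>48 * n\<close> to
  the support.\<close>

lemma sparse_normal_form:
  assumes m: "\<And>i j. m i j \<in> {-1, 0, 1}" and supp: "card (supp n m) \<le> 12 * n"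
  shows "\<exists>(s :: int) m'.
     (\<forall>\<pi>\<in>sym_grp n. lin n (\<lambda>i j. of_int (m i j)) \<pi> = of_int s + lin n (\<lambda>i j. of_int (m' i j)) \<pi>) \<and>
     card (supp n m') \<le> 60 * n \<and>
     (\<forall>i\<in>{1..n}. real n / 3 - 24 \<le> card {j\<in>{1..n}. m' i j = 0}) \<and>
     (\<forall>j\<in>{1..n}. real n / 3 - 24 \<le> card {i\<in>{1..n}. m' i j = 0})"
proof -
  have "\<exists>u. (\<forall>i\<in>{1..n}. n \<le> 3 * card {j\<in>{1..n}. m i j = u i}) \<and> card {i\<in>{1..n}. u i \<noteq> 0} \<le> 24"
    using m supp by (rule frequent_row_values)
  then obtain u where u: "\<forall>i\<in>{1..n}. n \<le> 3 * card {j\<in>{1..n}. m i j = u i}"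
    "card {i\<in>{1..n}. u i \<noteq> 0} \<le> 24"
    by (elim exE conjE) (rule that)
  have supp': "card (supp n (\<lambda>j i. m i j)) \<le> 12 * n" using supp card_supp_transpose[of n m] by linarith
  have "\<exists>v. (\<forall>j\<in>{1..n}. n \<le> 3 * card {i\<in>{1..n}. m i j = v j}) \<and> card {j\<in>{1..n}. v j \<noteq> 0} \<le> 24"
    using m supp' by (rule frequent_row_values)
  then obtain v where v: "\<forall>j\<in>{1..n}. n \<le> 3 * card {i\<in>{1..n}. m i j = v j}"
    "card {j\<in>{1..n}. v j \<noteq> 0} \<le> 24"
    by (elim exE conjE) (rule that)
  define m' where "m' = (\<lambda>i j. m i j - u i - v j)"
  define s where "s = (\<Sum>i=1..n. u i) + (\<Sum>j=1..n. v j)"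
  have lin: "lin n (\<lambda>i j. of_int (m i j)) \<pi> = of_int s + lin n (\<lambda>i j. of_int (m' i j)) \<pi>"
    if "\<pi> \<in> sym_grp n" for \<pi>
  proof -
    have "(\<Sum>i=1..n. real_of_int (v (\<pi> i))) = (\<Sum>j=1..n. of_int (v j))" by (rule sum_permuted[OF that])
    then show ?thesis by (simp add: lin_def m'_def s_def sum_subtractf)
  qed
  have rows: "real n / 3 - 24 \<le> card {j\<in>{1..n}. m' i j = 0}" if "i \<in> {1..n}" for i
    unfolding m'_def by (rule sparse_rows_after_shift[OF bspec[OF u(1)] v(2) that])
  have cols: "real n / 3 - 24 \<le> card {i\<in>{1..n}. m' i j = 0}" if "j \<in> {1..n}" for j
  proof -
    have "real n / 3 - 24 \<le> card {i\<in>{1..n}. m i j - v j - u i = 0}"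
      by (rule sparse_rows_after_shift[where m="\<lambda>j i. m i j" and u=v and v=u, OF bspec[OF v(1)] u(2) that])
    moreover have "m i j - v j - u i = m' i j" for i by (simp add: m'_def)
    ultimately show ?thesis by simp
  qed
  have "supp n m' \<subseteq> supp n m \<union> ({i\<in>{1..n}. u i \<noteq> 0} \<times> {1..n} \<union> {1..n} \<times> {j\<in>{1..n}. v j \<noteq> 0})"
    by (auto simp: supp_def m'_def)
  then have "card (supp n m') \<le> card (supp n m \<union> ({i\<in>{1..n}. u i \<noteq> 0} \<times> {1..n} \<union> {1..n} \<times> {j\<in>{1..n}. v j \<noteq> 0}))"
    by (intro card_mono) auto
  also have "\<dots> \<le> card (supp n m) + (card ({i\<in>{1..n}. u i \<noteq> 0} \<times> {1..n}) + card ({1..n} \<times> {j\<in>{1..n}. v j \<noteq> 0}))"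
    by (rule order_trans[OF card_Un_le add_left_mono[OF card_Un_le]])
  also have "\<dots> \<le> 12 * n + (24 * n + n * 24)"
    using supp u(2) v(2) unfolding card_cartesian_product by (intro add_mono mult_mono) auto
  finally have "card (supp n m') \<le> 60 * n" by simp
  then show ?thesis using lin rows cols by blast
qed

text \<open>All positions outside \<open>P\<close> are interchangeable, and at most one of them is sent to \<open>i\<close>.\<close>

lemma pavg_fresh_position:
  assumes P: "P \<subseteq> {1..n}" and p: "p \<in> {1..n} - P"
    and G: "\<And>\<pi>. \<pi> \<in> sym_grp n \<Longrightarrow> 0 \<le> G \<pi>"
    and dep: "\<And>\<pi> \<pi>'. (\<And>q. q \<in> P \<Longrightarrow> \<pi> q = \<pi>' q) \<Longrightarrow> G \<pi> = G \<pi>'"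
  shows "real (n - card P) * pavg n (\<lambda>\<pi>. G \<pi> * of_bool (\<pi> p = i)) \<le> pavg n G"
proof -
  have fP: "finite P" using P finite_subset by blast
  have eq: "pavg n (\<lambda>\<pi>. G \<pi> * of_bool (\<pi> q = i)) = pavg n (\<lambda>\<pi>. G \<pi> * of_bool (\<pi> p = i))"
    if q: "q \<in> {1..n} - P" for q
  proof -
    let ?t = "Transposition.transpose p q"
    have "G (\<pi> \<circ> ?t) = G \<pi>" for \<pi> by (rule dep) (use p q in \<open>auto simp: Transposition.transpose_def\<close>)
    then have "pavg n (\<lambda>\<pi>. G \<pi> * of_bool (\<pi> p = i)) = pavg n (\<lambda>\<pi>. G (\<pi> \<circ> ?t) * of_bool ((\<pi> \<circ> ?t) q = i))"
      by simp
    also have "\<dots> = pavg n (\<lambda>\<pi>. G \<pi> * of_bool (\<pi> q = i))"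
      using sym_grp_transpose[of p n q] p q by (intro pavg_compose_right) auto
    finally show ?thesis by simp
  qed
  have "real (n - card P) * pavg n (\<lambda>\<pi>. G \<pi> * of_bool (\<pi> p = i))
      = (\<Sum>q\<in>{1..n} - P. pavg n (\<lambda>\<pi>. G \<pi> * of_bool (\<pi> q = i)))"
    using P fP by (simp add: eq card_Diff_subset)
  also have "\<dots> = pavg n (\<lambda>\<pi>. G \<pi> * (\<Sum>q\<in>{1..n} - P. of_bool (\<pi> q = i)))"
    unfolding sum_distrib_left pavg_sum by (rule refl)
  also have "\<dots> \<le> pavg n G"
  proof (rule pavg_mono)
    fix \<pi> assume \<pi>: "\<pi> \<in> sym_grp n"
    have "card (({1..n} - P) \<inter> {q. \<pi> q = i}) \<le> card {inv \<pi> i}"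
      by (rule card_mono) (auto simp: sym_grp_inv_iff[OF \<pi>])
    then have "(\<Sum>q\<in>{1..n} - P. of_bool (\<pi> q = i)) \<le> (1 :: real)" by simp
    then show "G \<pi> * (\<Sum>q\<in>{1..n} - P. of_bool (\<pi> q = i)) \<le> G \<pi>"
      using G[OF \<pi>] by (simp add: mult_left_le)
  qed
  finally show ?thesis .
qed

lemma pavg_two_fresh_positions:
  assumes P: "P \<subseteq> {1..n}" and p: "p \<in> {1..n} - P" "p' \<in> {1..n} - P"
    and G: "\<And>\<sigma> \<pi>. 0 \<le> G \<sigma> \<pi>"
    and dep: "\<And>\<sigma> \<sigma>' \<pi> \<pi>'. (\<And>q. q \<in> P \<Longrightarrow> \<sigma> q = \<sigma>' q) \<Longrightarrow> (\<And>q. q \<in> P \<Longrightarrow> \<pi> q = \<pi>' q) \<Longrightarrow> G \<sigma> \<pi> = G \<sigma>' \<pi>'"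
  shows "(real (n - card P))\<^sup>2 * pavg n (\<lambda>\<sigma>. pavg n (\<lambda>\<pi>. G \<sigma> \<pi> * of_bool (\<sigma> p = i \<and> \<pi> p' = j)))
     \<le> pavg n (\<lambda>\<sigma>. pavg n (\<lambda>\<pi>. G \<sigma> \<pi>))"
proof -
  let ?r = "real (n - card P)"
  have "?r\<^sup>2 * pavg n (\<lambda>\<sigma>. pavg n (\<lambda>\<pi>. G \<sigma> \<pi> * of_bool (\<sigma> p = i \<and> \<pi> p' = j)))
      = ?r * pavg n (\<lambda>\<sigma>. (?r * pavg n (\<lambda>\<pi>. G \<sigma> \<pi> * of_bool (\<pi> p' = j))) * of_bool (\<sigma> p = i))"
    by (simp add: power2_eq_square mult.assoc pavg_cmult[symmetric] of_bool_conj ac_simps)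
  also have "\<dots> \<le> ?r * pavg n (\<lambda>\<sigma>. pavg n (G \<sigma>) * of_bool (\<sigma> p = i))"
    by (intro mult_left_mono pavg_mono mult_right_mono pavg_fresh_position[OF P p(2)])
      (auto intro!: G dep)
  also have "\<dots> \<le> pavg n (\<lambda>\<sigma>. pavg n (G \<sigma>))"
    by (rule pavg_fresh_position[OF P p(1)])
      (auto intro!: G pavg_nonneg arg_cong[where f="pavg n"] dep)
  finally show ?thesis .
qed

section \<open>Probability that a random subcube contains a conflict\<close>

text \<open>For lists of length \<open>r\<close> the probability is \<open>(n - r)! / n!\<close>,
  and \<open>n! \<le> n^r * (n - r)!\<close>.\<close>

lemma pavg_prescribed:
  assumes "distinct xs" "distinct ys" "set xs \<subseteq> {1..n}" "set ys \<subseteq> {1..n}" "length xs = length ys"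
  shows "1 / real n ^ length xs \<le> pavg n (\<lambda>\<pi>. of_bool (map \<pi> xs = ys))"
proof -
  have len: "length xs \<le> n" using card_mono[of "{1..n}" "set xs"] assms by (simp add: distinct_card)
  have "fact n \<le> real n ^ length xs * fact (n - length xs)"
  proof -
    have "fact n div fact (n - length xs) \<le> n ^ length xs" using len by (rule fact_div_fact_le_pow)
    moreover have "fact (n - length xs) dvd (fact n :: nat)" by (rule fact_dvd) simp
    ultimately have "(fact n :: nat) \<le> n ^ length xs * fact (n - length xs)"
      by (metis dvd_div_mult_self mult_le_mono1)
    then have "real (fact n) \<le> real (n ^ length xs * fact (n - length xs))" by (rule of_nat_mono)
    then show ?thesis by simp
  qed
  moreover have "(\<Sum>\<pi>\<in>sym_grp n. of_bool (map \<pi> xs = ys)) = (fact (n - length xs) :: real)"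
  proof -
    have "(\<Sum>\<pi>\<in>sym_grp n. of_bool (map \<pi> xs = ys)) = real (card {\<pi>\<in>sym_grp n. map \<pi> xs = ys})"
      by (simp add: of_bool_def sum.If_cases Int_def)
    also have "{\<pi>\<in>sym_grp n. map \<pi> xs = ys} = {p. p permutes {1..n} \<and> map p xs = ys}" by (simp add: sym_grp_def)
    also have "card \<dots> = fact (n - length xs)" using card_permutes_prescribed[OF _ assms] by simp
    finally show ?thesis by simp
  qed
  moreover have "0 < real n ^ length xs" using len by (cases "n = 0") auto
  ultimately show ?thesis by (simp add: pavg_def field_simps)
qed

definition conflicts :: "nat \<Rightarrow> (nat \<Rightarrow> nat \<Rightarrow> int) \<Rightarrow> ((nat \<times> nat) \<times> nat \<times> nat) set" where
  "conflicts n m = {((i, j), (k, l)). (i, j) \<in> supp n m \<and> (k, l) \<in> supp n m \<and> i \<noteq> k \<and> j \<noteq> l}"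

lemma finite_conflicts [simp]: "finite (conflicts n m)"
  by (rule finite_subset[of _ "supp n m \<times> supp n m"]) (auto simp: conflicts_def)

lemma card_ge_minus_three:
  assumes "real n / 3 - 24 \<le> card A" "finite E" "card E \<le> 3"
  shows "real n / 3 - 27 \<le> card (A - E)"
  using diff_card_le_card_Diff[OF assms(2), of A] assms by linarith

text \<open>When the other three corners are zero, the slope through \<open>(i, j)\<close> is
  \<open>m i j\<close> up to sign. The zeros of column \<open>j\<close> and of row \<open>i\<close>
  span a grid of about \<open>(n / 3)\<^sup>2\<close> candidates, of which at most
  \<open>60 * n\<close> hit a nonzero \<open>m u v\<close>. The sets \<open>E\<close> and
  \<open>E'\<close> are meant for rows and columns already in use.\<close>

lemma many_completions:
  assumes n: "10000 \<le> n" and supp: "card (supp n m) \<le> 60 * n"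
    and rows: "real n / 3 - 24 \<le> card {j\<in>{1..n}. m i j = 0}"
    and cols: "real n / 3 - 24 \<le> card {i\<in>{1..n}. m i j = 0}"
    and E: "finite E" "card E \<le> 3" "finite E'" "card E' \<le> 3"
  shows "(real n)\<^sup>2 / 16 \<le> card {(u, v). u \<in> {1..n} - E \<and> v \<in> {1..n} - E' \<and> m u j = 0 \<and> m i v = 0 \<and> m u v = 0}"
    (is "_ \<le> real (card ?S)")
proof -
  define A B where "A = {i\<in>{1..n}. m i j = 0} - E" and "B = {j\<in>{1..n}. m i j = 0} - E'"
  have fin: "finite A" "finite B" by (auto simp: A_def B_def)
  have fS: "finite ?S" by (rule finite_subset[of _ "{1..n} \<times> {1..n}"]) auto
  have "real n / 3 - 27 \<le> card A" "real n / 3 - 27 \<le> card B"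
    unfolding A_def B_def by (rule card_ge_minus_three; use rows cols E in simp)+
  then have "(real n / 3 - 27)\<^sup>2 \<le> real (card A) * real (card B)"
    using n unfolding power2_eq_square by (intro mult_mono) auto
  also have "\<dots> = real (card (A \<times> B))" by (simp add: card_cartesian_product)
  also have "\<dots> \<le> real (card (?S \<union> supp n m))"
  proof (intro of_nat_mono card_mono)
    show "finite (?S \<union> supp n m)" using fS by simp
    show "A \<times> B \<subseteq> ?S \<union> supp n m" by (auto simp: A_def B_def supp_def)
  qed
  also have "\<dots> \<le> real (card ?S) + 60 * real n"
    using card_Un_le[of ?S "supp n m"] supp by linarith
  finally have *: "(real n / 3 - 27)\<^sup>2 - 60 * real n \<le> card ?S" by simp
  have "(real n / 3 - 27)\<^sup>2 - 60 * real n
      = (real n)\<^sup>2 / 16 + (real n * (7 * real n - 11232) + 104976) / 144"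
    by (simp add: power2_eq_square field_simps)
  also have "\<dots> \<ge> (real n)\<^sup>2 / 16" using n by simp
  finally have "(real n)\<^sup>2 / 16 \<le> (real n / 3 - 27)\<^sup>2 - 60 * real n" .
  with * show ?thesis by linarith
qed

text \<open>A conflict together with completions of its two entries prescribes
  \<open>\<sigma>\<close> and \<open>\<pi>\<close> at four positions and makes both slopes nonzero.
  There are at least \<open>(n\<^sup>2 / 16)\<^sup>2\<close> completions per conflict, and the
  resulting events are disjoint, each of probability at least \<open>1 / n^8\<close>.\<close>

lemma pair_active_lower:
  assumes n: "10000 \<le> n" and supp: "card (supp n m) \<le> 60 * n"
    and rows: "\<And>i. i \<in> {1..n} \<Longrightarrow> real n / 3 - 24 \<le> card {j\<in>{1..n}. m i j = 0}"
    and cols: "\<And>j. j \<in> {1..n} \<Longrightarrow> real n / 3 - 24 \<le> card {i\<in>{1..n}. m i j = 0}"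
    and ps: "distinct [p1, p2, p3, p4]" "set [p1, p2, p3, p4] \<subseteq> {1..n}"
  defines "q \<equiv> quad (\<lambda>i j. of_int (m i j))"
  shows "card (conflicts n m) / (256 * real n ^ 4)
    \<le> pavg n (\<lambda>\<sigma>. pavg n (\<lambda>\<pi>. of_bool (q (\<sigma> p1) (\<sigma> p2) (\<pi> p1) (\<pi> p2) \<noteq> 0 \<and> q (\<sigma> p3) (\<sigma> p4) (\<pi> p3) (\<pi> p4) \<noteq> 0)))"
proof -
  define UV where "UV = (\<lambda>i j E E'. {(u, v). u \<in> {1..n} - E \<and> v \<in> {1..n} - E' \<and> m u j = 0 \<and> m i v = 0 \<and> m u v = 0})"
  have fUV: "finite (UV i j E E')" for i j E E'
    by (rule finite_subset[of _ "{1..n} \<times> {1..n}"]) (auto simp: UV_def)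
  have cUV: "(real n)\<^sup>2 / 16 \<le> card (UV i j E E')"
    if "i \<in> {1..n}" "j \<in> {1..n}" "finite E" "card E \<le> 3" "finite E'" "card E' \<le> 3" for i j E E'
    unfolding UV_def by (rule many_completions[OF n supp rows[OF that(1)] cols[OF that(2)] that(3-6)])
  \<comment> \<open>The excluded rows and columns keep the four rows and the four columns of a tuple
    distinct; at most three are excluded at a time.\<close>
  define T where "T = Sigma (conflicts n m) (\<lambda>((i, j), (k, l)).
      Sigma (UV i j {i, k} {j, l}) (\<lambda>(u, v). UV k l {i, k, u} {j, l, v}))"
  define L where "L = (\<lambda>(((i :: nat, j :: nat), (k :: nat, l :: nat)), (u :: nat, v :: nat), (w :: nat, z :: nat)). ([i, u, k, w], [j, v, l, z]))"
  have finT: "finite T" unfolding T_def by (intro finite_SigmaI) (auto simp: fUV split: prod.splits)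
  have injL: "inj_on L T" by (auto simp: inj_on_def L_def)
  have cardT: "real (card (conflicts n m)) * ((real n)\<^sup>2 / 16 * ((real n)\<^sup>2 / 16)) \<le> card T"
  proof -
    have c3: "card {a, b, c :: nat} \<le> 3" for a b c by (simp add: card_insert_if)
    have c2: "card {a, b :: nat} \<le> 3" for a b by (simp add: card_insert_if)
    have in1: "(real n)\<^sup>2 / 16 * ((real n)\<^sup>2 / 16) \<le> real (card (Sigma (UV i j {i, k} {j, l}) (\<lambda>(u, v). UV k l {i, k, u} {j, l, v})))"
      if "((i, j), (k, l)) \<in> conflicts n m" for i j k l
    proof -
      have ijkl: "i \<in> {1..n}" "j \<in> {1..n}" "k \<in> {1..n}" "l \<in> {1..n}" using that by (auto simp: conflicts_def supp_def)
      have "(real n)\<^sup>2 / 16 * ((real n)\<^sup>2 / 16) \<le> real (card (UV i j {i, k} {j, l})) * ((real n)\<^sup>2 / 16)"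
        using cUV[OF ijkl(1,2), of "{i, k}" "{j, l}"] c2 by (intro mult_right_mono) simp_all
      also have "\<dots> = (\<Sum>p\<in>UV i j {i, k} {j, l}. (real n)\<^sup>2 / 16)" by simp
      also have "\<dots> \<le> (\<Sum>p\<in>UV i j {i, k} {j, l}. real (card (case p of (u, v) \<Rightarrow> UV k l {i, k, u} {j, l, v})))"
        by (rule sum_mono) (use cUV[OF ijkl(3,4)] c3 in \<open>auto split: prod.splits\<close>)
      also have "\<dots> = real (card (Sigma (UV i j {i, k} {j, l}) (\<lambda>(u, v). UV k l {i, k, u} {j, l, v})))"
        by (subst card_SigmaI) (auto simp: fUV split: prod.splits)
      finally show ?thesis .
    qed
    have "real (card (conflicts n m)) * ((real n)\<^sup>2 / 16 * ((real n)\<^sup>2 / 16))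
       = (\<Sum>t\<in>conflicts n m. (real n)\<^sup>2 / 16 * ((real n)\<^sup>2 / 16))" by simp
    also have "\<dots> \<le> (\<Sum>t\<in>conflicts n m. real (card ((\<lambda>((i, j), (k, l)).
      Sigma (UV i j {i, k} {j, l}) (\<lambda>(u, v). UV k l {i, k, u} {j, l, v})) t)))"
      by (rule sum_mono) (use in1 in \<open>auto split: prod.splits\<close>)
    also have "\<dots> = card T"
      unfolding T_def by (subst card_SigmaI) (auto simp: fUV split: prod.splits intro!: finite_SigmaI)
    finally show ?thesis .
  qed
  define xs where "xs = [p1, p2, p3, p4]"
  have xs: "distinct xs" "set xs \<subseteq> {1..n}" "length xs = 4" using ps by (simp_all add: xs_def)
  define \<Phi> where "\<Phi> = (\<lambda>\<sigma> \<pi>. of_bool (q (\<sigma> p1) (\<sigma> p2) (\<pi> p1) (\<pi> p2) \<noteq> 0 \<and> q (\<sigma> p3) (\<sigma> p4) (\<pi> p3) (\<pi> p4) \<noteq> 0) :: real)"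
  have good: "distinct (fst (L t))" "distinct (snd (L t))" "set (fst (L t)) \<subseteq> {1..n}" "set (snd (L t)) \<subseteq> {1..n}"
      "length (fst (L t)) = 4" "length (snd (L t)) = 4" if "t \<in> T" for t
    using that by (auto simp: T_def L_def UV_def conflicts_def supp_def)
  \<comment> \<open>As \<open>L\<close> is injective, at most one tuple matches a given pair of
    permutations.\<close>
  have pt: "(\<Sum>t\<in>T. of_bool (map \<sigma> xs = fst (L t)) * of_bool (map \<pi> xs = snd (L t))) \<le> \<Phi> \<sigma> \<pi>" for \<sigma> \<pi>
  proof (cases "(map \<sigma> xs, map \<pi> xs) \<in> L ` T")
    case True
    then obtain t0 where t0: "t0 \<in> T" "L t0 = (map \<sigma> xs, map \<pi> xs)" by auto
    have "(\<Sum>t\<in>T. of_bool (map \<sigma> xs = fst (L t)) * of_bool (map \<pi> xs = snd (L t)))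
       = (\<Sum>t\<in>T. of_bool (t = t0) :: real)"
    proof (rule sum.cong[OF refl])
      fix t assume t: "t \<in> T"
      have "t = t0 \<longleftrightarrow> map \<sigma> xs = fst (L t) \<and> map \<pi> xs = snd (L t)"
        using inj_onD[OF injL _ t t0(1)] t0 by (metis fst_conv prod.collapse snd_conv)
      then show "of_bool (map \<sigma> xs = fst (L t)) * of_bool (map \<pi> xs = snd (L t)) = (of_bool (t = t0) :: real)"
        by simp
    qed
    also have "\<dots> \<le> 1" using finT by (simp add: of_bool_def)
    also have "1 = \<Phi> \<sigma> \<pi>"
      using t0 by (auto simp: \<Phi>_def xs_def L_def T_def UV_def conflicts_def supp_def q_def quad_def)
    finally show ?thesis .
  next
    case False
    have "(\<Sum>t\<in>T. of_bool (map \<sigma> xs = fst (L t)) * of_bool (map \<pi> xs = snd (L t))) = (0 :: real)"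
    proof (intro sum.neutral ballI)
      fix t assume "t \<in> T"
      then have "L t \<noteq> (map \<sigma> xs, map \<pi> xs)" using False by (metis imageI)
      then show "of_bool (map \<sigma> xs = fst (L t)) * of_bool (map \<pi> xs = snd (L t)) = (0 :: real)"
        by (cases "L t") auto
    qed
    then show ?thesis by (simp add: \<Phi>_def)
  qed
  have "card (conflicts n m) / (256 * real n ^ 4) = real (card (conflicts n m)) * ((real n)\<^sup>2 / 16 * ((real n)\<^sup>2 / 16)) * (1 / real n ^ 4 * (1 / real n ^ 4))"
    using n by (simp add: field_simps flip: power_add)
  also have "\<dots> \<le> card T * (1 / real n ^ 4 * (1 / real n ^ 4))"
    by (rule mult_right_mono[OF cardT]) simp
  also have "\<dots> = (\<Sum>t\<in>T. 1 / real n ^ 4 * (1 / real n ^ 4))" by simp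
  also have "\<dots> \<le> (\<Sum>t\<in>T. pavg n (\<lambda>\<sigma>. of_bool (map \<sigma> xs = fst (L t))) * pavg n (\<lambda>\<pi>. of_bool (map \<pi> xs = snd (L t))))"
  proof (intro sum_mono mult_mono)
    fix t assume t: "t \<in> T"
    show "1 / real n ^ 4 \<le> pavg n (\<lambda>\<sigma>. of_bool (map \<sigma> xs = fst (L t)))"
      using pavg_prescribed[of xs "fst (L t)" n, unfolded xs(3)] good[OF t] xs by simp
    show "1 / real n ^ 4 \<le> pavg n (\<lambda>\<sigma>. of_bool (map \<sigma> xs = snd (L t)))"
      using pavg_prescribed[of xs "snd (L t)" n, unfolded xs(3)] good[OF t] xs by simp
  qed (auto intro: pavg_nonneg)
  also have "\<dots> = pavg n (\<lambda>\<sigma>. pavg n (\<lambda>\<pi>. \<Sum>t\<in>T. of_bool (map \<sigma> xs = fst (L t)) * of_bool (map \<pi> xs = snd (L t))))"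
    unfolding pavg_sum pavg_cmult pavg_multc by (rule refl)
  also have "\<dots> \<le> pavg n (\<lambda>\<sigma>. pavg n (\<lambda>\<pi>. \<Phi> \<sigma> \<pi>))"
    by (intro pavg_mono pt)
  finally show ?thesis by (simp add: \<Phi>_def)
qed

text \<open>On the natural numbers the polynomial equals \<open>r\<close> at 2 and 3 and is at most
  0 elsewhere.\<close>

lemma nat_cubic_le:
  assumes "0 \<le> (\<eta> :: real)" "2 \<le> r \<Longrightarrow> real r \<le> \<eta>"
  shows "real r * (real r - 1) * (2 - real r / 2) \<le> \<eta>"
proof -
  consider "r = 0" | "r = 1" | "r = 2" | "r = 3" | "4 \<le> r" by linarith
  then show ?thesis
  proof cases
    case 5
    then have "real r * (real r - 1) * (2 - real r / 2) \<le> 0"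
      by (intro mult_nonneg_nonpos mult_nonneg_nonneg) auto
    then show ?thesis using assms(1) by linarith
  qed (use assms in auto)
qed

text \<open>Truncated inclusion-exclusion: \<open>(r)\<^sub>2 - (r)\<^sub>3 / 2\<close> is at most \<open>r\<close> for \<open>r \<ge> 2\<close> and vanishes otherwise.\<close>

lemma sum_pairs_minus_triples:
  fixes A :: "nat \<Rightarrow> bool"
  assumes fin: "finite I"
  defines "a \<equiv> \<lambda>k. of_bool (A k) :: real"
  defines "r \<equiv> real (card {k\<in>I. A k})"
  shows "(\<Sum>k\<in>I. \<Sum>k'\<in>I - {k}. a k * a k' - (\<Sum>k''\<in>I - {k, k'}. a k * a k' * a k'') / 2) = r * (r - 1) * (2 - r / 2)"
proof -
  have r: "(\<Sum>k\<in>I. a k) = r" using fin by (simp add: a_def r_def Int_def)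
  have "a k * a k' - (\<Sum>k''\<in>I - {k, k'}. a k * a k' * a k'') / 2 = a k * a k' * (2 - r / 2)"
    if "k \<in> I" "k' \<in> I - {k}" for k k'
  proof -
    have "I - {k, k'} = (I - {k}) - {k'}" by auto
    then have "(\<Sum>k''\<in>I - {k, k'}. a k'') = r - a k - a k'" using fin that by (simp add: sum_diff1 r)
    then show ?thesis by (auto simp: sum_distrib_left[symmetric] a_def algebra_simps)
  qed
  then have "(\<Sum>k\<in>I. \<Sum>k'\<in>I - {k}. a k * a k' - (\<Sum>k''\<in>I - {k, k'}. a k * a k' * a k'') / 2)
     = (\<Sum>k\<in>I. \<Sum>k'\<in>I - {k}. a k * a k' * (2 - r / 2))" by simp
  also have "\<dots> = (\<Sum>k\<in>I. a k * (r - a k) * (2 - r / 2))"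
    using fin by (intro sum.cong refl) (simp add: sum_distrib_left[symmetric] sum_distrib_right[symmetric] sum_diff1 r)
  also have "\<dots> = (\<Sum>k\<in>I. a k * (r - 1) * (2 - r / 2))"
    by (intro sum.cong refl) (simp add: a_def)
  also have "\<dots> = r * (r - 1) * (2 - r / 2)" by (simp add: sum_distrib_right[symmetric] r)
  finally show ?thesis .
qed

text \<open>A subcube with \<open>r \<ge> 2\<close> active coordinates has error at least
  \<open>r / 576\<close>. Counting active pairs alone would not do, since \<open>r * (r - 1)\<close>
  is not linear in the error; subtracting half of the triples repairs this. Only
  \<open>n div 500\<close> coordinates are used, so that the expected number of triples extending a
  pair is at most the probability of that pair.\<close>

lemma few_conflicts:
  assumes n: "10000 \<le> n" and f: "\<And>\<pi>. \<pi> \<in> sym_grp n \<Longrightarrow> f \<pi> \<in> {0, 1}"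
    and supp: "card (supp n m) \<le> 60 * n"
    and rows: "\<And>i. i \<in> {1..n} \<Longrightarrow> real n / 3 - 24 \<le> card {j\<in>{1..n}. m i j = 0}"
    and cols: "\<And>j. j \<in> {1..n} \<Longrightarrow> real n / 3 - 24 \<le> card {i\<in>{1..n}. m i j = 0}"
    and close: "pavg n (\<lambda>\<pi>. (f \<pi> - (b + lin n (\<lambda>i j. of_int (m i j)) \<pi>))\<^sup>2) \<le> \<epsilon>"
  shows "card (conflicts n m) \<le> 300000000000 * \<epsilon> * (real n)\<^sup>2"
proof -
  define q where "q = quad (\<lambda>i j. of_int (m i j))"
  \<comment> \<open>The divisor 500 is large enough for \<open>240 / 500 = 12 / 25 < 1\<close>,
    where 240 comes from the triples.\<close>
  define h s where "h = n div 2" and "s = n div 500"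
  have h: "2 * h \<le> n" "s \<le> h" by (auto simp: h_def s_def)
  have s: "real s \<le> real n / 500" "real n / 1000 \<le> real s - 1"
    using n unfolding s_def by linarith+
  define I where "I = {1..s}"
  define A where "A = (\<lambda>\<sigma> \<pi> k. q (\<sigma> k) (\<sigma> (k + h)) (\<pi> k) (\<pi> (k + h)) \<noteq> 0)"
  define a where "a = (\<lambda>\<sigma> \<pi> k. of_bool (A \<sigma> \<pi> k) :: real)"
  define W where "W = (\<lambda>\<sigma> \<pi>. \<Sum>k\<in>I. \<Sum>k'\<in>I - {k}. a \<sigma> \<pi> k * a \<sigma> \<pi> k' - (\<Sum>k''\<in>I - {k, k'}. a \<sigma> \<pi> k * a \<sigma> \<pi> k' * a \<sigma> \<pi> k'') / 2)"
  define av where "av = (\<lambda>G. pavg n (\<lambda>\<sigma>. pavg n (\<lambda>\<pi>. G \<sigma> \<pi>)))"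
  let ?D = "\<lambda>\<sigma> \<pi> k. quad (\<lambda>i j. of_int (m i j)) (\<sigma> k) (\<sigma> (k + h)) (\<pi> k) (\<pi> (k + h))"
  have "\<exists>\<eta>. pavg n (\<lambda>\<sigma>. pavg n (\<lambda>\<pi>. \<eta> \<sigma> \<pi>)) \<le> \<epsilon> \<and>
    (\<forall>\<sigma>\<in>sym_grp n. \<forall>\<pi>\<in>sym_grp n. 0 \<le> \<eta> \<sigma> \<pi> \<and>
        (\<Sum>k\<in>{1..h}. (?D \<sigma> \<pi> k - of_int (rd (?D \<sigma> \<pi> k)))\<^sup>2) \<le> 224 * \<eta> \<sigma> \<pi> \<and>
        real (card {k\<in>{1..h}. 1/2 \<le> \<bar>?D \<sigma> \<pi> k\<bar>}) \<le> 1 + 288 * \<eta> \<sigma> \<pi>)"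
    by (rule random_cube_fkn[where f=f, OF h(1) _ close]) (rule f)
  then obtain \<eta> where \<eta>: "av \<eta> \<le> \<epsilon>"
    "\<And>\<sigma> \<pi>. \<sigma> \<in> sym_grp n \<Longrightarrow> \<pi> \<in> sym_grp n \<Longrightarrow> 0 \<le> \<eta> \<sigma> \<pi>"
    "\<And>\<sigma> \<pi>. \<sigma> \<in> sym_grp n \<Longrightarrow> \<pi> \<in> sym_grp n \<Longrightarrow>
        real (card {k\<in>{1..h}. 1/2 \<le> \<bar>?D \<sigma> \<pi> k\<bar>}) \<le> 1 + 288 * \<eta> \<sigma> \<pi>"
    unfolding av_def by blast
  have W: "W \<sigma> \<pi> \<le> 576 * \<eta> \<sigma> \<pi>" if sp: "\<sigma> \<in> sym_grp n" "\<pi> \<in> sym_grp n" for \<sigma> \<pi>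
  proof -
    define r where "r = card {k\<in>I. A \<sigma> \<pi> k}"
    \<comment> \<open>The slopes of an integer matrix are integers, so a nonzero one has modulus at
      least 1.\<close>
    have act: "1/2 \<le> \<bar>?D \<sigma> \<pi> k\<bar>" if "A \<sigma> \<pi> k" for k
    proof -
      define z where "z = m (\<sigma> k) (\<pi> (k + h)) + m (\<sigma> (k + h)) (\<pi> k) - m (\<sigma> k) (\<pi> k) - m (\<sigma> (k + h)) (\<pi> (k + h))"
      have "?D \<sigma> \<pi> k = of_int z" by (simp add: quad_def z_def)
      moreover from this have "z \<noteq> 0" using that by (auto simp: A_def q_def)
      ultimately show ?thesis by simp
    qed
    have "r \<le> card {k\<in>{1..h}. 1/2 \<le> \<bar>?D \<sigma> \<pi> k\<bar>}"
      unfolding r_def by (rule card_mono) (use act h in \<open>auto simp: I_def\<close>)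
    then have r: "real r \<le> 1 + 288 * \<eta> \<sigma> \<pi>" using \<eta>(3)[OF sp] by linarith
    have "W \<sigma> \<pi> = real r * (real r - 1) * (2 - real r / 2)"
      unfolding W_def a_def r_def by (rule sum_pairs_minus_triples) (simp add: I_def)
    \<comment> \<open>For \<open>r \<ge> 2\<close> the bound \<open>r - 1 \<le> 288 * \<eta>\<close>
      gives \<open>r \<le> 2 * (r - 1) \<le> 576 * \<eta>\<close>.\<close>
    also have "\<dots> \<le> 576 * \<eta> \<sigma> \<pi>"
      by (rule nat_cubic_le) (use \<eta>(2)[OF sp] r in linarith)+
    finally show ?thesis .
  qed
  have avW: "av W \<le> 576 * \<epsilon>"
  proof -
    have "av W \<le> av (\<lambda>\<sigma> \<pi>. 576 * \<eta> \<sigma> \<pi>)" unfolding av_def by (intro pavg_mono W)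
    also have "\<dots> \<le> 576 * \<epsilon>" using \<eta>(1) by (simp add: av_def pavg_cmult)
    finally show ?thesis .
  qed
  \<comment> \<open>If \<open>k''\<close> is active, one of its four corners hits one of at most
    \<open>60 * n\<close> support entries. Given the values at the four positions of
    \<open>k\<close> and \<open>k'\<close>, a fixed corner hits a fixed entry with probability at
    most \<open>1 / (n - 4)\<^sup>2\<close>; this gives \<open>4 * 60 = 240\<close>.\<close>
  have triple: "(real n - 4)\<^sup>2 * av (\<lambda>\<sigma> \<pi>. a \<sigma> \<pi> k * a \<sigma> \<pi> k' * a \<sigma> \<pi> k'') \<le> 240 * real n * av (\<lambda>\<sigma> \<pi>. a \<sigma> \<pi> k * a \<sigma> \<pi> k')"
    if k: "k \<in> I" "k' \<in> I - {k}" "k'' \<in> I - {k, k'}" for k k' k''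
  proof -
    define P where "P = {k, k + h, k', k' + h}"
    define B where "B = {k'', k'' + h} \<times> {k'', k'' + h}"
    define G where "G = (\<lambda>\<sigma> \<pi>. a \<sigma> \<pi> k * a \<sigma> \<pi> k')"
    have range: "1 \<le> k" "k \<le> h" "1 \<le> k'" "k' \<le> h" "1 \<le> k''" "k'' \<le> h" "k \<noteq> k'" "k'' \<noteq> k" "k'' \<noteq> k'"
      using k h(2) by (auto simp: I_def)
    have P: "P \<subseteq> {1..n}" "card P = 4" using range h(1) by (auto simp: P_def)
    have B: "p \<in> {1..n} - P" "p' \<in> {1..n} - P" if "(p, p') \<in> B" for p p'
    proof -
      have "k'' \<in> {1..n} - P" "k'' + h \<in> {1..n} - P" using range h(1) by (auto simp: P_def)
      then show "p \<in> {1..n} - P" "p' \<in> {1..n} - P" using that by (auto simp: B_def)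
    qed
    have pt: "a \<sigma> \<pi> k'' \<le> (\<Sum>(p, p')\<in>B. \<Sum>(i, j)\<in>supp n m. of_bool (\<sigma> p = i \<and> \<pi> p' = j))"
      if sp: "\<sigma> \<in> sym_grp n" "\<pi> \<in> sym_grp n" for \<sigma> \<pi>
    proof (cases "A \<sigma> \<pi> k''")
      case True
      have "\<exists>p p'. (p, p') \<in> B \<and> m (\<sigma> p) (\<pi> p') \<noteq> 0"
      proof (rule ccontr)
        assume "\<not> ?thesis"
        then have "m (\<sigma> p) (\<pi> p') = 0" if "(p, p') \<in> B" for p p' using that by blast
        then show False using True by (simp add: A_def q_def quad_def B_def)
      qed
      then obtain p p' where p: "(p, p') \<in> B" "m (\<sigma> p) (\<pi> p') \<noteq> 0" by blast
      then have in_supp: "(\<sigma> p, \<pi> p') \<in> supp n m"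
        using sym_grp_in[OF sp(1), of p] sym_grp_in[OF sp(2), of p'] B by (simp add: supp_def)
      have "1 \<le> (\<Sum>(i, j)\<in>supp n m. of_bool (\<sigma> p = i \<and> \<pi> p' = j) :: real)"
        using member_le_sum[OF in_supp, of "\<lambda>(i, j). of_bool (\<sigma> p = i \<and> \<pi> p' = j) :: real"]
        by (simp add: case_prod_beta)
      also have "\<dots> \<le> (\<Sum>(p, p')\<in>B. \<Sum>(i, j)\<in>supp n m. of_bool (\<sigma> p = i \<and> \<pi> p' = j))"
        using member_le_sum[OF p(1), of "\<lambda>(p, p'). \<Sum>(i, j)\<in>supp n m. of_bool (\<sigma> p = i \<and> \<pi> p' = j) :: real"]
        by (simp add: case_prod_beta B_def sum_nonneg)
      finally show ?thesis by (simp add: a_def)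
    next
      case False
      then show ?thesis by (auto simp: a_def intro!: sum_nonneg)
    qed
    have Gdep: "G \<sigma> \<pi> = G \<sigma>' \<pi>'" if "\<And>x. x \<in> P \<Longrightarrow> \<sigma> x = \<sigma>' x" "\<And>x. x \<in> P \<Longrightarrow> \<pi> x = \<pi>' x" for \<sigma> \<sigma>' \<pi> \<pi>'
      using that by (simp add: G_def a_def A_def P_def)
    have G0: "0 \<le> G \<sigma> \<pi>" for \<sigma> \<pi> by (simp add: G_def a_def)
    have fresh: "(real n - 4)\<^sup>2 * av (\<lambda>\<sigma> \<pi>. G \<sigma> \<pi> * of_bool (\<sigma> p = i \<and> \<pi> p' = j)) \<le> av G"
      if "(p, p') \<in> B" for p p' i j
    proof -
      have "(real (n - card P))\<^sup>2 * av (\<lambda>\<sigma> \<pi>. G \<sigma> \<pi> * of_bool (\<sigma> p = i \<and> \<pi> p' = j)) \<le> av G"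
        unfolding av_def by (rule pavg_two_fresh_positions[OF P(1) B[OF that] G0]) (rule Gdep)
      then show ?thesis using P(2) n by (simp add: of_nat_diff)
    qed
    have "av (\<lambda>\<sigma> \<pi>. a \<sigma> \<pi> k * a \<sigma> \<pi> k' * a \<sigma> \<pi> k'')
       \<le> av (\<lambda>\<sigma> \<pi>. \<Sum>(p, p')\<in>B. \<Sum>(i, j)\<in>supp n m. G \<sigma> \<pi> * of_bool (\<sigma> p = i \<and> \<pi> p' = j))"
      unfolding av_def
    proof (intro pavg_mono)
      fix \<sigma> \<pi> assume sp: "\<sigma> \<in> sym_grp n" "\<pi> \<in> sym_grp n"
      have "a \<sigma> \<pi> k * a \<sigma> \<pi> k' * a \<sigma> \<pi> k'' \<le> G \<sigma> \<pi> * (\<Sum>(p, p')\<in>B. \<Sum>(i, j)\<in>supp n m. of_bool (\<sigma> p = i \<and> \<pi> p' = j))"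
        unfolding G_def[symmetric] using mult_left_mono[OF pt[OF sp] G0[of \<sigma> \<pi>]] by (simp add: G_def)
      then show "a \<sigma> \<pi> k * a \<sigma> \<pi> k' * a \<sigma> \<pi> k'' \<le> (\<Sum>(p, p')\<in>B. \<Sum>(i, j)\<in>supp n m. G \<sigma> \<pi> * of_bool (\<sigma> p = i \<and> \<pi> p' = j))"
        by (simp only: sum_distrib_left case_prod_beta case_prod_beta')
    qed
    also have "\<dots> = (\<Sum>(p, p')\<in>B. \<Sum>(i, j)\<in>supp n m. av (\<lambda>\<sigma> \<pi>. G \<sigma> \<pi> * of_bool (\<sigma> p = i \<and> \<pi> p' = j)))"
      unfolding av_def case_prod_beta pavg_sum by (rule refl)
    finally have "(real n - 4)\<^sup>2 * av (\<lambda>\<sigma> \<pi>. a \<sigma> \<pi> k * a \<sigma> \<pi> k' * a \<sigma> \<pi> k'')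
       \<le> (real n - 4)\<^sup>2 * (\<Sum>(p, p')\<in>B. \<Sum>(i, j)\<in>supp n m. av (\<lambda>\<sigma> \<pi>. G \<sigma> \<pi> * of_bool (\<sigma> p = i \<and> \<pi> p' = j)))"
      by (rule mult_left_mono) simp
    also have "\<dots> = (\<Sum>(p, p')\<in>B. \<Sum>(i, j)\<in>supp n m. (real n - 4)\<^sup>2 * av (\<lambda>\<sigma> \<pi>. G \<sigma> \<pi> * of_bool (\<sigma> p = i \<and> \<pi> p' = j)))"
      by (simp only: sum_distrib_left case_prod_beta case_prod_beta')
    also have "\<dots> \<le> (\<Sum>(p, p')\<in>B. \<Sum>(i, j)\<in>supp n m. av G)"
      by (rule sum_mono, clarify, rule sum_mono, clarify, rule fresh)
    also have "\<dots> = real (card B) * real (card (supp n m)) * av G" by (simp add: case_prod_beta)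
    also have "\<dots> \<le> 4 * (60 * real n) * av G"
    proof (intro mult_right_mono mult_mono)
      have "h \<noteq> 0" using n by (simp add: h_def)
      then show "real (card B) \<le> 4" by (simp add: B_def card_cartesian_product)
      show "real (card (supp n m)) \<le> 60 * real n" using supp by linarith
      show "0 \<le> av G" unfolding av_def by (intro pavg_nonneg G0)
    qed auto
    finally show ?thesis by (simp add: G_def)
  qed
  have pair: "card (conflicts n m) / (256 * real n ^ 4) \<le> av (\<lambda>\<sigma> \<pi>. a \<sigma> \<pi> k * a \<sigma> \<pi> k')"
    if k: "k \<in> I" "k' \<in> I - {k}" for k k'
  proof -
    have range: "1 \<le> k" "k \<le> s" "1 \<le> k'" "k' \<le> s" "k \<noteq> k'" using k by (auto simp: I_def)
    have "distinct [k, k + h, k', k' + h]" "set [k, k + h, k', k' + h] \<subseteq> {1..n}" using range h by auto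
    from pair_active_lower[OF n supp rows cols this]
    show ?thesis by (simp add: av_def a_def A_def q_def of_bool_conj)
  qed
  define Q where "Q = card (conflicts n m) / (256 * real n ^ 4)"
  have Q0: "0 \<le> Q" by (simp add: Q_def)
  have each: "Q / 2 \<le> av (\<lambda>\<sigma> \<pi>. a \<sigma> \<pi> k * a \<sigma> \<pi> k') - (\<Sum>k''\<in>I - {k, k'}. av (\<lambda>\<sigma> \<pi>. a \<sigma> \<pi> k * a \<sigma> \<pi> k' * a \<sigma> \<pi> k'')) / 2"
    if k: "k \<in> I" "k' \<in> I - {k}" for k k'
  proof -
    define p where "p = av (\<lambda>\<sigma> \<pi>. a \<sigma> \<pi> k * a \<sigma> \<pi> k')"
    have p: "Q \<le> p" unfolding Q_def p_def by (rule pair[OF k])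
    have p0: "0 \<le> p" using p Q0 by linarith
    have "(real n - 4)\<^sup>2 * (\<Sum>k''\<in>I - {k, k'}. av (\<lambda>\<sigma> \<pi>. a \<sigma> \<pi> k * a \<sigma> \<pi> k' * a \<sigma> \<pi> k''))
        \<le> (\<Sum>k''\<in>I - {k, k'}. 240 * real n * p)"
      unfolding sum_distrib_left p_def by (rule sum_mono) (rule triple[OF k])
    also have "\<dots> = real (card (I - {k, k'})) * (240 * real n * p)" by simp
    also have "\<dots> \<le> real s * (240 * real n * p)"
    proof (rule mult_right_mono)
      have "card (I - {k, k'}) \<le> card I" by (intro card_mono) (auto simp: I_def)
      then show "real (card (I - {k, k'})) \<le> real s" by (simp add: I_def)
    qed (use p0 in simp)
    also have "\<dots> \<le> (real n / 500) * (240 * real n * p)" using s p0 by (intro mult_right_mono) auto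
    also have "\<dots> = (12 / 25 * (real n)\<^sup>2) * p" by (simp add: power2_eq_square)
    also have "\<dots> \<le> (real n - 4)\<^sup>2 * p"
    proof (rule mult_right_mono[OF _ p0])
      have "real n * 8 \<le> real n * (13 / 25 * real n)" using n by (intro mult_left_mono) auto
      then show "12 / 25 * (real n)\<^sup>2 \<le> (real n - 4)\<^sup>2" by (simp add: power2_eq_square algebra_simps)
    qed
    finally have "(\<Sum>k''\<in>I - {k, k'}. av (\<lambda>\<sigma> \<pi>. a \<sigma> \<pi> k * a \<sigma> \<pi> k' * a \<sigma> \<pi> k'')) \<le> p"
      using n by (simp add: mult_le_cancel_left)
    then show ?thesis using p unfolding p_def[symmetric] by linarith
  qed
  have "real s * (real s - 1) * (Q / 2) = (\<Sum>k\<in>I. \<Sum>k'\<in>I - {k}. Q / 2)"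
    using s n by (simp add: I_def of_nat_diff)
  also have "\<dots> \<le> (\<Sum>k\<in>I. \<Sum>k'\<in>I - {k}. av (\<lambda>\<sigma> \<pi>. a \<sigma> \<pi> k * a \<sigma> \<pi> k') - (\<Sum>k''\<in>I - {k, k'}. av (\<lambda>\<sigma> \<pi>. a \<sigma> \<pi> k * a \<sigma> \<pi> k' * a \<sigma> \<pi> k'')) / 2)"
    by (intro sum_mono each)
  also have "\<dots> = av W"
    unfolding av_def W_def pavg_sum pavg_diff pavg_divide by (rule refl)
  also have "\<dots> \<le> 576 * \<epsilon>" by (rule avW)
  finally have "real s * (real s - 1) * (Q / 2) \<le> 576 * \<epsilon>" .
  moreover have "real n / 1000 * (real n / 1000) * (Q / 2) \<le> real s * (real s - 1) * (Q / 2)"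
    using s n Q0 by (intro mult_right_mono mult_mono) auto
  ultimately have "real n / 1000 * (real n / 1000) * (Q / 2) \<le> 576 * \<epsilon>" by linarith
  \<comment> \<open>The constant is \<open>2 * 576 * 256 = 294912\<close>, times
    \<open>1000\<^sup>2\<close> from the lower bound on \<open>s\<close>.\<close>
  then have le: "real (card (conflicts n m)) \<le> 294912000000 * \<epsilon> * (real n)\<^sup>2"
    using n unfolding Q_def by (simp add: field_simps power2_eq_square power4_eq_xxxx)
  have "0 \<le> av \<eta>" unfolding av_def by (intro pavg_nonneg \<eta>(2))
  then have "0 \<le> \<epsilon> * (real n)\<^sup>2" using \<eta>(1) by simp
  with le show ?thesis by linarith
qed

section \<open>Concentration on a line\<close>

text \<open>An entry off the line \<open>p = x\<close> agrees in \<open>q\<close> with at most one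
  entry on it, hence conflicts with all the others there, and these are about 3/8 of
  \<open>M\<close> or more. The coordinates \<open>p\<close>, \<open>q\<close> are abstract so that
  rows and columns are treated alike.\<close>

lemma heavy_line_covers:
  assumes fin: "finite M" and inj: "\<And>a b. a \<in> M \<Longrightarrow> b \<in> M \<Longrightarrow> p a = p b \<Longrightarrow> q a = q b \<Longrightarrow> a = b"
    and heavy: "3 * card M + 4 \<le> 8 * card {a\<in>M. p a = x}"
  shows "card {a\<in>M. p a \<noteq> x} * card M \<le> 6 * card {(a, b). a \<in> M \<and> b \<in> M \<and> p a \<noteq> p b \<and> q a \<noteq> q b}"
proof -
  define L Z N where "L = {a\<in>M. p a = x}" and "Z = {a\<in>M. p a \<noteq> x}"
    and "N = {(a, b). a \<in> M \<and> b \<in> M \<and> p a \<noteq> p b \<and> q a \<noteq> q b}"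
  have fins: "finite L" "finite Z" using fin by (auto simp: L_def Z_def)
  have finN: "finite N" by (rule finite_subset[of _ "M \<times> M"]) (use fin in \<open>auto simp: N_def\<close>)
  have split: "card M = card L + card Z"
  proof -
    have "card (L \<union> Z) = card L + card Z" by (rule card_Un_disjoint[OF fins]) (auto simp: L_def Z_def)
    moreover have "L \<union> Z = M" by (auto simp: L_def Z_def)
    ultimately show ?thesis by simp
  qed
  have line: "card L - 1 \<le> card {a\<in>L. q a \<noteq> q z}" for z
  proof -
    have "card {a\<in>L. q a = q z} \<le> 1"
      unfolding One_nat_def by (subst card_le_Suc0_iff_eq) (use fin in \<open>auto simp: L_def intro: inj\<close>)
    moreover have "card L \<le> card ({a\<in>L. q a \<noteq> q z} \<union> {a\<in>L. q a = q z})"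
      using fins by (intro card_mono) auto
    moreover have "\<dots> \<le> card {a\<in>L. q a \<noteq> q z} + card {a\<in>L. q a = q z}" by (rule card_Un_le)
    ultimately show ?thesis by linarith
  qed
  have "card Z * (card L - 1) = (\<Sum>z\<in>Z. card L - 1)" by simp
  also have "\<dots> \<le> (\<Sum>z\<in>Z. card {a\<in>L. q a \<noteq> q z})" by (rule sum_mono) (rule line)
  also have "\<dots> = card (Sigma Z (\<lambda>z. {a\<in>L. q a \<noteq> q z}))" using fins by simp
  also have "\<dots> \<le> card N" by (rule card_mono[OF finN]) (auto simp: Z_def L_def N_def)
  finally have "card Z * (card L - 1) \<le> card N" .
  then have "card Z * (6 * (card L - 1)) \<le> 6 * card N" by simp
  moreover have "card Z * card M \<le> card Z * (6 * (card L - 1))"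
  proof (cases "card L \<le> 1")
    case True
    then have "card Z = 0" using heavy split unfolding L_def[symmetric] by linarith
    then show ?thesis by simp
  next
    case False
    then show ?thesis using heavy unfolding L_def[symmetric] by (intro mult_le_mono2) linarith
  qed
  ultimately show ?thesis unfolding Z_def N_def by linarith
qed

text \<open>If no line were heavy, almost all pairs of entries would be in conflict.\<close>

lemma line_covers:
  assumes fin: "finite M" and ne: "M \<noteq> {}"
    and inj: "\<And>a b. a \<in> M \<Longrightarrow> b \<in> M \<Longrightarrow> p a = p b \<Longrightarrow> q a = q b \<Longrightarrow> a = b"
    and few: "4 * card {(a, b). a \<in> M \<and> b \<in> M \<and> p a \<noteq> p b \<and> q a \<noteq> q b} \<le> card M * card M"
  shows "(\<exists>x. card {a\<in>M. p a \<noteq> x} * card M \<le> 6 * card {(a, b). a \<in> M \<and> b \<in> M \<and> p a \<noteq> p b \<and> q a \<noteq> q b}) \<or>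
    (\<exists>y. card {a\<in>M. q a \<noteq> y} * card M \<le> 6 * card {(a, b). a \<in> M \<and> b \<in> M \<and> p a \<noteq> p b \<and> q a \<noteq> q b})"
proof (cases "(\<exists>x. 3 * card M + 4 \<le> 8 * card {a\<in>M. p a = x}) \<or> (\<exists>y. 3 * card M + 4 \<le> 8 * card {a\<in>M. q a = y})")
  case True
  then show ?thesis
  proof (elim disjE exE)
    fix x assume "3 * card M + 4 \<le> 8 * card {a\<in>M. p a = x}"
    with heavy_line_covers[OF fin inj this] show ?thesis by blast
  next
    fix y assume y: "3 * card M + 4 \<le> 8 * card {a\<in>M. q a = y}"
    have "card {a\<in>M. q a \<noteq> y} * card M \<le> 6 * card {(a, b). a \<in> M \<and> b \<in> M \<and> q a \<noteq> q b \<and> p a \<noteq> p b}"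
      by (rule heavy_line_covers[OF fin _ y]) (rule inj)
    also have "{(a, b). a \<in> M \<and> b \<in> M \<and> q a \<noteq> q b \<and> p a \<noteq> p b} = {(a, b). a \<in> M \<and> b \<in> M \<and> p a \<noteq> p b \<and> q a \<noteq> q b}"
      by auto
    finally show ?thesis by blast
  qed
next
  case False
  define c N where "c = card M" and "N = {(a, b). a \<in> M \<and> b \<in> M \<and> p a \<noteq> p b \<and> q a \<noteq> q b}"
  have finN: "finite N" by (rule finite_subset[of _ "M \<times> M"]) (use fin in \<open>auto simp: N_def\<close>)
  \<comment> \<open>A pair outside \<open>N\<close> agrees in \<open>p\<close> or in
    \<open>q\<close>. The diagonal is counted for \<open>p\<close> only, which saves the 1 that
    makes the final inequality strict.\<close>
  have "M \<times> M \<subseteq> N \<union> (Sigma M (\<lambda>a. {b\<in>M. p b = p a}) \<union> Sigma M (\<lambda>a. {b\<in>M. q b = q a} - {a}))"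
    by (auto simp: N_def)
  then have "card (M \<times> M) \<le> card (N \<union> (Sigma M (\<lambda>a. {b\<in>M. p b = p a}) \<union> Sigma M (\<lambda>a. {b\<in>M. q b = q a} - {a})))"
    using fin finN by (intro card_mono) auto
  also have "\<dots> \<le> card N + (card (Sigma M (\<lambda>a. {b\<in>M. p b = p a})) + card (Sigma M (\<lambda>a. {b\<in>M. q b = q a} - {a})))"
    by (rule order_trans[OF card_Un_le add_left_mono[OF card_Un_le]])
  also have "\<dots> = card N + (\<Sum>a\<in>M. card {b\<in>M. p b = p a} + (card {b\<in>M. q b = q a} - 1))"
    using fin by (simp add: sum.distrib card_Diff_singleton_if)
  finally have "c * c \<le> card N + (\<Sum>a\<in>M. card {b\<in>M. p b = p a} + (card {b\<in>M. q b = q a} - 1))"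
    by (simp only: c_def card_cartesian_product)
  then have "8 * (c * c) \<le> 8 * (card N + (\<Sum>a\<in>M. card {b\<in>M. p b = p a} + (card {b\<in>M. q b = q a} - 1)))"
    by (rule mult_le_mono2)
  also have "\<dots> = 8 * card N + (\<Sum>a\<in>M. 8 * (card {b\<in>M. p b = p a} + (card {b\<in>M. q b = q a} - 1)))"
    unfolding sum_distrib_left distrib_left[of _ "card N"] by (rule refl)
  also have "\<dots> \<le> 2 * (c * c) + (\<Sum>a\<in>M. 6 * c - 2)"
  proof (intro add_mono sum_mono)
    show "8 * card N \<le> 2 * (c * c)" using few by (simp add: N_def c_def)
    fix a assume a: "a \<in> M"
    have "\<not> 3 * c + 4 \<le> 8 * card {b\<in>M. p b = p a}" "\<not> 3 * c + 4 \<le> 8 * card {b\<in>M. q b = q a}"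
      using False unfolding c_def by blast+
    moreover have arith: "8 * (A + (B - 1)) \<le> 6 * c - 2" if "\<not> 3 * c + 4 \<le> 8 * A" "\<not> 3 * c + 4 \<le> 8 * B" "1 \<le> B" for A B
    proof -
      have "8 * A + 8 * B \<le> 6 * c + 6" using that by linarith
      then have "8 * (A + (B - 1)) + 2 \<le> 6 * c" using that(3) by (cases B) auto
      then show ?thesis by simp
    qed
    moreover have "1 \<le> card {b\<in>M. q b = q a}" using a fin by (auto simp: Suc_le_eq card_gt_0_iff)
    ultimately show "8 * (card {b\<in>M. p b = p a} + (card {b\<in>M. q b = q a} - 1)) \<le> 6 * c - 2"
      using arith by blast
  qed
  also have "\<dots> = 2 * (c * c) + c * (6 * c - 2)" by (simp add: c_def)
  also have "\<dots> < 8 * (c * c)"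
  proof -
    have "0 < c" using fin ne by (simp add: c_def card_gt_0_iff)
    then have "c * (6 * c - 2) < c * (6 * c)" by (intro mult_strict_left_mono) auto
    then show ?thesis by simp
  qed
  finally show ?thesis by simp
qed

section \<open>From a covering line to a dictator\<close>

lemma pavg_hit:
  assumes "O' \<subseteq> {1..n} \<times> {1..n}"
  shows "pavg n (\<lambda>\<pi>. of_bool (\<exists>(i, j)\<in>O'. \<pi> i = j)) \<le> card O' / real n"
proof -
  have fin: "finite O'" using assms finite_subset by blast
  have "pavg n (\<lambda>\<pi>. of_bool (\<exists>(i, j)\<in>O'. \<pi> i = j)) \<le> pavg n (\<lambda>\<pi>. \<Sum>(i, j)\<in>O'. of_bool (\<pi> i = j))"
  proof (rule pavg_mono)
    fix \<pi> :: "nat \<Rightarrow> nat"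
    show "of_bool (\<exists>(i, j)\<in>O'. \<pi> i = j) \<le> (\<Sum>(i, j)\<in>O'. of_bool (\<pi> i = j) :: real)"
    proof (cases "\<exists>(i, j)\<in>O'. \<pi> i = j")
      case True
      then obtain t where t: "t \<in> O'" "\<pi> (fst t) = snd t" by auto
      then show ?thesis
        using True member_le_sum[OF t(1), of "\<lambda>(i, j). of_bool (\<pi> i = j) :: real"] fin
        by (auto simp: case_prod_beta)
    qed (auto intro!: sum_nonneg)
  qed
  also have "\<dots> = (\<Sum>(i, j)\<in>O'. pavg n (\<lambda>\<pi>. of_bool (\<pi> i = j)))"
    unfolding case_prod_beta pavg_sum by (rule refl)
  also have "\<dots> = (\<Sum>t\<in>O'. 1 / real n)"
  proof (rule sum.cong[OF refl])
    fix t assume "t \<in> O'"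
    then have "fst t \<in> {1..n}" "snd t \<in> {1..n}" using assms by auto
    then show "(case t of (i, j) \<Rightarrow> pavg n (\<lambda>\<pi>. of_bool (\<pi> i = j))) = 1 / real n"
      using pavg_one_point[of "fst t" n "\<lambda>j. of_bool (j = snd t)"] by (simp add: case_prod_beta of_bool_def)
  qed
  finally show ?thesis by simp
qed

lemma lin_supported_row:
  assumes "\<pi> \<in> sym_grp n" "x \<in> {1..n}" "\<not> (\<exists>(i, j)\<in>{a\<in>supp n m. fst a \<noteq> x}. \<pi> i = j)"
  shows "lin n (\<lambda>i j. of_int (m i j)) \<pi> = of_int (m x (\<pi> x))"
proof -
  have "m i (\<pi> i) = 0" if "i \<in> {1..n} - {x}" for i
    using assms(3) that sym_grp_in[OF assms(1), of i] by (auto simp: supp_def)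
  then have "(\<Sum>i\<in>{1..n} - {x}. real_of_int (m i (\<pi> i))) = 0" by simp
  then show ?thesis using assms(2) by (simp add: lin_def sum_remove_one)
qed

lemma lin_supported_col:
  assumes "\<pi> \<in> sym_grp n" "y \<in> {1..n}" "\<not> (\<exists>(i, j)\<in>{a\<in>supp n m. snd a \<noteq> y}. \<pi> i = j)"
  shows "lin n (\<lambda>i j. of_int (m i j)) \<pi> = of_int (m (inv \<pi> y) y)"
proof -
  have x: "inv \<pi> y \<in> {1..n}" "\<pi> (inv \<pi> y) = y"
    using sym_grp_in[OF sym_grp_inv[OF assms(1)] assms(2)] sym_grp_inv_iff[OF assms(1)] by auto
  have "m i (\<pi> i) = 0" if "i \<in> {1..n} - {inv \<pi> y}" for i
    using assms(3) that sym_grp_in[OF assms(1), of i] sym_grp_inv_iff[OF assms(1), of i y] by (auto simp: supp_def)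
  then have "(\<Sum>i\<in>{1..n} - {inv \<pi> y}. real_of_int (m i (\<pi> i))) = 0" by simp
  then show ?thesis using x by (simp add: lin_def sum_remove_one)
qed

text \<open>The difference is an integer, and a nonzero integer has square at least 1.\<close>

lemma near_integer_function:
  assumes "\<And>\<pi>. \<pi> \<in> sym_grp n \<Longrightarrow> f \<pi> \<in> {0, 1}"
  shows "pavg n (\<lambda>\<pi>. of_bool (f \<pi> \<noteq> of_int b + lin n (\<lambda>i j. of_int (m i j)) \<pi>))
    \<le> pavg n (\<lambda>\<pi>. (f \<pi> - (of_int b + lin n (\<lambda>i j. of_int (m i j)) \<pi>))\<^sup>2)"
proof (rule pavg_mono)
  fix \<pi> assume \<pi>: "\<pi> \<in> sym_grp n"
  have "f \<pi> \<in> {of_int 0, of_int 1}" using assms[OF \<pi>] by simp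
  moreover have "of_int b + lin n (\<lambda>i j. of_int (m i j)) \<pi> = of_int (b + (\<Sum>i=1..n. m i (\<pi> i)))" by (simp add: lin_def)
  ultimately obtain z :: int where z: "f \<pi> - (of_int b + lin n (\<lambda>i j. of_int (m i j)) \<pi>) = of_int z"
    by (metis insert_iff of_int_diff singletonD)
  have "(1 :: real) \<le> (of_int z)\<^sup>2" if "z \<noteq> 0"
  proof -
    have "1 \<le> z\<^sup>2" using that by (simp add: int_one_le_iff_zero_less)
    then show ?thesis by (metis of_int_1_le_iff of_int_power)
  qed
  then have "of_bool (z \<noteq> 0) \<le> (of_int z :: real)\<^sup>2" by (cases "z = 0") auto
  moreover have "(f \<pi> \<noteq> of_int b + lin n (\<lambda>i j. of_int (m i j)) \<pi>) = (z \<noteq> 0)" using z by auto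
  ultimately show "of_bool (f \<pi> \<noteq> of_int b + lin n (\<lambda>i j. of_int (m i j)) \<pi>)
      \<le> (f \<pi> - (of_int b + lin n (\<lambda>i j. of_int (m i j)) \<pi>))\<^sup>2"
    unfolding z by simp
qed

text \<open>On a permutation that meets no nonzero entry the integer function is the constant
  \<open>b\<close>, while \<open>f\<close> differs from any constant with probability at least
  \<open>\<delta>\<close>.\<close>

lemma support_lower_bound:
  assumes f: "\<And>\<pi>. \<pi> \<in> sym_grp n \<Longrightarrow> f \<pi> \<in> {0, 1}"
    and near: "pavg n (\<lambda>\<pi>. of_bool (f \<pi> \<noteq> of_int b + lin n (\<lambda>i j. of_int (m i j)) \<pi>)) \<le> \<epsilon>"
    and \<delta>: "\<delta> \<le> pavg n f" "pavg n f \<le> 1 - \<delta>" "\<delta> \<le> 1"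
  shows "\<delta> \<le> \<epsilon> + card (supp n m) / real n"
proof -
  let ?F = "\<lambda>\<pi>. of_int b + lin n (\<lambda>i j. of_int (m i j)) \<pi>"
  have sub: "supp n m \<subseteq> {1..n} \<times> {1..n}" by (auto simp: supp_def)
  have "pavg n (\<lambda>\<pi>. of_bool (f \<pi> \<noteq> of_int b)) \<le>
     pavg n (\<lambda>\<pi>. of_bool (f \<pi> \<noteq> ?F \<pi>) + of_bool (\<exists>(i, j)\<in>supp n m. \<pi> i = j))"
  proof (rule pavg_mono)
    fix \<pi> assume \<pi>: "\<pi> \<in> sym_grp n"
    have "lin n (\<lambda>i j. of_int (m i j)) \<pi> = 0" if "\<not> (\<exists>(i, j)\<in>supp n m. \<pi> i = j)"
      unfolding lin_def using that sym_grp_in[OF \<pi>] by (intro sum.neutral) (auto simp: supp_def)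
    then show "of_bool (f \<pi> \<noteq> of_int b) \<le> of_bool (f \<pi> \<noteq> ?F \<pi>) + (of_bool (\<exists>(i, j)\<in>supp n m. \<pi> i = j) :: real)"
      by auto
  qed
  also have "\<dots> \<le> \<epsilon> + card (supp n m) / real n"
    unfolding pavg_add by (intro add_mono near pavg_hit sub)
  finally have *: "pavg n (\<lambda>\<pi>. of_bool (f \<pi> \<noteq> of_int b)) \<le> \<epsilon> + card (supp n m) / real n" .
  consider "b = 0" | "b = 1" | "b \<noteq> 0" "b \<noteq> 1" by blast
  then have "\<delta> \<le> pavg n (\<lambda>\<pi>. of_bool (f \<pi> \<noteq> of_int b))"
  proof cases
    case 1
    have "pavg n f = pavg n (\<lambda>\<pi>. of_bool (f \<pi> \<noteq> of_int b))"
      by (rule pavg_cong) (use f 1 in force)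
    then show ?thesis using \<delta> by simp
  next
    case 2
    have "pavg n (\<lambda>\<pi>. 1 - f \<pi>) = pavg n (\<lambda>\<pi>. of_bool (f \<pi> \<noteq> of_int b))"
      by (rule pavg_cong) (use f 2 in force)
    then show ?thesis using \<delta> by (simp add: pavg_diff)
  next
    case 3
    have "pavg n (\<lambda>\<pi>. 1) = pavg n (\<lambda>\<pi>. of_bool (f \<pi> \<noteq> of_int b))"
      by (rule pavg_cong) (use f 3 in force)
    then show ?thesis using \<delta> by simp
  qed
  with * show ?thesis by linarith
qed

text \<open>The support has at least \<open>\<delta> * n / 2\<close> entries and
  \<open>O(\<epsilon> * n\<^sup>2)\<close> conflicts, so some line misses only
  \<open>O(\<epsilon> * n / \<delta>)\<close> entries. On permutations avoiding those, the integer
  function depends on one value or one preimage.\<close>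

lemma large_case:
  assumes n: "10000 \<le> n" and f: "\<And>\<pi>. \<pi> \<in> sym_grp n \<Longrightarrow> f \<pi> \<in> {0, 1}"
    and m: "\<And>i j. m i j \<in> {-1, 0, 1}" "card (supp n m) \<le> 12 * n"
    and close: "pavg n (\<lambda>\<pi>. (f \<pi> - (of_int b + lin n (\<lambda>i j. of_int (m i j)) \<pi>))\<^sup>2) \<le> \<epsilon>"
    and \<delta>: "0 < \<delta>" "\<delta> \<le> pavg n f" "pavg n f \<le> 1 - \<delta>" and eps: "10000000000000 * \<epsilon> \<le> \<delta>\<^sup>2"
  shows "\<exists>g. dictator n g \<and> pavg n (\<lambda>\<pi>. of_bool (f \<pi> \<noteq> g \<pi>)) \<le> 10000000000000 * \<epsilon> / \<delta>"
proof -
  have \<delta>1: "\<delta> \<le> 1 / 2" using \<delta> by linarith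
  have \<delta>2: "\<delta>\<^sup>2 \<le> \<delta> / 2" using mult_left_mono[OF \<delta>1, of \<delta>] \<delta>(1) by (simp add: power2_eq_square)
  have "0 \<le> pavg n (\<lambda>\<pi>. (f \<pi> - (of_int b + lin n (\<lambda>i j. of_int (m i j)) \<pi>))\<^sup>2)" by (rule pavg_nonneg) simp
  then have \<epsilon>0: "0 \<le> \<epsilon>" using close by linarith
  obtain s m' where s: "\<forall>\<pi>\<in>sym_grp n. lin n (\<lambda>i j. of_int (m i j)) \<pi> = of_int s + lin n (\<lambda>i j. of_int (m' i j)) \<pi>"
     "card (supp n m') \<le> 60 * n"
     "\<forall>i\<in>{1..n}. real n / 3 - 24 \<le> card {j\<in>{1..n}. m' i j = 0}"
     "\<forall>j\<in>{1..n}. real n / 3 - 24 \<le> card {i\<in>{1..n}. m' i j = 0}"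
    using sparse_normal_form[OF m] by (elim exE conjE) (rule that)
  define F where "F = (\<lambda>\<pi>. of_int (b + s) + lin n (\<lambda>i j. of_int (m' i j)) \<pi>)"
  have close': "pavg n (\<lambda>\<pi>. (f \<pi> - F \<pi>)\<^sup>2) \<le> \<epsilon>"
  proof -
    have "pavg n (\<lambda>\<pi>. (f \<pi> - F \<pi>)\<^sup>2) = pavg n (\<lambda>\<pi>. (f \<pi> - (of_int b + lin n (\<lambda>i j. of_int (m i j)) \<pi>))\<^sup>2)"
      by (rule pavg_cong) (simp add: F_def s(1) add.assoc)
    then show ?thesis using close by simp
  qed
  have near: "pavg n (\<lambda>\<pi>. of_bool (f \<pi> \<noteq> F \<pi>)) \<le> \<epsilon>"
    using near_integer_function[where f=f and b="b + s" and m=m', OF f] close' unfolding F_def by (rule order_trans)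
  define M c N where "M = supp n m'" and "c = card M" and "N = conflicts n m'"
  have N: "card N \<le> 300000000000 * \<epsilon> * (real n)\<^sup>2"
    unfolding N_def by (rule few_conflicts[OF n f s(2) bspec[OF s(3)] bspec[OF s(4)] close'[unfolded F_def]])
  have N_eq: "N = {(x, y). x \<in> M \<and> y \<in> M \<and> fst x \<noteq> fst y \<and> snd x \<noteq> snd y}"
    by (auto simp: N_def M_def conflicts_def)
  have "\<delta> \<le> \<epsilon> + c / real n"
    using support_lower_bound[OF f near[unfolded F_def] \<delta>(2,3)] \<delta>1 by (simp add: c_def M_def)
  moreover have "\<epsilon> \<le> \<delta> / 2" using eps \<delta>2 \<epsilon>0 by linarith
  ultimately have "\<delta> / 2 \<le> c / real n" by linarith
  then have c: "\<delta> * real n \<le> 2 * real c" using n by (simp add: field_simps)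
  have c0: "0 < real c" using c \<delta>(1) n by (smt (verit) mult_pos_pos of_nat_0_less_iff zero_less_numeral order_less_le_trans)
  \<comment> \<open>Here \<open>\<epsilon> = O(\<delta>\<^sup>2)\<close> makes conflicts rare among
    all pairs of nonzero entries.\<close>
  have few: "4 * card N \<le> c * c"
  proof -
    have "4 * real (card N) \<le> 1200000000000 * \<epsilon> * (real n)\<^sup>2" using N by simp
    also have "\<dots> \<le> (\<delta>\<^sup>2 / 4) * (real n)\<^sup>2" using eps \<epsilon>0 by (intro mult_right_mono) auto
    also have "\<dots> = (\<delta> * real n)\<^sup>2 / 4" by (simp add: power_mult_distrib)
    also have "\<dots> \<le> (2 * real c)\<^sup>2 / 4" using c \<delta>(1) by (intro divide_right_mono power_mono) auto
    also have "\<dots> = real (c * c)" by (simp add: power2_eq_square)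
    finally show ?thesis by linarith
  qed
  have finM: "finite M" "M \<noteq> {}" using c0 by (auto simp: M_def c_def)
  have X1: "1 \<in> {1..n}" using n by simp
  have cover: "(\<exists>x. card {a\<in>M. fst a \<noteq> x} * c \<le> 6 * card N) \<or> (\<exists>y. card {a\<in>M. snd a \<noteq> y} * c \<le> 6 * card N)"
    unfolding N_eq c_def by (rule line_covers[OF finM]) (use few in \<open>auto simp: N_eq c_def prod_eq_iff\<close>)
  have finish: "\<exists>g. dictator n g \<and> pavg n (\<lambda>\<pi>. of_bool (f \<pi> \<noteq> g \<pi>)) \<le> 10000000000000 * \<epsilon> / \<delta>"
    if Z: "card Z * c \<le> 6 * card N" "Z \<subseteq> M"
      and line: "\<And>\<pi>. \<pi> \<in> sym_grp n \<Longrightarrow> \<not> (\<exists>(i, j)\<in>Z. \<pi> i = j) \<Longrightarrow> F \<pi> = P (h \<pi>)"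
      and dict: "\<And>Q. dictator n (\<lambda>\<pi>. if Q (h \<pi>) then 1 else 0)"
    for Z and P :: "nat \<Rightarrow> real" and h
  proof (intro exI conjI)
    let ?g = "\<lambda>\<pi>. if P (h \<pi>) = 1 then 1 else 0 :: real"
    show "dictator n ?g" by (rule dict)
    have "pavg n (\<lambda>\<pi>. of_bool (f \<pi> \<noteq> ?g \<pi>)) \<le> pavg n (\<lambda>\<pi>. of_bool (f \<pi> \<noteq> F \<pi>) + of_bool (\<exists>(i, j)\<in>Z. \<pi> i = j))"
    proof (rule pavg_mono)
      fix \<pi> assume \<pi>: "\<pi> \<in> sym_grp n"
      show "of_bool (f \<pi> \<noteq> ?g \<pi>) \<le> of_bool (f \<pi> \<noteq> F \<pi>) + (of_bool (\<exists>(i, j)\<in>Z. \<pi> i = j) :: real)"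
      proof (cases "f \<pi> = F \<pi> \<and> \<not> (\<exists>(i, j)\<in>Z. \<pi> i = j)")
        case True
        then have "f \<pi> = P (h \<pi>)" using line[OF \<pi>] by simp
        then have "f \<pi> = ?g \<pi>" using f[OF \<pi>] by auto
        then show ?thesis by simp
      qed auto
    qed
    also have "\<dots> \<le> \<epsilon> + card Z / real n"
      unfolding pavg_add using Z(2) by (intro add_mono near pavg_hit) (auto simp: M_def supp_def)
    \<comment> \<open>From \<open>card Z \<le> 6 * card N / c\<close> and
      \<open>c \<ge> \<delta> * n / 2\<close>, the size of \<open>Z\<close> is at most
      \<open>12 * card N / (\<delta> * n)\<close>; 12 times the constant of
      \<open>few_conflicts\<close> is \<open>3600000000000\<close>.\<close>
    also have "\<dots> \<le> \<epsilon> / \<delta> + 3600000000000 * \<epsilon> / \<delta>"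
    proof (rule add_mono)
      show "\<epsilon> \<le> \<epsilon> / \<delta>" using \<epsilon>0 \<delta>1 \<delta>(1) by (simp add: field_simps mult_left_le_one_le)
      have "real (card Z) * (\<delta> * real n) \<le> real (card Z) * (2 * real c)" by (rule mult_left_mono[OF c]) simp
      also have "\<dots> \<le> 12 * real (card N)"
      proof -
        have "real (card Z) * real c \<le> 6 * real (card N)"
          using of_nat_mono[OF Z(1), where 'a=real] by (simp only: of_nat_mult of_nat_numeral)
        then show ?thesis by linarith
      qed
      also have "\<dots> \<le> 3600000000000 * \<epsilon> * (real n)\<^sup>2" using N by simp
      finally show "card Z / real n \<le> 3600000000000 * \<epsilon> / \<delta>"
        using n \<delta>(1) by (simp add: field_simps power2_eq_square)
    qed
    also have "\<dots> \<le> 10000000000000 * \<epsilon> / \<delta>"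
    proof -
      have "0 \<le> \<epsilon> / \<delta>" using \<epsilon>0 \<delta>(1) by simp
      then show ?thesis by simp
    qed
    finally show "pavg n (\<lambda>\<pi>. of_bool (f \<pi> \<noteq> ?g \<pi>)) \<le> 10000000000000 * \<epsilon> / \<delta>" .
  qed
  have shrink: "card {a\<in>M. p a \<noteq> x} * c \<le> 6 * card N" if "card M * c \<le> 6 * card N" for p :: "nat \<times> nat \<Rightarrow> nat" and x
  proof -
    have "card {a\<in>M. p a \<noteq> x} \<le> card M" using finM by (intro card_mono) auto
    then show ?thesis using that by (meson le_trans mult_le_mono1)
  qed
  from cover show ?thesis
  proof (elim disjE exE)
    fix x assume x: "card {a\<in>M. fst a \<noteq> x} * c \<le> 6 * card N"
    obtain x' where x': "x' \<in> {1..n}" "card {a\<in>M. fst a \<noteq> x'} * c \<le> 6 * card N"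
    proof (cases "x \<in> {1..n}")
      case False
      then have "{a\<in>M. fst a \<noteq> x} = M" by (auto simp: M_def supp_def)
      then show ?thesis using that[OF X1] shrink x by simp
    qed (use x that in blast)
    show ?thesis
    proof (rule finish[OF x'(2)])
      show "F \<pi> = of_int (b + s) + of_int (m' x' (\<pi> x'))"
        if "\<pi> \<in> sym_grp n" "\<not> (\<exists>(i, j)\<in>{a\<in>M. fst a \<noteq> x'}. \<pi> i = j)" for \<pi>
        using lin_supported_row[OF that(1) x'(1)] that(2) by (simp add: F_def M_def)
      show "dictator n (\<lambda>\<pi>. if Q (\<pi> x') then 1 else 0)" for Q by (rule row_dictator[OF x'(1)])
    qed auto
  next
    fix y assume y: "card {a\<in>M. snd a \<noteq> y} * c \<le> 6 * card N"
    obtain y' where y': "y' \<in> {1..n}" "card {a\<in>M. snd a \<noteq> y'} * c \<le> 6 * card N"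
    proof (cases "y \<in> {1..n}")
      case False
      then have "{a\<in>M. snd a \<noteq> y} = M" by (auto simp: M_def supp_def)
      then show ?thesis using that[OF X1] shrink y by simp
    qed (use y that in blast)
    show ?thesis
    proof (rule finish[OF y'(2), where h="\<lambda>\<pi>. inv \<pi> y'"])
      show "F \<pi> = of_int (b + s) + of_int (m' (inv \<pi> y') y')"
        if "\<pi> \<in> sym_grp n" "\<not> (\<exists>(i, j)\<in>{a\<in>M. snd a \<noteq> y'}. \<pi> i = j)" for \<pi>
        using lin_supported_col[OF that(1) y'(1)] that(2) by (simp add: F_def M_def)
      show "dictator n (\<lambda>\<pi>. if Q (inv \<pi> y') then 1 else 0)" for Q by (rule col_dictator[OF y'(1)])
    qed auto
  qed
qed

text \<open>Probabilities are multiples of \<open>1 / n!\<close>, so the integer function agrees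
  with \<open>f\<close> everywhere and \<open>exact_dictator\<close> applies.\<close>

lemma small_case:
  assumes n: "2 \<le> n" and f: "\<And>\<pi>. \<pi> \<in> sym_grp n \<Longrightarrow> f \<pi> \<in> {0, 1}"
    and close: "pavg n (\<lambda>\<pi>. (f \<pi> - (of_int b + lin n (\<lambda>i j. of_int (m i j)) \<pi>))\<^sup>2) \<le> \<epsilon>"
    and eps: "\<epsilon> * fact n < 1"
  shows "\<exists>g. dictator n g \<and> pavg n (\<lambda>\<pi>. of_bool (f \<pi> \<noteq> g \<pi>)) = 0"
proof -
  let ?F = "\<lambda>\<pi>. of_int b + lin n (\<lambda>i j. of_int (m i j)) \<pi>"
  have "(\<Sum>\<pi>\<in>sym_grp n. of_bool (f \<pi> \<noteq> ?F \<pi>) :: real) \<le> \<epsilon> * fact n"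
    using order_trans[OF near_integer_function[OF f] close] by (simp add: pavg_def field_simps)
  moreover have "(\<Sum>\<pi>\<in>sym_grp n. of_bool (f \<pi> \<noteq> ?F \<pi>)) = real (card {\<pi>\<in>sym_grp n. f \<pi> \<noteq> ?F \<pi>})"
    by (simp add: Int_def)
  ultimately have "card {\<pi>\<in>sym_grp n. f \<pi> \<noteq> ?F \<pi>} = 0" using eps by linarith
  then have "{\<pi>\<in>sym_grp n. f \<pi> \<noteq> ?F \<pi>} = {}" by (subst (asm) card_0_eq) simp_all
  then have eqF: "f \<pi> = ?F \<pi>" if "\<pi> \<in> sym_grp n" for \<pi> using that by blast
  have "\<exists>g. dictator n g \<and> (\<forall>\<pi>\<in>sym_grp n. f \<pi> = g \<pi>)" using n f eqF by (rule exact_dictator)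
  then obtain g where g: "dictator n g" "\<forall>\<pi>\<in>sym_grp n. f \<pi> = g \<pi>" by blast
  have "pavg n (\<lambda>\<pi>. of_bool (f \<pi> \<noteq> g \<pi>)) = pavg n (\<lambda>\<pi>. 0)" by (rule pavg_cong) (use g in simp)
  then show ?thesis using g(1) by auto
qed

lemma linear_on_perms_lin:
  assumes "linear_on_perms n l"
  shows "\<exists>c. \<forall>\<pi>\<in>sym_grp n. l \<pi> = lin n c \<pi>"
proof -
  obtain c where c: "\<forall>\<pi>\<in>sym_grp n. l \<pi> = (\<Sum>i=1..n. \<Sum>j=1..n. c i j * perm_entry i j \<pi>)"
    using assms unfolding linear_on_perms_def by blast
  have "(\<Sum>j=1..n. c i j * perm_entry i j \<pi>) = c i (\<pi> i)" if "\<pi> \<in> sym_grp n" "i \<in> {1..n}" for \<pi> i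
    using sym_grp_in[OF that] by (simp add: perm_entry_def if_distrib[of "(*) _"] cong: if_cong)
  then show ?thesis using c by (intro exI[of _ c]) (simp add: lin_def)
qed

text \<open>The cutoff \<open>t\<close> separates \<open>large_case\<close> from
  \<open>small_case\<close>. The factor \<open>fact t\<close> in the bound on \<open>K\<close> gives
  \<open>22000 * \<epsilon> * fact n < 1\<close> for \<open>n < t\<close>, and \<open>10^18\<close>
  leaves room for \<open>10^13 * 22000\<close>.\<close>

lemma near_linear_dictator:
  fixes \<epsilon> \<delta> K :: real and t :: nat
  assumes n: "1 \<le> n" and \<epsilon>0: "0 \<le> \<epsilon>" and \<delta>0: "0 < \<delta>" and \<delta>K: "K * sqrt \<epsilon> \<le> \<delta>"
    and K: "1000000000000000000 * fact t \<le> K" and t: "10000 \<le> t"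
    and f: "\<And>\<pi>. \<pi> \<in> sym_grp n \<Longrightarrow> f \<pi> \<in> {0, 1}"
    and close: "pavg n (\<lambda>\<pi>. (f \<pi> - lin n c \<pi>)\<^sup>2) \<le> \<epsilon>"
    and \<delta>: "\<delta> \<le> pavg n f" "pavg n f \<le> 1 - \<delta>"
  shows "\<exists>g. dictator n g \<and> pavg n (\<lambda>\<pi>. of_bool (f \<pi> \<noteq> g \<pi>)) \<le> 1000000000000000000 * \<epsilon> / \<delta>"
proof -
  have \<delta>1: "\<delta> \<le> 1 / 2" using \<delta> by linarith
  have \<delta>2: "\<delta>\<^sup>2 \<le> 1 / 4" using power_mono[OF \<delta>1, of 2] \<delta>0 by (simp add: power_divide)
  have ft: "1 \<le> (fact t :: real)" by (rule fact_ge_1)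
  then have K1: "1 \<le> K" using K by linarith
  \<comment> \<open>Squaring the hypothesis gives
    \<open>K\<^sup>2 * \<epsilon> \<le> \<delta>\<^sup>2\<close>; one factor
    \<open>K \<ge> 1\<close> is then given away.\<close>
  have "(K * sqrt \<epsilon>)\<^sup>2 \<le> \<delta>\<^sup>2" using \<delta>K K1 \<epsilon>0 by (intro power_mono) auto
  moreover have "(K * sqrt \<epsilon>)\<^sup>2 = K * (K * \<epsilon>)"
    using \<epsilon>0 by (simp only: power_mult_distrib real_sqrt_pow2) (simp add: power2_eq_square)
  ultimately have "K * (K * \<epsilon>) \<le> \<delta>\<^sup>2" by simp
  moreover have "K * \<epsilon> \<le> K * (K * \<epsilon>)" using mult_right_mono[OF K1, of "K * \<epsilon>"] K1 \<epsilon>0 by simp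
  moreover have "1000000000000000000 * fact t * \<epsilon> \<le> K * \<epsilon>" by (rule mult_right_mono[OF K \<epsilon>0])
  ultimately have eps: "1000000000000000000 * (fact t * \<epsilon>) \<le> \<delta>\<^sup>2" by simp
  have tE: "\<epsilon> \<le> fact t * \<epsilon>" using mult_right_mono[OF ft \<epsilon>0] by simp
  \<comment> \<open>For \<open>n = 1\<close> the mean of \<open>f\<close> is 0 or 1, which
    \<open>\<delta> > 0\<close> excludes.\<close>
  have "n \<noteq> 1"
  proof
    assume "n = 1"
    then have "card (sym_grp n) = 1" by (simp add: card_sym_grp)
    then obtain \<pi> where \<pi>: "sym_grp n = {\<pi>}" by (rule card_1_singletonE)
    then have "pavg n f = f \<pi>" using \<open>n = 1\<close> by (simp add: pavg_def)
    then show False using f[of \<pi>] \<pi> \<delta> \<delta>0 by auto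
  qed
  then have n2: "2 \<le> n" using n by simp
  have "\<epsilon> \<le> 1 / 288" using eps tE \<delta>2 by linarith
  then have "\<exists>(b :: int) (m :: nat \<Rightarrow> nat \<Rightarrow> int). (\<forall>i j. m i j \<in> {-1, 0, 1}) \<and>
     card (supp n m) \<le> 12 * n \<and>
     pavg n (\<lambda>\<pi>. (f \<pi> - (of_int b + lin n (\<lambda>i j. of_int (m i j)) \<pi>))\<^sup>2) \<le> 22000 * \<epsilon>"
    unfolding supp_def by (intro integer_approximation[OF n2 f close \<epsilon>0])
  then obtain b m where m: "\<And>i j. m i j \<in> {-1, 0, 1 :: int}" "card (supp n m) \<le> 12 * n"
    and close': "pavg n (\<lambda>\<pi>. (f \<pi> - (of_int b + lin n (\<lambda>i j. of_int (m i j)) \<pi>))\<^sup>2) \<le> 22000 * \<epsilon>"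
    by blast
  show ?thesis
  proof (cases "t \<le> n")
    case True
    have "\<exists>g. dictator n g \<and> pavg n (\<lambda>\<pi>. of_bool (f \<pi> \<noteq> g \<pi>)) \<le> 10000000000000 * (22000 * \<epsilon>) / \<delta>"
      by (rule large_case[OF _ f m close' \<delta>0 \<delta>]) (use True t eps tE \<epsilon>0 in linarith)+
    then obtain g where g: "dictator n g" "pavg n (\<lambda>\<pi>. of_bool (f \<pi> \<noteq> g \<pi>)) \<le> 10000000000000 * (22000 * \<epsilon>) / \<delta>"
      by blast
    have "10000000000000 * (22000 * \<epsilon>) / \<delta> \<le> 1000000000000000000 * \<epsilon> / \<delta>"
      using \<epsilon>0 \<delta>0 by (intro divide_right_mono) auto
    then show ?thesis using g by (meson order_trans)
  next
    case False
    have "(fact n :: real) \<le> fact t" using False by (intro fact_mono) simp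
    then have "\<epsilon> * fact n \<le> \<epsilon> * fact t" by (rule mult_left_mono[OF _ \<epsilon>0])
    moreover have "\<epsilon> * fact t = fact t * \<epsilon>" by simp
    ultimately have "22000 * \<epsilon> * fact n < 1" using eps \<delta>2 by linarith
    with n2 f close' have "\<exists>g. dictator n g \<and> pavg n (\<lambda>\<pi>. of_bool (f \<pi> \<noteq> g \<pi>)) = 0" by (rule small_case)
    then obtain g where "dictator n g" "pavg n (\<lambda>\<pi>. of_bool (f \<pi> \<noteq> g \<pi>)) = 0" by blast
    moreover have "0 \<le> 1000000000000000000 * \<epsilon> / \<delta>" using \<epsilon>0 \<delta>0 by simp
    ultimately show ?thesis by auto
  qed
qed

theorem theorem1p5:
  shows "\<exists>K K' :: real. K > 0 \<and> K' > 0 \<and>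
    (\<forall>(n :: nat) (\<epsilon> :: real) (\<delta> :: real) (f :: (nat \<Rightarrow> nat) \<Rightarrow> real).
       n \<ge> 1 \<longrightarrow> \<epsilon> \<ge> 0 \<longrightarrow> \<delta> > 0 \<longrightarrow> \<delta> \<ge> K * sqrt \<epsilon> \<longrightarrow>
       (\<forall>\<pi>\<in>sym_grp n. f \<pi> \<in> {0, 1}) \<longrightarrow>
       (\<exists>l. linear_on_perms n l \<and>
            measure_pmf.expectation (unif_perm n) (\<lambda>\<pi>. (f \<pi> - l \<pi>)\<^sup>2) \<le> \<epsilon>) \<longrightarrow>
       \<delta> \<le> measure_pmf.expectation (unif_perm n) f \<longrightarrow>
       measure_pmf.expectation (unif_perm n) f \<le> 1 - \<delta> \<longrightarrow>
       (\<exists>g. dictator n g \<and>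
            measure_pmf.prob (unif_perm n) {\<pi>. f \<pi> \<noteq> g \<pi>} \<le> K' * \<epsilon> / \<delta>))"
proof -
  \<comment> \<open>\<open>t\<close> stays opaque, otherwise \<open>fact t\<close> would be evaluated.\<close>
  obtain t :: nat where t: "10000 \<le> t" by blast
  define K :: real where "K = 1000000000000000000 * fact t"
  have K: "K > 0" by (simp add: K_def)
  have main: "\<exists>g. dictator n g \<and> measure_pmf.prob (unif_perm n) {\<pi>. f \<pi> \<noteq> g \<pi>} \<le> 1000000000000000000 * \<epsilon> / \<delta>"
    if "1 \<le> n" "0 \<le> \<epsilon>" "0 < \<delta>" "K * sqrt \<epsilon> \<le> \<delta>" and f: "\<forall>\<pi>\<in>sym_grp n. f \<pi> \<in> {0, 1}"
      and l: "\<exists>l. linear_on_perms n l \<and> measure_pmf.expectation (unif_perm n) (\<lambda>\<pi>. (f \<pi> - l \<pi>)\<^sup>2) \<le> \<epsilon>"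
      and \<delta>: "\<delta> \<le> measure_pmf.expectation (unif_perm n) f" "measure_pmf.expectation (unif_perm n) f \<le> 1 - \<delta>"
    for n \<epsilon> \<delta> and f :: "(nat \<Rightarrow> nat) \<Rightarrow> real"
  proof -
    obtain l where l: "linear_on_perms n l" "pavg n (\<lambda>\<pi>. (f \<pi> - l \<pi>)\<^sup>2) \<le> \<epsilon>"
      using l by (auto simp: expectation_unif_perm)
    obtain c where c: "\<forall>\<pi>\<in>sym_grp n. l \<pi> = lin n c \<pi>" using linear_on_perms_lin[OF l(1)] by blast
    have "pavg n (\<lambda>\<pi>. (f \<pi> - lin n c \<pi>)\<^sup>2) = pavg n (\<lambda>\<pi>. (f \<pi> - l \<pi>)\<^sup>2)"
      by (rule pavg_cong) (simp add: c)
    then have "pavg n (\<lambda>\<pi>. (f \<pi> - lin n c \<pi>)\<^sup>2) \<le> \<epsilon>" using l(2) by simp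
    from near_linear_dictator[OF that(1-4) _ t bspec[OF f] this \<delta>[unfolded expectation_unif_perm]]
    obtain g where g: "dictator n g" "pavg n (\<lambda>\<pi>. of_bool (f \<pi> \<noteq> g \<pi>)) \<le> 1000000000000000000 * \<epsilon> / \<delta>"
      by (auto simp: K_def)
    moreover have "measure_pmf.prob (unif_perm n) {\<pi>. f \<pi> \<noteq> g \<pi>} = pavg n (\<lambda>\<pi>. of_bool (f \<pi> \<noteq> g \<pi>))"
      by (simp add: prob_unif_perm pavg_def Int_def)
    ultimately show ?thesis by auto
  qed
  show ?thesis
    by (intro exI[of _ K] exI[of _ "1000000000000000000"] conjI allI impI K main) auto
qed

end
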